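(* Let $X$ be an infinite dimensional complex Banach space and let $T\in L(X)$, with dual operator $T^*\in L(X^* )$. Then: (i) $T^*$ has the SVEP at every point of $\mathbb{C}\setminus\sigma_{uw}(T)$ if and only if $T$ satisfies property $(az)$. (ii) $T$ has the SVEP at every point of $\mathbb{C}\setminus\sigma_{lw}(T)$ if and only if $T^*$ satisfies property $(az)$.
   Context: $L(X)$ is the algebra of bounded linear operators on $X$. For a bounded operator $T$ (on $X$, and likewise on any Banach space such as $X^*$): $N(T)$ is the kernel, $R(T)$ the range, $\alpha(T)=\dim N(T)$, $\beta(T)=\operatorname{codim} R(T)$; $\sigma(T)$ is the spectrum and $\sigma_a(T)$ the approximate point spectrum. $T$ is upper semi-Fredholm if $R(T)$ is closed and $\alpha(T)<\infty$; lower semi-Fredholm if $R(T)$ is closed and $\beta(T)<\infty$; in either case $\operatorname{ind}T=\alpha(T)-\beta(T)$. $T$ is upper semi-Weyl if it is upper semi-Fredholm with $\operatorname{ind}T\le 0$, and lower semi-Weyl if it is lower semi-Fredholm with $\operatorname{ind}T\ge 0$. $\sigma_{uw}(T)$ (resp. $\sigma_{lw}(T)$) is the set of $\lambda\in\mathbb{C}$ such that $T-\lambda I$ is not upper (resp. lower) semi-Weyl. The ascent is $a(T)=\inf\{n\ge 0: N(T^n)=N(T^{n+1})\}$ (with $\inf\emptyset=\infty$). A point $\lambda\in\sigma_a(T)$ is a left pole of $T$ if $p=a(T-\lambda I)<\infty$ and $R((T-\lambda I)^{p+1})$ is closed; it is of finite rank if moreover $\alpha(T-\lambda I)<\infty$.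 $p_{00}^a(T)$ is the set of left poles of $T$ of finite rank. $T$ satisfies property $(az)$ if $\sigma(T)\setminus\sigma_{uw}(T)=p_{00}^a(T)$. $T$ has the SVEP (single valued extension property) at $\lambda_0\in\mathbb{C}$ if for every open neighborhood $U$ of $\lambda_0$ the only analytic function $f:U\to X$ with $(T-\lambda I)f(\lambda)=0$ for all $\lambda\in U$ is $f\equiv 0$.
   Formalization: In the definition of the SVEP at a point, the open neighborhoods U are required to be connected; with disconnected U allowed, SVEP at one point would mean SVEP everywhere and the theorem would fail (e.g. for an infinite direct sum of copies of left shift plus right shift). *)

theory Defs
  imports "HOL-Analysis.Analysis"
begin

section \<open>Complex Banach spaces\<close>

class scaleC =
  fixes scaleC :: "complex \<Rightarrow> 'a \<Rightarrow> 'a"  (infixr "*\<^sub>C" 75)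

class complex_normed_vector = scaleC + real_normed_vector +
  assumes scaleC_add_right: "a *\<^sub>C (x + y) = a *\<^sub>C x + a *\<^sub>C y"
    and scaleC_add_left: "(a + b) *\<^sub>C x = a *\<^sub>C x + b *\<^sub>C x"
    and scaleC_scaleC: "a *\<^sub>C (b *\<^sub>C x) = (a * b) *\<^sub>C x"
    and scaleC_one: "1 *\<^sub>C x = x"
    and scaleR_scaleC: "r *\<^sub>R x = complex_of_real r *\<^sub>C x"
    and norm_scaleC: "norm (a *\<^sub>C x) = cmod a * norm x"

class complex_banach = complex_normed_vector + banach

global_interpretation complex_vector:
  vector_space "scaleC :: complex \<Rightarrow> 'a \<Rightarrow> 'a::complex_normed_vector"
  defines csubspace = complex_vector.subspace
    and cspan = complex_vector.span
    and cdependent_raw = complex_vector.dependent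
    and cdim_raw = complex_vector.dim
    and crepresentation_raw = complex_vector.representation
    and cextend_basis_raw = complex_vector.extend_basis
  by unfold_locales (simp_all add: scaleC_add_right scaleC_add_left scaleC_scaleC scaleC_one)

instantiation complex :: complex_banach
begin

definition scaleC_complex :: "complex \<Rightarrow> complex \<Rightarrow> complex"
  where "scaleC_complex a z = a * z"

instance
  by standard (simp_all add: scaleC_complex_def algebra_simps scaleR_conv_of_real norm_mult)

end

text \<open>The library's \<^term>\<open>vector_space.dim\<close> is a natural number with junk value 0 on
  infinite dimensional spaces; here the value is \<open>\<infinity>\<close> in that case.\<close>

definition cdimension :: "'a::complex_normed_vector set \<Rightarrow> enat" where
  "cdimension V = (if \<exists>B. finite B \<and> V \<subseteq> cspan B then enat (cdim_raw V) else \<infinity>)"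

text \<open>The codimension of a subspace is the dimension of an algebraic complement; complements exist
  and are all isomorphic to the quotient space.\<close>

definition ccomplement :: "'a::complex_normed_vector set \<Rightarrow> 'a set \<Rightarrow> bool" where
  "ccomplement V M \<longleftrightarrow> csubspace M \<and> V \<inter> M = {0} \<and> (\<forall>x. \<exists>v\<in>V. \<exists>m\<in>M. x = v + m)"

definition ccodimension :: "'a::complex_normed_vector set \<Rightarrow> enat" where
  "ccodimension V = cdimension (SOME M. ccomplement V M)"


section \<open>Bounded operators and the dual space\<close>

definition bounded_clinear ::
    "('a::complex_normed_vector \<Rightarrow> 'b::complex_normed_vector) \<Rightarrow> bool" where
  "bounded_clinear f \<longleftrightarrow> bounded_linear f \<and> (\<forall>c x. f (c *\<^sub>C x) = c *\<^sub>C f x)"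

lemma bounded_clinear_add:
  "bounded_clinear f \<Longrightarrow> bounded_clinear g \<Longrightarrow> bounded_clinear (\<lambda>x. f x + g x)"
  by (auto simp: bounded_clinear_def bounded_linear_add scaleC_add_right)

lemma bounded_clinear_uminus:
  "bounded_clinear f \<Longrightarrow> bounded_clinear (\<lambda>x. - f x)"
  by (auto simp: bounded_clinear_def bounded_linear_minus)

lemma bounded_clinear_diff:
  "bounded_clinear f \<Longrightarrow> bounded_clinear g \<Longrightarrow> bounded_clinear (\<lambda>x. f x - g x)"
  using bounded_clinear_add[OF _ bounded_clinear_uminus, of f g] by simp

lemma bounded_linear_scaleC: "bounded_linear (\<lambda>x::'a::complex_normed_vector. c *\<^sub>C x)"
  by (rule bounded_linear_intro[where K = "cmod c"])
    (simp_all add: scaleC_add_right scaleR_scaleC scaleC_scaleC norm_scaleC mult.commute)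

lemma bounded_clinear_scaleC:
  "bounded_clinear f \<Longrightarrow> bounded_clinear (\<lambda>x. c *\<^sub>C f x)"
  unfolding bounded_clinear_def
  using bounded_linear_compose[OF bounded_linear_scaleC, of f c]
  by (auto simp: scaleC_scaleC mult.commute)

lemma bounded_clinear_zero: "bounded_clinear (\<lambda>x. 0)"
  by (simp add: bounded_clinear_def)

lemma bounded_clinear_compose:
  "bounded_clinear f \<Longrightarrow> bounded_clinear g \<Longrightarrow> bounded_clinear (\<lambda>x. f (g x))"
  by (auto simp: bounded_clinear_def bounded_linear_compose)

text \<open>The topological dual: all bounded complex-linear functionals, with the operator norm.\<close>

typedef (overloaded) 'a cdual =
    "{f :: 'a::complex_normed_vector \<Rightarrow> complex. bounded_clinear f}"
  morphisms cdual_apply Cdual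
  using bounded_clinear_zero by blast

setup_lifting type_definition_cdual

instantiation cdual :: (complex_normed_vector) complex_normed_vector
begin

lift_definition zero_cdual :: "'a cdual" is "\<lambda>x. 0" by (rule bounded_clinear_zero)

lift_definition plus_cdual :: "'a cdual \<Rightarrow> 'a cdual \<Rightarrow> 'a cdual" is "\<lambda>f g x. f x + g x"
  by (rule bounded_clinear_add)

lift_definition minus_cdual :: "'a cdual \<Rightarrow> 'a cdual \<Rightarrow> 'a cdual" is "\<lambda>f g x. f x - g x"
  by (rule bounded_clinear_diff)

lift_definition uminus_cdual :: "'a cdual \<Rightarrow> 'a cdual" is "\<lambda>f x. - f x"
  by (rule bounded_clinear_uminus)

lift_definition scaleC_cdual :: "complex \<Rightarrow> 'a cdual \<Rightarrow> 'a cdual" is "\<lambda>c f x. c *\<^sub>C f x"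
  by (rule bounded_clinear_scaleC)

definition scaleR_cdual :: "real \<Rightarrow> 'a cdual \<Rightarrow> 'a cdual"
  where "scaleR_cdual r f = complex_of_real r *\<^sub>C f"

lift_definition norm_cdual :: "'a cdual \<Rightarrow> real" is onorm .

definition dist_cdual :: "'a cdual \<Rightarrow> 'a cdual \<Rightarrow> real"
  where "dist_cdual f g = norm (f - g)"

definition sgn_cdual :: "'a cdual \<Rightarrow> 'a cdual"
  where "sgn_cdual f = inverse (norm f) *\<^sub>R f"

definition uniformity_cdual :: "('a cdual \<times> 'a cdual) filter"
  where "uniformity_cdual = (INF e\<in>{0 <..}. principal {(x, y). dist x y < e})"

definition open_cdual :: "'a cdual set \<Rightarrow> bool"
  where "open_cdual U \<longleftrightarrow> (\<forall>x\<in>U. eventually (\<lambda>(x', y). x' = x \<longrightarrow> y \<in> U) uniformity)"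

instance
proof
  fix f g h :: "'a cdual" and a b :: complex and r s :: real and U :: "'a cdual set"
  show "f + g + h = f + (g + h)" by transfer (simp add: add.assoc)
  show "f + g = g + f" by transfer (simp add: add.commute)
  show "0 + f = f" by transfer simp
  show "- f + f = 0" by transfer simp
  show "f - g = f + - g" by transfer simp
  have c1: "a *\<^sub>C (f + g) = a *\<^sub>C f + a *\<^sub>C g" for a
    by transfer (simp add: scaleC_add_right)
  then show "a *\<^sub>C (f + g) = a *\<^sub>C f + a *\<^sub>C g" .
  have c2: "(a + b) *\<^sub>C f = a *\<^sub>C f + b *\<^sub>C f" for a b
    by transfer (simp add: scaleC_add_left)
  then show "(a + b) *\<^sub>C f = a *\<^sub>C f + b *\<^sub>C f" .
  have c3: "a *\<^sub>C (b *\<^sub>C f) = (a * b) *\<^sub>C f" for a b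
    by transfer (simp add: scaleC_scaleC)
  then show "a *\<^sub>C (b *\<^sub>C f) = (a * b) *\<^sub>C f" .
  show c4: "1 *\<^sub>C f = f" by transfer (simp add: scaleC_one)
  show "r *\<^sub>R f = complex_of_real r *\<^sub>C f" by (simp add: scaleR_cdual_def)
  show "r *\<^sub>R (f + g) = r *\<^sub>R f + r *\<^sub>R g" by (simp add: scaleR_cdual_def c1)
  show "(r + s) *\<^sub>R f = r *\<^sub>R f + s *\<^sub>R f" by (simp add: scaleR_cdual_def c2)
  show "r *\<^sub>R s *\<^sub>R f = (r * s) *\<^sub>R f" by (simp add: scaleR_cdual_def c3)
  show "1 *\<^sub>R f = f" by (simp add: scaleR_cdual_def c4)
  show "dist f g = norm (f - g)" by (simp add: dist_cdual_def)
  show "sgn f = inverse (norm f) *\<^sub>R f" by (simp add: sgn_cdual_def)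
  show "uniformity = (INF e\<in>{0 <..}. principal {(x, y :: 'a cdual). dist x y < e})"
    by (simp add: uniformity_cdual_def)
  show "open U \<longleftrightarrow> (\<forall>x\<in>U. eventually (\<lambda>(x', y). x' = x \<longrightarrow> y \<in> U) uniformity)"
    by (simp add: open_cdual_def)
  show "norm f = 0 \<longleftrightarrow> f = 0"
    by transfer (auto simp: bounded_clinear_def onorm_eq_0 fun_eq_iff)
  show "norm (f + g) \<le> norm f + norm g"
    by transfer (auto simp: bounded_clinear_def intro: onorm_triangle)
  have nC: "norm (a *\<^sub>C f) = cmod a * norm f" for a
  proof transfer
    fix a :: complex and f :: "'a \<Rightarrow> complex"
    assume f: "bounded_clinear f"
    have bf: "bounded_linear f" using f by (simp add: bounded_clinear_def)
    show "onorm (\<lambda>x. a *\<^sub>C f x) = cmod a * onorm f"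
    proof (cases "a = 0")
      case True
      then show ?thesis by (simp add: scaleC_complex_def onorm_zero)
    next
      case False
      have le: "onorm (\<lambda>x. c * g x) \<le> cmod c * onorm g" if "bounded_linear g"
        for c and g :: "'a \<Rightarrow> complex"
      proof (rule onorm_bound)
        show "0 \<le> cmod c * onorm g" using that by (simp add: onorm_pos_le)
        show "norm (c * g x) \<le> cmod c * onorm g * norm x" for x
          using onorm[OF that, of x]
          by (simp add: norm_mult mult.assoc mult_left_mono)
      qed
      have "onorm (\<lambda>x. inverse a * (a * f x)) \<le> cmod (inverse a) * onorm (\<lambda>x. a * f x)"
        by (rule le) (rule bounded_linear_compose[OF bounded_linear_mult_right bf])
      then have "onorm f \<le> onorm (\<lambda>x. a * f x) / cmod a"
        using False by (simp add: mult.assoc[symmetric] norm_inverse divide_inverse mult.commute)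
      then have "cmod a * onorm f \<le> onorm (\<lambda>x. a * f x)"
        using False by (simp add: field_simps)
      then show ?thesis using le[OF bf, of a] by (simp add: scaleC_complex_def)
    qed
  qed
  then show "norm (a *\<^sub>C f) = cmod a * norm f" .
  show "norm (r *\<^sub>R f) = \<bar>r\<bar> * norm f"
    by (simp add: scaleR_cdual_def nC)
qed

end

instance cdual :: (complex_normed_vector) complex_banach
proof
  fix X :: "nat \<Rightarrow> 'a cdual"
  assume X: "Cauchy X"
  have cl: "bounded_clinear (cdual_apply f)" for f :: "'a cdual"
    using cdual_apply by blast
  then have bl: "bounded_linear (cdual_apply f)" for f :: "'a cdual"
    by (simp add: bounded_clinear_def)
  define Y where "Y n = Blinfun (cdual_apply (X n))" for n
  have Y_apply: "blinfun_apply (Y n) = cdual_apply (X n)" for n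
    by (simp add: Y_def bounded_linear_Blinfun_apply bl)
  have "dist (Y m) (Y n) = dist (X m) (X n)" for m n
    by (simp add: dist_norm norm_blinfun.rep_eq norm_cdual.rep_eq minus_blinfun.rep_eq
        minus_cdual.rep_eq Y_apply)
  then have "Cauchy Y" using X by (simp add: Cauchy_def)
  then obtain L where L: "Y \<longlonglongrightarrow> L"
    using Cauchy_convergent_iff convergent_def by blast
  have "blinfun_apply L (c *\<^sub>C x) = c *\<^sub>C blinfun_apply L x" for c x
  proof (rule LIMSEQ_unique)
    show "(\<lambda>n. blinfun_apply (Y n) (c *\<^sub>C x)) \<longlonglongrightarrow> blinfun_apply L (c *\<^sub>C x)"
      by (intro tendsto_intros L)
    have "(\<lambda>n. c * blinfun_apply (Y n) x) \<longlonglongrightarrow> c * blinfun_apply L x"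
      by (intro tendsto_intros L)
    then show "(\<lambda>n. blinfun_apply (Y n) (c *\<^sub>C x)) \<longlonglongrightarrow> c *\<^sub>C blinfun_apply L x"
      using cl by (simp add: Y_apply bounded_clinear_def scaleC_complex_def)
  qed
  then have "bounded_clinear (blinfun_apply L)"
    by (simp add: bounded_clinear_def blinfun.bounded_linear_right)
  then have ap: "cdual_apply (Cdual (blinfun_apply L)) = blinfun_apply L"
    by (simp add: Cdual_inverse)
  have "dist (X n) (Cdual (blinfun_apply L)) = dist (Y n) L" for n
    by (simp add: dist_norm norm_blinfun.rep_eq norm_cdual.rep_eq minus_blinfun.rep_eq
        minus_cdual.rep_eq Y_apply ap)
  then have "X \<longlonglongrightarrow> Cdual (blinfun_apply L)"
    using L by (simp add: tendsto_iff)
  then show "convergent X" by (auto simp: convergent_def)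
qed

text \<open>Meaningful for bounded operators only.\<close>

definition dual_op :: "('a::complex_normed_vector \<Rightarrow> 'a) \<Rightarrow> 'a cdual \<Rightarrow> 'a cdual" where
  "dual_op T \<phi> = Cdual (\<lambda>x. cdual_apply \<phi> (T x))"

lemma cdual_apply_dual_op:
  "bounded_clinear T \<Longrightarrow> cdual_apply (dual_op T \<phi>) x = cdual_apply \<phi> (T x)"
  using cdual_apply[of \<phi>]
  by (simp add: dual_op_def Cdual_inverse bounded_clinear_compose)


section \<open>Spectra and poles\<close>

definition op_shift ::
    "('a::complex_normed_vector \<Rightarrow> 'a) \<Rightarrow> complex \<Rightarrow> 'a \<Rightarrow> 'a" where
  "op_shift T \<mu> = (\<lambda>x. T x - \<mu> *\<^sub>C x)"

definition kernel :: "('a::complex_normed_vector \<Rightarrow> 'a) \<Rightarrow> 'a set" where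
  "kernel T = {x. T x = 0}"

definition nullity :: "('a::complex_normed_vector \<Rightarrow> 'a) \<Rightarrow> enat" where
  "nullity T = cdimension (kernel T)"

definition deficiency :: "('a::complex_normed_vector \<Rightarrow> 'a) \<Rightarrow> enat" where
  "deficiency T = ccodimension (range T)"

definition op_spectrum :: "('a::complex_normed_vector \<Rightarrow> 'a) \<Rightarrow> complex set" where
  "op_spectrum T = {\<mu>. \<nexists>S. bounded_clinear S \<and>
     S \<circ> op_shift T \<mu> = id \<and> op_shift T \<mu> \<circ> S = id}"

definition approx_point_spectrum :: "('a::complex_normed_vector \<Rightarrow> 'a) \<Rightarrow> complex set" where
  "approx_point_spectrum T = {\<mu>. \<exists>x :: nat \<Rightarrow> 'a. (\<forall>n. norm (x n) = 1) \<and>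
     (\<lambda>n. op_shift T \<mu> (x n)) \<longlonglongrightarrow> 0}"

definition upper_semi_Fredholm :: "('a::complex_normed_vector \<Rightarrow> 'a) \<Rightarrow> bool" where
  "upper_semi_Fredholm T \<longleftrightarrow> closed (range T) \<and> nullity T < \<infinity>"

definition lower_semi_Fredholm :: "('a::complex_normed_vector \<Rightarrow> 'a) \<Rightarrow> bool" where
  "lower_semi_Fredholm T \<longleftrightarrow> closed (range T) \<and> deficiency T < \<infinity>"

text \<open>Only used for semi-Fredholm operators, so that \<open>\<infinity> - \<infinity>\<close> does not occur.\<close>

definition fredholm_index :: "('a::complex_normed_vector \<Rightarrow> 'a) \<Rightarrow> ereal" where
  "fredholm_index T = ereal_of_enat (nullity T) - ereal_of_enat (deficiency T)"

definition upper_semi_Weyl :: "('a::complex_normed_vector \<Rightarrow> 'a) \<Rightarrow> bool" where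
  "upper_semi_Weyl T \<longleftrightarrow> upper_semi_Fredholm T \<and> fredholm_index T \<le> 0"

definition lower_semi_Weyl :: "('a::complex_normed_vector \<Rightarrow> 'a) \<Rightarrow> bool" where
  "lower_semi_Weyl T \<longleftrightarrow> lower_semi_Fredholm T \<and> fredholm_index T \<ge> 0"

definition uw_spectrum :: "('a::complex_normed_vector \<Rightarrow> 'a) \<Rightarrow> complex set" where
  "uw_spectrum T = {\<mu>. \<not> upper_semi_Weyl (op_shift T \<mu>)}"

definition lw_spectrum :: "('a::complex_normed_vector \<Rightarrow> 'a) \<Rightarrow> complex set" where
  "lw_spectrum T = {\<mu>. \<not> lower_semi_Weyl (op_shift T \<mu>)}"

definition ascent :: "('a::complex_normed_vector \<Rightarrow> 'a) \<Rightarrow> enat" where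
  "ascent T = (INF n \<in> {n. kernel (T ^^ n) = kernel (T ^^ (n + 1))}. enat n)"

definition left_pole :: "('a::complex_normed_vector \<Rightarrow> 'a) \<Rightarrow> complex \<Rightarrow> bool" where
  "left_pole T \<mu> \<longleftrightarrow> \<mu> \<in> approx_point_spectrum T \<and>
     (\<exists>p. ascent (op_shift T \<mu>) = enat p \<and> closed (range (op_shift T \<mu> ^^ (p + 1))))"

definition finite_rank_left_poles :: "('a::complex_normed_vector \<Rightarrow> 'a) \<Rightarrow> complex set" where
  "finite_rank_left_poles T = {\<mu>. left_pole T \<mu> \<and> nullity (op_shift T \<mu>) < \<infinity>}"

definition property_az :: "('a::complex_normed_vector \<Rightarrow> 'a) \<Rightarrow> bool" where
  "property_az T \<longleftrightarrow> op_spectrum T - uw_spectrum T = finite_rank_left_poles T"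


section \<open>The single valued extension property\<close>

text \<open>The library's \<open>holomorphic_on\<close> covers complex-valued functions only; this is complex
  differentiability on an open set for vector-valued ones.\<close>

definition vector_analytic_on ::
    "(complex \<Rightarrow> 'a::complex_normed_vector) \<Rightarrow> complex set \<Rightarrow> bool" where
  "vector_analytic_on f U \<longleftrightarrow> (\<forall>z\<in>U. \<exists>D. (f has_derivative (\<lambda>h. h *\<^sub>C D)) (at z))"

text \<open>Neighborhoods are connected, as is implicit in this notion: admitting disconnected ones would
  turn the property at a single point into the property at all points, since \<open>f\<close> could vanish
  near \<open>\<mu>0\<close> and be a nonzero local solution on another component.\<close>

definition SVEP_at :: "('a::complex_normed_vector \<Rightarrow> 'a) \<Rightarrow> complex \<Rightarrow> bool" where
  "SVEP_at T \<mu>0 \<longleftrightarrow> (\<forall>U f. open U \<and> connected U \<and> \<mu>0 \<in> U \<and> vector_analytic_on f U \<and>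
     (\<forall>\<mu>\<in>U. op_shift T \<mu> (f \<mu>) = 0) \<longrightarrow> (\<forall>\<mu>\<in>U. f \<mu> = 0))"

end

theory Submission
  imports Defs "HOL-Complex_Analysis.Conformal_Mappings"
begin

text \<open>
  Write \<open>N\<close>, \<open>R\<close>, \<open>\<alpha>\<close>, \<open>\<beta>\<close> for kernel, range, nullity and deficiency. Each of the four implications is
  proved locally, at a point \<open>\<mu>\<close>.

  From the SVEP to property \<open>(az)\<close>. Let \<open>S'\<close> be the upper semi-Weyl operator whose spectrum is
  studied and let \<open>S\<close> be its partner under duality: \<open>S' = T - \<mu>\<close> and \<open>S = T\<^sup>* - \<mu>\<close> for the first
  equivalence, \<open>S' = T\<^sup>* - \<mu>\<close> and \<open>S = T - \<mu>\<close> for the second. In both cases \<open>R(S)\<close> is closed of finite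
  codimension. The increasing subspaces \<open>R(S) + N(S\<^sup>n)\<close> become stationary, and this means that
  \<open>N(S) \<inter> R(S\<^sup>m)\<close> lies in all ranges \<open>R(S\<^sup>n)\<close> for some \<open>m\<close>. Hence every element \<open>x\<^sub>0\<close> of it starts a
  backward orbit \<open>S x\<^sub>n\<^sub>+\<^sub>1 = x\<^sub>n\<close>, and the open mapping theorem on \<open>R(S\<^sup>m)\<close> keeps its growth geometric. The
  sum of \<open>(\<lambda> - \<mu>)\<^sup>n x\<^sub>n\<close> is then an analytic solution of the eigenvalue equation with value \<open>x\<^sub>0\<close>
  at \<open>\<mu>\<close>, so that the SVEP forces \<open>N(S) \<inter> R(S\<^sup>m) = 0\<close>
  (\<open>SVEP_imp_kernel_meets_range_trivially\<close>). By linear algebra alone, \<open>\<alpha>(S) \<le> \<beta>(S)\<close> follows, with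
  equality only if \<open>S\<close> maps \<open>R(S\<^sup>m)\<close> onto itself (\<open>nullity_le_deficiency_of_trivial_meet\<close>). On the
  other hand \<open>\<beta>(S) \<le> \<alpha>(S') \<le> \<beta>(S') \<le> \<alpha>(S)\<close>: the outer inequalities are duality, the inner one is
  the hypothesis on \<open>S'\<close>. So equality holds everywhere; the finite descent of \<open>S\<close> transposes to a
  finite ascent of \<open>S'\<close>, and \<open>S'\<close> is bijective as soon as it is injective. A point of the spectrum
  is therefore an eigenvalue, and a left pole of finite rank. The inclusion of
  the left poles of finite rank in the spectrum without the upper semi-Weyl spectrum holds for every
  operator (\<open>finite_rank_left_poles_subset\<close>).

  From property \<open>(az)\<close> to the SVEP. A point \<open>\<mu>\<close> outside the upper semi-Weyl spectrum is, by \<open>(az)\<close>,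
  either in the resolvent set or a left pole, and in both cases \<open>N(T - \<mu>) \<inter> R((T - \<mu>)\<^sup>p) = 0\<close> for
  some \<open>p\<close>. This makes \<open>T - \<nu>\<close> bounded below for all \<open>\<nu> \<noteq> \<mu>\<close> near \<open>\<mu>\<close>
  (\<open>bounded_below_punctured_neighbourhood\<close>). Such \<open>\<nu>\<close> lie neither in the upper semi-Weyl nor in the
  approximate point spectrum, so that \<open>(az)\<close> expels them from the spectrum. Thus \<open>\<mu>\<close> is at most an
  isolated point of the spectrum, and the identity theorem gives the SVEP.

  The transfer between \<open>T\<close> and \<open>T\<^sup>*\<close> rests on the Hahn--Banach theorem, the closed range theorem in
  both directions, and the four inequalities between \<open>\<alpha>\<close> and \<open>\<beta>\<close> of an operator and its dual.
\<close>

section \<open>Dimension and codimension of subspaces\<close>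

abbreviation clinear :: "('a::complex_normed_vector \<Rightarrow> 'b::complex_normed_vector) \<Rightarrow> bool" where
  "clinear \<equiv> Vector_Spaces.linear scaleC scaleC"

abbreviation cindependent :: "'a::complex_normed_vector set \<Rightarrow> bool" where
  "cindependent B \<equiv> \<not> cdependent_raw B"

global_interpretation complex_vector_pair:
  vector_space_pair "scaleC :: complex \<Rightarrow> 'a \<Rightarrow> 'a::complex_normed_vector"
    "scaleC :: complex \<Rightarrow> 'b \<Rightarrow> 'b::complex_normed_vector"
  by unfold_locales

lemmas clinear_0 = complex_vector_pair.linear_0
  and clinear_add = complex_vector_pair.linear_add
  and clinear_diff = complex_vector_pair.linear_diff
  and clinear_eq_on = complex_vector_pair.linear_eq_on
  and clinear_scale = complex_vector_pair.linear_scale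
  and clinear_span_image = complex_vector_pair.linear_span_image
  and clinear_subspace_image = complex_vector_pair.linear_subspace_image
  and csubspace_0 = complex_vector.subspace_0
  and csubspace_UNIV = complex_vector.subspace_UNIV
  and csubspace_add = complex_vector.subspace_add
  and csubspace_diff = complex_vector.subspace_diff
  and csubspace_scale = complex_vector.subspace_scale
  and cspan_Un = complex_vector.span_Un
  and cspan_base = complex_vector.span_base
  and cspan_eq_iff = complex_vector.span_eq_iff
  and cspan_insert = complex_vector.span_insert
  and cspan_minimal = complex_vector.span_minimal
  and cspan_mono = complex_vector.span_mono
  and cspan_superset = complex_vector.span_superset

lemma clinear_iff:
  "clinear f \<longleftrightarrow> (\<forall>x y. f (x + y) = f x + f y) \<and> (\<forall>c x. f (c *\<^sub>C x) = c *\<^sub>C f x)"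
  unfolding Vector_Spaces.linear_iff
  using complex_vector_pair.vector_space_pair_axioms
  by (auto simp: vector_space_pair_def)

lemma clinear_funpow:
  fixes f :: "'a::complex_normed_vector \<Rightarrow> 'a"
  shows "clinear f \<Longrightarrow> clinear (f ^^ n)"
  by (induction n) (simp_all add: clinear_iff)

lemma csubspace_kernel: "clinear f \<Longrightarrow> csubspace (kernel f)"
  unfolding kernel_def by (rule complex_vector_pair.linear_subspace_kernel)

lemma csubspace_range: "clinear f \<Longrightarrow> csubspace (range f)"
  by (rule clinear_subspace_image) simp_all

lemma in_cspan_Un_iff:
  assumes "csubspace V"
  shows "x \<in> cspan (V \<union> B) \<longleftrightarrow> (\<exists>v\<in>V. \<exists>b\<in>cspan B. x = v + b)"
proof -
  have "cspan V = V" using assms by simp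
  then show ?thesis unfolding cspan_Un by blast
qed

lemma cspan_Un_eq_UNIV:
  assumes "cspan (R \<union> G) = UNIV" "R \<subseteq> cspan A"
  shows "cspan (A \<union> G) = UNIV"
proof -
  have "cspan A \<subseteq> cspan (A \<union> G)" "G \<subseteq> cspan (A \<union> G)"
    using cspan_mono[of A "A \<union> G"] cspan_superset[of "A \<union> G"] by simp_all
  then have "cspan (R \<union> G) \<subseteq> cspan (A \<union> G)"
    using assms(2) by (intro cspan_minimal) auto
  then show ?thesis using assms(1) by auto
qed

lemma cindependent_Un:
  assumes "cindependent A" "cindependent B" "cspan A \<inter> cspan B \<subseteq> {0}" "finite A"
  shows "cindependent (A \<union> B)"
  using assms(4,1,3)
proof (induction A rule: finite_induct)
  case empty
  then show ?case using assms(2) by simp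
next
  case (insert a A)
  have a: "a \<notin> cspan A" "cindependent A"
    using insert.prems(1) insert.hyps by (simp_all add: complex_vector.independent_insert)
  have sub: "cspan A \<subseteq> cspan (insert a A)" by (rule cspan_mono) auto
  have ind: "cindependent (A \<union> B)" using insert a sub by blast
  have "a \<notin> cspan (A \<union> B)"
  proof
    assume "a \<in> cspan (A \<union> B)"
    then obtain u v where uv: "a = u + v" "u \<in> cspan A" "v \<in> cspan B"
      by (auto simp: cspan_Un)
    have "v = a - u" using uv by simp
    moreover have "a \<in> cspan (insert a A)" by (rule cspan_base) simp
    ultimately have "v \<in> cspan (insert a A)"
      using uv(2) sub by (metis complex_vector.span_diff subsetD)
    then have "v = 0" using uv(3) insert.prems(2) by auto
    then show False using uv a by simp
  qed
  then show ?case using ind by (simp add: complex_vector.independent_insertI)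
qed

lemma cdimension_le_card:
  assumes "finite B" "V \<subseteq> cspan B"
  shows "cdimension V \<le> enat (card B)"
  using complex_vector.dim_le_card[OF assms(2,1)] assms unfolding cdimension_def by auto

lemma card_le_cdimension:
  assumes "B \<subseteq> V" "cindependent B" "finite B"
  shows "enat (card B) \<le> cdimension V"
proof (cases "\<exists>A. finite A \<and> V \<subseteq> cspan A")
  case True
  obtain C where C: "B \<subseteq> C" "C \<subseteq> V" "cindependent C" "V \<subseteq> cspan C"
    using complex_vector.maximal_independent_subset_extend[OF assms(1,2)] by metis
  obtain A where A: "finite A" "V \<subseteq> cspan A" using True by auto
  have "finite C" using complex_vector.independent_span_bound[OF A(1) C(3)] C A by blast
  then have "card B \<le> cdim_raw V"
    using complex_vector.basis_card_eq_dim[OF C(2,4,3)] card_mono[OF _ C(1)] by simp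
  then show ?thesis using True by (simp add: cdimension_def)
qed (auto simp: cdimension_def)

lemma cdimension_basis:
  assumes "csubspace V" "cdimension V < \<infinity>"
  obtains B where "finite B" "cindependent B" "cspan B = V" "B \<subseteq> V" "enat (card B) = cdimension V"
proof -
  obtain A where A: "finite A" "V \<subseteq> cspan A"
    using assms(2) by (auto simp: cdimension_def split: if_splits)
  obtain B where B: "B \<subseteq> V" "cindependent B" "V \<subseteq> cspan B"
    using complex_vector.maximal_independent_subset by metis
  have fin: "finite B" using complex_vector.independent_span_bound[OF A(1) B(2)] A B by blast
  have "cspan B = V" using B assms(1) cspan_minimal by blast
  moreover have "enat (card B) = cdimension V"
    using cdimension_le_card[OF fin B(3)] card_le_cdimension[OF B(1,2) fin] by simp
  ultimately show ?thesis using that fin B by blast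
qed

lemma cdimension_less_infty_iff: "cdimension V < \<infinity> \<longleftrightarrow> (\<exists>B. finite B \<and> V \<subseteq> cspan B)"
  by (simp add: cdimension_def)

lemma cdimension_ge_obtain:
  assumes "csubspace V" "enat n \<le> cdimension V"
  obtains B where "finite B" "cindependent B" "B \<subseteq> V" "card B = n"
proof -
  obtain B where B: "B \<subseteq> V" "cindependent B" "V \<subseteq> cspan B"
    using complex_vector.maximal_independent_subset by metis
  have "\<exists>C\<subseteq>B. finite C \<and> card C = n"
  proof (cases "finite B")
    case True
    then have "n \<le> card B" using cdimension_le_card[OF True B(3)] assms(2)
      by (metis enat_ord_simps(1) order_trans)
    then show ?thesis using True by (metis obtain_subset_with_card_n)
  next
    case False
    then show ?thesis by (metis infinite_arbitrarily_large)
  qed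
  then obtain C where "C \<subseteq> B" "finite C" "card C = n" by blast
  then show ?thesis using that complex_vector.independent_mono[OF B(2)] B(1) by blast
qed

lemma ccomplement_exists:
  assumes "csubspace V"
  shows "\<exists>M. ccomplement V M"
proof -
  obtain B where B: "B \<subseteq> V" "cindependent B" "V \<subseteq> cspan B"
    using complex_vector.maximal_independent_subset by metis
  obtain C where C: "B \<subseteq> C" "cindependent C" "UNIV \<subseteq> cspan C"
    using complex_vector.maximal_independent_subset_extend[OF subset_UNIV B(2)] by metis
  have VB: "cspan B = V" using B assms cspan_minimal by blast
  obtain g where g: "clinear g" "\<And>x. x \<in> C \<Longrightarrow> g x = (if x \<in> B then x else 0)"
    using complex_vector_pair.linear_independent_extend[OF C(2), of "\<lambda>x. if x \<in> B then x else 0"] by metis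
  have id: "clinear (\<lambda>x. x)" and zero: "clinear (\<lambda>x. 0)" by (simp_all add: clinear_iff)
  have gV: "g v = v" if "v \<in> V" for v
    using clinear_eq_on[OF g(1) id, of v B] that VB g(2) C(1) by (metis subsetD)
  have g0: "g v = 0" if "v \<in> cspan (C - B)" for v
    using clinear_eq_on[OF g(1) zero that] g(2) by auto
  have "V \<inter> cspan (C - B) = {0}"
  proof
    show "V \<inter> cspan (C - B) \<subseteq> {0}" using gV g0 by (metis IntE singletonI subsetI)
    show "{0} \<subseteq> V \<inter> cspan (C - B)"
      using csubspace_0[OF assms] complex_vector.span_zero by simp
  qed
  moreover have "\<exists>v\<in>V. \<exists>m\<in>cspan (C - B). x = v + m" for x
  proof -
    have "B \<union> (C - B) = C" using C by auto
    then have "x \<in> cspan (B \<union> (C - B))" using C by auto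
    then show ?thesis unfolding cspan_Un VB by blast
  qed
  ultimately have "ccomplement V (cspan (C - B))"
    by (simp add: ccomplement_def)
  then show ?thesis by blast
qed

text \<open>The projection along \<open>V\<close> onto the complement chosen in the definition of the codimension.
  Every bound on the codimension is obtained by transporting vectors with it; afterwards no
  complement needs to be mentioned.\<close>

lemma ccodimension_complement:
  assumes "csubspace V"
  obtains M p where "ccomplement V M" "csubspace M" "ccodimension V = cdimension M"
    "clinear p" "\<And>x. p x \<in> M" "\<And>x. x - p x \<in> V"
proof -
  define M where "M = (SOME M. ccomplement V M)"
  have M: "ccomplement V M" unfolding M_def using ccomplement_exists[OF assms] by (rule someI_ex)
  then have sM: "csubspace M" and dis: "V \<inter> M = {0}" and ex: "\<forall>x. \<exists>v\<in>V. \<exists>m\<in>M. x = v + m"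
    by (auto simp: ccomplement_def)
  have "\<exists>m. m \<in> M \<and> x - m \<in> V" for x
  proof -
    obtain v m where "v \<in> V" "m \<in> M" "x = v + m" using ex by blast
    then show ?thesis by (intro exI[of _ m]) simp
  qed
  then obtain p where p: "\<And>x. p x \<in> M" "\<And>x. x - p x \<in> V" by metis
  have uni: "m = m'" if "m \<in> M" "m' \<in> M" "x - m \<in> V" "x - m' \<in> V" for m m' x
  proof -
    have "m - m' \<in> M" using that sM by (simp add: csubspace_diff)
    moreover have "(x - m') - (x - m) \<in> V"
      by (rule csubspace_diff[OF assms that(4,3)])
    ultimately have "m - m' \<in> V \<inter> M" by simp
    then show ?thesis unfolding dis by simp
  qed
  have "clinear p"
    unfolding clinear_iff
  proof (intro conjI allI)
    fix x y :: 'a and c :: complex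
    have "x + y - (p x + p y) \<in> V"
      using csubspace_add[OF assms p(2)[of x] p(2)[of y]] by (simp add: algebra_simps)
    then show "p (x + y) = p x + p y"
      using uni[OF p(1) csubspace_add[OF sM p(1) p(1)] p(2)] by blast
    have "c *\<^sub>C x - c *\<^sub>C p x \<in> V"
      using csubspace_scale[OF assms p(2)[of x], of c]
      by (simp add: complex_vector.scale_right_diff_distrib)
    then show "p (c *\<^sub>C x) = c *\<^sub>C p x"
      using uni[OF p(1) csubspace_scale[OF sM p(1)] p(2)] by blast
  qed
  then show ?thesis using that M sM p by (simp add: ccodimension_def M_def)
qed

lemma ccodimension_le_card:
  assumes "csubspace V" "finite B" "cspan (V \<union> B) = UNIV"
  shows "ccodimension V \<le> enat (card B)"
proof -
  obtain M p where M: "ccomplement V M" "csubspace M" "ccodimension V = cdimension M"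
    and p: "clinear p" "\<And>x. p x \<in> M" "\<And>x. x - p x \<in> V"
    using ccodimension_complement[OF assms(1)] by metis
  have dis: "V \<inter> M = {0}" using M by (simp add: ccomplement_def)
  have pM: "p m = m" if "m \<in> M" for m
  proof -
    have "m - p m \<in> V \<inter> M" using p(3) csubspace_diff[OF M(2) that p(2)[of m]] by simp
    then show ?thesis unfolding dis by simp
  qed
  have pV: "p v = 0" if "v \<in> V" for v
  proof -
    have "v - (v - p v) \<in> V" by (rule csubspace_diff[OF assms(1) that p(3)])
    then have "p v \<in> V \<inter> M" using p(2)[of v] by simp
    then show ?thesis unfolding dis by simp
  qed
  have "M \<subseteq> cspan (p ` B)"
  proof
    fix m assume m: "m \<in> M"
    have "m \<in> cspan (V \<union> B)" using assms(3) by simp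
    then obtain v b where vb: "v \<in> V" "b \<in> cspan B" "m = v + b"
      using in_cspan_Un_iff[OF assms(1)] by blast
    then have "m = p b" using pM[OF m] pV[OF vb(1)] p(1) by (simp add: clinear_iff)
    then show "m \<in> cspan (p ` B)"
      using vb clinear_span_image[OF p(1), of B] by auto
  qed
  then have "cdimension M \<le> enat (card (p ` B))"
    using assms by (intro cdimension_le_card) auto
  also have "\<dots> \<le> enat (card B)" using card_image_le[OF assms(2)] by simp
  finally show ?thesis using M by simp
qed

lemma card_le_ccodimension:
  assumes "csubspace V" "finite B" "cindependent B" "cspan B \<inter> V \<subseteq> {0}"
  shows "enat (card B) \<le> ccodimension V"
proof -
  obtain M p where M: "ccomplement V M" "csubspace M" "ccodimension V = cdimension M"
    and p: "clinear p" "\<And>x. p x \<in> M" "\<And>x. x - p x \<in> V"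
    using ccodimension_complement[OF assms(1)] by metis
  have inj: "inj_on p (cspan B)"
  proof (subst complex_vector_pair.linear_inj_on_iff_eq_0[OF p(1)])
    show "\<forall>x\<in>cspan B. p x = 0 \<longrightarrow> x = 0" using p(3) assms(4)
      by (metis IntI diff_zero singletonD subsetD)
  qed auto
  have "card (p ` B) = card B"
    using inj cspan_superset[of B] by (metis card_image inj_on_subset)
  moreover have "cindependent (p ` B)"
    using complex_vector_pair.linear_independent_injective_image[OF p(1) assms(3) inj] .
  ultimately show ?thesis
    using card_le_cdimension[of "p ` B" M] p(2) assms(2) M(3) by auto
qed

lemma ccodimension_ge_obtain:
  assumes "csubspace V" "enat n \<le> ccodimension V"
  obtains B where "finite B" "cindependent B" "cspan B \<inter> V \<subseteq> {0}" "card B = n"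
proof -
  obtain M p where M: "ccomplement V M" "csubspace M" "ccodimension V = cdimension M"
    using ccodimension_complement[OF assms(1)] by metis
  obtain B where B: "finite B" "cindependent B" "B \<subseteq> M" "card B = n"
    using cdimension_ge_obtain[OF M(2)] assms(2) M(3) by metis
  have "cspan B \<subseteq> M" using B M cspan_minimal by blast
  then have "cspan B \<inter> V \<subseteq> {0}" using M(1) unfolding ccomplement_def by blast
  then show ?thesis using that B by blast
qed

lemma ccodimension_basis:
  assumes "csubspace V" "ccodimension V < \<infinity>"
  obtains B where "finite B" "cindependent B" "cspan B \<inter> V \<subseteq> {0}" "cspan (V \<union> B) = UNIV"
    "enat (card B) = ccodimension V"
proof -
  obtain M p where M: "ccomplement V M" "csubspace M" "ccodimension V = cdimension M"
    using ccodimension_complement[OF assms(1)] by metis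
  obtain B where B: "finite B" "cindependent B" "cspan B = M" "enat (card B) = cdimension M"
    using cdimension_basis[OF M(2)] assms(2) M(3) by metis
  have "x \<in> cspan (V \<union> B)" for x
    using M(1) B(3) unfolding ccomplement_def in_cspan_Un_iff[OF assms(1)] by blast
  moreover have "cspan B \<inter> V \<subseteq> {0}" using M(1) B(3) unfolding ccomplement_def by blast
  ultimately show ?thesis using that B M(3) by (metis UNIV_eq_I)
qed

text \<open>Here and below, \<open>V + span B\<close> is written as \<open>cspan (V \<union> B)\<close>, and independence of \<open>B\<close> modulo
  \<open>V\<close> as independence of \<open>B\<close> together with \<open>cspan B \<inter> V \<subseteq> {0}\<close>.\<close>

lemma ccodimension_less_infty_iff:
  assumes "csubspace V"
  shows "ccodimension V < \<infinity> \<longleftrightarrow> (\<exists>B. finite B \<and> cspan (V \<union> B) = UNIV)"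
proof
  assume "ccodimension V < \<infinity>"
  from ccodimension_basis[OF assms this] show "\<exists>B. finite B \<and> cspan (V \<union> B) = UNIV"
    by metis
next
  assume "\<exists>B. finite B \<and> cspan (V \<union> B) = UNIV"
  then obtain B where "finite B" "cspan (V \<union> B) = UNIV" by blast
  from ccodimension_le_card[OF assms this] show "ccodimension V < \<infinity>"
    by (rule le_less_trans) simp
qed

lemma ccodimension_antimono:
  assumes "csubspace V" "csubspace W" "V \<subseteq> W"
  shows "ccodimension W \<le> ccodimension V"
proof (cases "ccodimension V < \<infinity>")
  case True
  then obtain B where B: "finite B" "cspan (V \<union> B) = UNIV" "enat (card B) = ccodimension V"
    using ccodimension_basis[OF assms(1)] by metis
  have "cspan (W \<union> B) = UNIV"
    using B(2) cspan_mono[of "V \<union> B" "W \<union> B"] assms(3) by blast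
  then show ?thesis using ccodimension_le_card[OF assms(2) B(1)] B(3) by metis
qed auto

text \<open>A vector of \<open>W\<close> outside \<open>V\<close> could be added to a basis modulo \<open>W\<close> and would give one more
  independent vector modulo \<open>V\<close> than the codimension of \<open>V\<close> admits.\<close>

lemma subspace_eq_of_ccodimension_le:
  assumes V: "csubspace V" and W: "csubspace W" and VW: "V \<subseteq> W"
    and le: "ccodimension V \<le> ccodimension W" and fin: "ccodimension V < \<infinity>"
  shows "V = W"
proof (rule ccontr)
  assume "V \<noteq> W"
  then obtain y where y: "y \<in> W" "y \<notin> V" using VW by blast
  have "ccodimension W < \<infinity>" using ccodimension_antimono[OF V W VW] fin by (rule le_less_trans)
  then obtain B where B: "finite B" "cindependent B" "cspan B \<inter> W \<subseteq> {0}" "enat (card B) = ccodimension W"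
    using ccodimension_basis[OF W] by metis
  have y0: "y \<notin> cspan B" using y B(3) csubspace_0[OF V] by auto
  have "cspan (insert y B) \<inter> V \<subseteq> {0}"
  proof
    fix z assume z: "z \<in> cspan (insert y B) \<inter> V"
    then obtain k where k: "z - k *\<^sub>C y \<in> cspan B"
      by (auto simp: cspan_insert)
    have "z - k *\<^sub>C y \<in> W"
      using z y(1) VW by (intro csubspace_diff[OF W] csubspace_scale[OF W]) auto
    then have zk: "z = k *\<^sub>C y" using k B(3) by auto
    have "k = 0"
    proof (rule ccontr)
      assume "k \<noteq> 0"
      then have "y = inverse k *\<^sub>C z" using zk by (simp add: scaleC_scaleC scaleC_one)
      then show False using y(2) z csubspace_scale[OF V] by auto
    qed
    then show "z \<in> {0}" using zk by simp
  qed
  moreover have "cindependent (insert y B)"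
    using y0 B(2) by (simp add: complex_vector.independent_insertI)
  ultimately have "enat (card (insert y B)) \<le> ccodimension V"
    using card_le_ccodimension[OF V, of "insert y B"] B(1) by simp
  moreover have "y \<notin> B" using y0 cspan_base by blast
  ultimately have "enat (Suc (card B)) \<le> enat (card B)" using B(1,4) le by simp
  then show False by simp
qed

text \<open>Steinitz exchange in the quotient by \<open>V\<close>: a basis of the whole space that contains \<open>B\<close> and a
  basis \<open>A\<close> of \<open>V\<close> yields the new vectors outside \<open>A\<close>.\<close>

lemma independent_complement_extend:
  assumes V: "csubspace V" "ccodimension V < \<infinity>"
    and B: "finite B" "cindependent B" "cspan B \<inter> V \<subseteq> {0}"
  obtains D where "finite D" "B \<inter> D = {}" "cindependent (B \<union> D)"
    "cspan (B \<union> D) \<inter> V \<subseteq> {0}" "cspan (V \<union> (B \<union> D)) = UNIV"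
proof -
  obtain A where A: "A \<subseteq> V" "cindependent A" "V \<subseteq> cspan A"
    using complex_vector.maximal_independent_subset by metis
  have VA: "cspan A = V" using A V cspan_minimal by blast
  have ind: "cindependent (B \<union> A)"
    using cindependent_Un[OF B(2) A(2) _ B(1)] B(3) VA by simp
  obtain C where C: "B \<union> A \<subseteq> C" "cindependent C" "UNIV \<subseteq> cspan C"
    using complex_vector.maximal_independent_subset_extend[OF subset_UNIV ind] by metis
  define D where "D = C - A - B"
  have AB: "A \<inter> B = {}"
  proof -
    have "x = 0" if "x \<in> A" "x \<in> B" for x
      using that A(1) B(3) cspan_base[of x B] by blast
    then show ?thesis using A(2) complex_vector.dependent_zero by blast
  qed
  have CA: "C - A = B \<union> D" using C AB by (auto simp: D_def)
  have dis: "cspan (C - A) \<inter> V \<subseteq> {0}"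
  proof
    fix x assume x: "x \<in> cspan (C - A) \<inter> V"
    obtain g where g: "clinear g" "\<And>x. x \<in> C \<Longrightarrow> g x = (if x \<in> A then x else 0)"
      using complex_vector_pair.linear_independent_extend[OF C(2), of "\<lambda>x. if x \<in> A then x else 0"] by metis
    have id: "clinear (\<lambda>x. x)" and zero: "clinear (\<lambda>x. 0)" by (simp_all add: clinear_iff)
    have "g x = x"
      using clinear_eq_on[OF g(1) id, of x A] x VA g(2) C(1) by (metis IntD2 Un_subset_iff subsetD)
    moreover have "g x = 0"
      using clinear_eq_on[OF g(1) zero, of x "C - A"] x g(2) by auto
    ultimately show "x \<in> {0}" by simp
  qed
  have indD: "cindependent (C - A)" using C(2) complex_vector.independent_mono by blast
  have "finite (C - A)"
  proof (rule ccontr)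
    assume "infinite (C - A)"
    moreover obtain n where n: "ccodimension V = enat n" using V(2) by auto
    ultimately obtain E where E: "E \<subseteq> C - A" "finite E" "card E = Suc n"
      by (metis infinite_arbitrarily_large)
    have "cspan E \<inter> V \<subseteq> {0}" using dis cspan_mono[OF E(1)] by blast
    then have "enat (Suc n) \<le> ccodimension V"
      using card_le_ccodimension[OF V(1) E(2)] complex_vector.independent_mono[OF indD E(1)] E(3) by auto
    then show False using n by simp
  qed
  moreover have "cspan (V \<union> (B \<union> D)) = UNIV"
  proof -
    have "C \<subseteq> V \<union> (B \<union> D)" using A(1) by (auto simp: D_def)
    then show ?thesis using C(3) cspan_mono by blast
  qed
  moreover have "finite D" "B \<inter> D = {}" using calculation(1) by (auto simp: D_def)
  ultimately show ?thesis using that[of D] dis indD CA by metis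
qed

section \<open>Kernels, ranges and iterates\<close>

text \<open>This replaces an index computation for the map induced on the finite dimensional quotient by
  \<open>M\<close>. Let \<open>B\<close> be independent in the kernel and let \<open>D\<close> complete it to a basis modulo \<open>M\<close>. Then
  \<open>range f = span (f D) + f M\<close>, hence \<open>f M\<close> has codimension at most \<open>card D + \<beta>(f)\<close>; since \<open>f M\<close>
  is contained in \<open>M\<close>, its codimension is at least \<open>card B + card D\<close>. Comparing the two gives
  \<open>card B \<le> \<beta>(f)\<close>, and in case of equality the codimensions of \<open>f M\<close> and \<open>M\<close> agree.\<close>

lemma nullity_le_deficiency_of_trivial_meet:
  assumes f: "clinear f" and M: "csubspace M" "f ` M \<subseteq> M" "ccodimension M < \<infinity>"
    and triv: "kernel f \<inter> M \<subseteq> {0}"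
  shows "nullity f \<le> deficiency f"
    and "nullity f = deficiency f \<Longrightarrow> deficiency f < \<infinity> \<Longrightarrow> f ` M = M"
proof -
  have fM: "csubspace (f ` M)" using clinear_subspace_image[OF f M(1)] .
  have key: "\<exists>D. finite D \<and> cindependent (B \<union> D) \<and> B \<inter> D = {} \<and> cspan (B \<union> D) \<inter> M \<subseteq> {0}
      \<and> ccodimension (f ` M) \<le> enat (card D) + deficiency f"
    if B: "finite B" "cindependent B" "B \<subseteq> kernel f" for B
  proof -
    have "cspan B \<subseteq> kernel f"
      using B(3) csubspace_kernel[OF f] cspan_minimal by blast
    then have "cspan B \<inter> M \<subseteq> {0}" using triv by blast
    then obtain D where D: "finite D" "B \<inter> D = {}" "cindependent (B \<union> D)"
      "cspan (B \<union> D) \<inter> M \<subseteq> {0}" "cspan (M \<union> (B \<union> D)) = UNIV"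
      using independent_complement_extend[OF M(1,3) B(1,2)] by metis
    have "ccodimension (f ` M) \<le> enat (card D) + deficiency f"
    proof (cases "deficiency f < \<infinity>")
      case True
      then obtain G where G: "finite G" "cspan (range f \<union> G) = UNIV" "enat (card G) = deficiency f"
        using ccodimension_basis[OF csubspace_range[OF f]] by (metis deficiency_def)
      have "range f \<subseteq> cspan (f ` M \<union> f ` D)"
      proof
        fix y assume "y \<in> range f"
        then obtain x where y: "y = f x" by auto
        have "x \<in> cspan (M \<union> (B \<union> D))" using D by simp
        then have "x \<in> cspan (B \<union> (M \<union> D))" by (simp add: Un_left_commute)
        then obtain b z where bz: "x = b + z" "b \<in> cspan B" "z \<in> cspan (M \<union> D)"
          unfolding cspan_Un[of B] by blast
        have "f b = 0" using \<open>cspan B \<subseteq> kernel f\<close> bz(2) by (auto simp: kernel_def)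
        then have "y = f z" unfolding y bz(1) clinear_add[OF f] by simp
        then have "y \<in> f ` cspan (M \<union> D)" using bz(3) by blast
        then show "y \<in> cspan (f ` M \<union> f ` D)"
          unfolding image_Un[symmetric] clinear_span_image[OF f] .
      qed
      from cspan_Un_eq_UNIV[OF G(2) this]
      have "cspan (f ` M \<union> (f ` D \<union> G)) = UNIV" by (simp add: Un_assoc)
      from ccodimension_le_card[OF fM _ this]
      have "ccodimension (f ` M) \<le> enat (card (f ` D \<union> G))"
        using D(1) G(1) by simp
      also have "card (f ` D \<union> G) \<le> card D + card G"
        using card_Un_le[of "f ` D" G] card_image_le[OF D(1), of f] by simp
      finally have "ccodimension (f ` M) \<le> enat (card D + card G)" by simp
      then show ?thesis using G(3) by (metis plus_enat_simps(1))
    qed auto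
    then show ?thesis using D by blast
  qed
  have bound: "enat (card B) \<le> deficiency f" if B: "finite B" "cindependent B" "B \<subseteq> kernel f" for B
  proof -
    obtain D where D: "finite D" "cindependent (B \<union> D)" "B \<inter> D = {}" "cspan (B \<union> D) \<inter> M \<subseteq> {0}"
       "ccodimension (f ` M) \<le> enat (card D) + deficiency f"
      using key[OF B] by blast
    have "cspan (B \<union> D) \<inter> f ` M \<subseteq> {0}" using D(4) M(2) by blast
    then have "enat (card (B \<union> D)) \<le> ccodimension (f ` M)"
      using card_le_ccodimension[OF fM _ D(2)] D(1) B(1) by simp
    then have "enat (card B + card D) \<le> enat (card D) + deficiency f"
      using D(1,3,5) B(1) card_Un_disjoint by (metis order_trans)
    then show ?thesis by (cases "deficiency f") auto
  qed
  show le: "nullity f \<le> deficiency f"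
  proof (rule ccontr)
    assume "\<not> ?thesis"
    then obtain n where n: "deficiency f = enat n" "enat (Suc n) \<le> nullity f"
      by (metis Suc_ile_eq enat_ord_simps(6) not_le_imp_less not_infinity_eq order_less_imp_le)
    then show False using cdimension_ge_obtain[OF csubspace_kernel[OF f], of "Suc n"] bound
      unfolding nullity_def by (metis Suc_n_not_le_n enat_ord_simps(1))
  qed
  assume eq: "nullity f = deficiency f" and fin: "deficiency f < \<infinity>"
  obtain B where B: "finite B" "cindependent B" "B \<subseteq> kernel f" "enat (card B) = nullity f"
    using cdimension_basis[OF csubspace_kernel[OF f]] eq fin unfolding nullity_def by metis
  obtain D where D: "finite D" "cindependent (B \<union> D)" "B \<inter> D = {}" "cspan (B \<union> D) \<inter> M \<subseteq> {0}"
     "ccodimension (f ` M) \<le> enat (card D) + deficiency f"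
    using key[OF B(1-3)] by blast
  have "ccodimension (f ` M) \<le> enat (card D + card B)" using D(5) B(4) eq
    by (metis plus_enat_simps(1))
  moreover have "enat (card (B \<union> D)) \<le> ccodimension M"
    using card_le_ccodimension[OF M(1) _ D(2,4)] D(1) B(1) by simp
  then have "enat (card D + card B) \<le> ccodimension M"
    using D(1,3) B(1) by (simp add: card_Un_disjoint add.commute)
  ultimately have le': "ccodimension (f ` M) \<le> ccodimension M" by (rule order_trans)
  show "f ` M = M"
    using subspace_eq_of_ccodimension_le[OF fM M(1,2) le' le_less_trans[OF le' M(3)]] .
qed

lemma finite_codimension_range_funpow:
  fixes f :: "'a::complex_normed_vector \<Rightarrow> 'a"
  assumes f: "clinear f" and fin: "deficiency f < \<infinity>"
  shows "ccodimension (range (f ^^ n)) < \<infinity>"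
proof (induction n)
  case 0
  have "ccodimension (UNIV :: 'a set) \<le> enat (card ({} :: 'a set))"
    by (rule ccodimension_le_card) auto
  then have "ccodimension (UNIV :: 'a set) < \<infinity>" by (rule le_less_trans) simp
  moreover have "range (f ^^ 0) = UNIV" by auto
  ultimately show ?case by simp
next
  case (Suc n)
  obtain B where B: "finite B" "cspan (range (f ^^ n) \<union> B) = UNIV"
    using Suc ccodimension_less_infty_iff[OF csubspace_range[OF clinear_funpow[OF f]]] by blast
  obtain G where G: "finite G" "cspan (range f \<union> G) = UNIV"
    using fin ccodimension_less_infty_iff[OF csubspace_range[OF f]] unfolding deficiency_def by blast
  have img: "f ` range (f ^^ n) = range (f ^^ Suc n)" by (auto simp: image_comp)
  have "range f \<subseteq> cspan (range (f ^^ Suc n) \<union> f ` B)"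
    using clinear_span_image[OF f, of "range (f ^^ n) \<union> B"] B(2) img
    by (simp add: image_Un del: funpow.simps)
  from cspan_Un_eq_UNIV[OF G(2) this]
  have "cspan (range (f ^^ Suc n) \<union> (f ` B \<union> G)) = UNIV" by (simp add: Un_assoc)
  moreover have "finite (f ` B \<union> G)" using B(1) G(1) by simp
  ultimately show ?case
    unfolding ccodimension_less_infty_iff[OF csubspace_range[OF clinear_funpow[OF f]]] by (intro exI conjI)
qed

lemma finite_dimension_vimage:
  assumes f: "clinear f" and W: "csubspace W" "cdimension W < \<infinity>" and fin: "nullity f < \<infinity>"
  shows "cdimension {x. f x \<in> W} < \<infinity>"
proof -
  obtain A where A: "finite A" "W \<subseteq> cspan A" using W(2) cdimension_less_infty_iff by blast
  obtain N where N: "finite N" "kernel f \<subseteq> cspan N"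
    using fin unfolding nullity_def cdimension_less_infty_iff by blast
  obtain C where C: "C \<subseteq> W \<inter> range f" "cindependent C" "W \<inter> range f \<subseteq> cspan C"
    using complex_vector.maximal_independent_subset by metis
  have "finite C" using complex_vector.independent_span_bound[OF A(1) C(2)] C A by blast
  then obtain C' where C': "finite C'" "C = f ` C'"
    using C(1) finite_subset_image[of C f UNIV] by blast
  have "{x. f x \<in> W} \<subseteq> cspan (C' \<union> N)"
  proof
    fix x assume "x \<in> {x. f x \<in> W}"
    then have "f x \<in> f ` cspan C'"
      using C(3) clinear_span_image[OF f, of C'] C'(2) by auto
    then obtain c where c: "c \<in> cspan C'" "f x = f c" by auto
    have "x - c \<in> cspan N" using c N(2) clinear_diff[OF f] by (auto simp: kernel_def)
    then have "c + (x - c) \<in> cspan (C' \<union> N)" using c unfolding cspan_Un by blast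
    then show "x \<in> cspan (C' \<union> N)" by simp
  qed
  then show ?thesis unfolding cdimension_less_infty_iff using C' N by blast
qed

lemma nullity_funpow_finite:
  assumes f: "clinear f" and fin: "nullity f < \<infinity>"
  shows "nullity (f ^^ n) < \<infinity>"
proof (induction n)
  case 0
  show ?case unfolding nullity_def cdimension_less_infty_iff
    by (rule exI[of _ "{}"]) (auto simp: kernel_def)
next
  case (Suc n)
  have "kernel (f ^^ Suc n) = {x. f x \<in> kernel (f ^^ n)}"
    by (auto simp: kernel_def funpow_swap1)
  then show ?case
    using finite_dimension_vimage[OF f csubspace_kernel[OF clinear_funpow[OF f]] _ fin] Suc
    unfolding nullity_def by metis
qed

text \<open>The codimensions form a decreasing sequence of natural numbers; beyond an index where it
  attains its minimum the subspaces are equal.\<close>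

lemma finite_codimension_chain_stabilises:
  fixes W :: "nat \<Rightarrow> 'a::complex_normed_vector set"
  assumes sub: "\<And>n. csubspace (W n)" and inc: "\<And>n. W n \<subseteq> W (Suc n)"
    and fin: "ccodimension (W 0) < \<infinity>"
  obtains m where "\<And>n. n \<ge> m \<Longrightarrow> W n = W m"
proof -
  have mono: "W m \<subseteq> W n" if "m \<le> n" for m n using lift_Suc_mono_le[of W] inc that by blast
  have codim_mono: "ccodimension (W n) \<le> ccodimension (W m)" if "m \<le> n" for m n
    using ccodimension_antimono[OF sub sub mono[OF that]] .
  define c where "c n = the_enat (ccodimension (W n))" for n
  have c: "ccodimension (W n) = enat (c n)" for n
    using codim_mono[of 0 n] fin unfolding c_def by (cases "ccodimension (W n)") auto
  define m where "m = arg_min c (\<lambda>_. True)"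
  have m: "c m \<le> c n" for n unfolding m_def by (rule arg_min_nat_le) simp
  have "W n = W m" if "n \<ge> m" for n
    by (rule subspace_eq_of_ccodimension_le[OF sub sub mono[OF that], symmetric]) (simp_all add: c m)
  then show ?thesis by (rule that)
qed

section \<open>The Hahn--Banach theorem\<close>

text \<open>The one-dimensional extension step. A partial functional is represented by its graph \<open>M\<close>, a
  real subspace of the product, and domination by \<open>q\<close> is a condition on the pairs of \<open>M\<close>. The
  admissible values \<open>c\<close> at \<open>z\<close> are those between the numbers \<open>s - q (y - z)\<close> and \<open>q (x + z) - r\<close>;
  the supremum of the former is one of them.\<close>

lemma sublinear_extension_maximal:
  fixes q :: "'a::real_vector \<Rightarrow> real" and M :: "('a \<times> real) set"
  assumes add: "\<And>x y. q (x + y) \<le> q x + q y"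
    and scale: "\<And>t x. 0 < t \<Longrightarrow> q (t *\<^sub>R x) = t * q x"
    and M: "subspace M" "\<And>x r. (x, r) \<in> M \<Longrightarrow> r \<le> q x"
  shows "\<exists>c. \<forall>x r t. (x, r) \<in> M \<longrightarrow> r + t * c \<le> q (x + t *\<^sub>R z)"
proof -
  have zero: "(0, 0) \<in> M" using subspace_0[OF M(1)] by (simp add: zero_prod_def)
  define A where "A = (\<lambda>(y, s). s - q (y - z)) ` M"
  have sep: "s - q (y - z) \<le> q (x + z) - r" if "(x, r) \<in> M" "(y, s) \<in> M" for x r y s
  proof -
    have "(x + y, r + s) \<in> M" using subspace_add[OF M(1) that] by simp
    then have "r + s \<le> q ((x + z) + (y - z))" using M(2) by fastforce
    then show ?thesis using add[of "x + z" "y - z"] by linarith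
  qed
  have ne: "A \<noteq> {}" using zero by (auto simp: A_def)
  have bdd: "bdd_above A"
    using sep[OF zero] by (auto simp: A_def intro!: bdd_aboveI)
  define c where "c = Sup A"
  have lower: "s - q (y - z) \<le> c" if "(y, s) \<in> M" for y s
    unfolding c_def using that by (intro cSup_upper bdd) (force simp: A_def)
  have upper: "c \<le> q (x + z) - r" if "(x, r) \<in> M" for x r
    unfolding c_def using sep[OF that] by (intro cSup_least ne) (auto simp: A_def)
  have "r + t * c \<le> q (x + t *\<^sub>R z)" if xr: "(x, r) \<in> M" for x r t
  proof (cases t "0 :: real" rule: linorder_cases)
    case greater
    have "(inverse t *\<^sub>R x, inverse t * r) \<in> M" using subspace_scale[OF M(1) xr, of "inverse t"] by simp
    from upper[OF this] have "t * (inverse t * r + c) \<le> t * q (inverse t *\<^sub>R x + z)"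
      using greater by simp
    also have "\<dots> = q (x + t *\<^sub>R z)" using greater by (simp flip: scale add: scaleR_add_right)
    finally show ?thesis using greater by (simp add: distrib_left flip: mult.assoc)
  next
    case less
    define u where "u = - t"
    have u: "u > 0" "t = - u" using less by (auto simp: u_def)
    have "(inverse u *\<^sub>R x, inverse u * r) \<in> M" using subspace_scale[OF M(1) xr, of "inverse u"] by simp
    from lower[OF this] have "u * (inverse u * r - c) \<le> u * q (inverse u *\<^sub>R x - z)"
      using u by simp
    also have "\<dots> = q (x - u *\<^sub>R z)" using u by (simp flip: scale add: scaleR_diff_right)
    finally show ?thesis using u by (simp add: right_diff_distrib flip: mult.assoc)
  next
    case equal
    then show ?thesis using M(2)[OF xr] by simp
  qed
  then show ?thesis by blast
qed

text \<open>Domination makes a subspace of pairs the graph of a function, because both \<open>(0, r)\<close> and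
  \<open>(0, - r)\<close> would have to satisfy \<open>r \<le> q 0\<close>. So Zorn's lemma can be applied to dominated
  subspaces ordered by inclusion, without speaking about partial functions.\<close>

lemma real_Hahn_Banach:
  fixes q :: "'a::real_vector \<Rightarrow> real" and G :: "('a \<times> real) set"
  assumes add: "\<And>x y. q (x + y) \<le> q x + q y"
    and scale: "\<And>t x. 0 < t \<Longrightarrow> q (t *\<^sub>R x) = t * q x"
    and q0: "q 0 = 0"
    and G: "subspace G" "\<And>x r. (x, r) \<in> G \<Longrightarrow> r \<le> q x"
  obtains f where "linear f" "\<And>x. f x \<le> q x" "\<And>x r. (x, r) \<in> G \<Longrightarrow> f x = r"
proof -
  define F where "F = {H. subspace H \<and> G \<subseteq> H \<and> (\<forall>(x, r)\<in>H. r \<le> q x)}"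
  have "\<exists>M\<in>F. \<forall>X\<in>F. M \<subseteq> X \<longrightarrow> X = M"
  proof (rule subset_Zorn_nonempty)
    show "F \<noteq> {}" using G by (auto simp: F_def)
  next
    fix C assume ne: "C \<noteq> {}" and chain: "subset.chain F C"
    then have CF: "C \<subseteq> F" and tot: "\<And>a b. a \<in> C \<Longrightarrow> b \<in> C \<Longrightarrow> a \<subseteq> b \<or> b \<subseteq> a"
      by (auto simp: subset_chain_def)
    have "subspace (\<Union>C)"
    proof (rule subspaceI)
      obtain H where "H \<in> C" "subspace H" using ne CF by (auto simp: F_def)
      then show "0 \<in> \<Union>C" using subspace_0 by blast
      show "x + y \<in> \<Union>C" if xy: "x \<in> \<Union>C" "y \<in> \<Union>C" for x y
      proof -
        obtain a b where ab: "a \<in> C" "x \<in> a" "b \<in> C" "y \<in> b" using xy by auto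
        have "\<exists>c\<in>C. x \<in> c \<and> y \<in> c" using ab tot[of a b] by blast
        then obtain H where "H \<in> C" "x \<in> H" "y \<in> H" by blast
        moreover then have "subspace H" using CF by (auto simp: F_def)
        ultimately show ?thesis using subspace_add by blast
      qed
      show "k *\<^sub>R x \<in> \<Union>C" if xC: "x \<in> \<Union>C" for k x
      proof -
        obtain H where "H \<in> C" "x \<in> H" using xC by blast
        moreover then have "subspace H" using CF by (auto simp: F_def)
        ultimately show ?thesis using subspace_scale by blast
      qed
    qed
    moreover have "G \<subseteq> \<Union>C" using ne CF unfolding F_def by blast
    moreover have "\<forall>(x, r)\<in>\<Union>C. r \<le> q x" using CF unfolding F_def by blast
    ultimately show "\<Union>C \<in> F" by (simp add: F_def)
  qed
  then obtain M where MF: "M \<in> F" and max: "\<And>X. X \<in> F \<Longrightarrow> M \<subseteq> X \<Longrightarrow> X = M"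
    by metis
  have M: "subspace M" "G \<subseteq> M" "\<And>x r. (x, r) \<in> M \<Longrightarrow> r \<le> q x"
    using MF by (auto simp: F_def)
  have total: "\<exists>r. (z, r) \<in> M" for z
  proof -
    obtain c where c: "\<And>x r t. (x, r) \<in> M \<Longrightarrow> r + t * c \<le> q (x + t *\<^sub>R z)"
      using sublinear_extension_maximal[OF add scale M(1,3)] by metis
    define X where "X = span (insert (z, c) M)"
    have spanM: "span M = M" using M(1) by (simp add: span_eq_iff)
    have "X \<in> F"
    proof -
      have "r \<le> q x" if xr: "(x, r) \<in> X" for x r
      proof -
        obtain k where "(x, r) - k *\<^sub>R (z, c) \<in> M"
          using xr by (auto simp: X_def span_insert spanM)
        then have "(x - k *\<^sub>R z, r - k * c) \<in> M" by simp
        from c[OF this, of k] show ?thesis by simp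
      qed
      then show ?thesis using M(2) span_superset[of "insert (z, c) M"] by (auto simp: F_def X_def)
    qed
    moreover have "M \<subseteq> X" using span_superset[of "insert (z, c) M"] by (auto simp: X_def)
    ultimately have "X = M" by (rule max)
    then show ?thesis using span_base[of "(z, c)" "insert (z, c) M"] by (auto simp: X_def)
  qed
  have uniq: "r = s" if "(x, r) \<in> M" "(x, s) \<in> M" for x r s
  proof -
    have "(0, r - s) \<in> M" "(0, s - r) \<in> M"
      using subspace_diff[OF M(1) that] subspace_diff[OF M(1) that(2,1)] by simp_all
    from M(3)[OF this(1)] M(3)[OF this(2)] show ?thesis using q0 by simp
  qed
  obtain f where f: "\<And>z. (z, f z) \<in> M" using total by metis
  have "linear f"
  proof (rule linearI)
    show "f (x + y) = f x + f y" for x y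
      using uniq[OF f] subspace_add[OF M(1) f[of x] f[of y]] by simp
    show "f (k *\<^sub>R x) = k *\<^sub>R f x" for k x
      using uniq[OF f] subspace_scale[OF M(1) f[of x], of k] by simp
  qed
  then show ?thesis using that M f uniq by blast
qed

text \<open>The real part of \<open>f\<close> is extended to \<open>g\<close>, and \<open>F x = g x - \<i> g (\<i> x)\<close> is the complex
  functional with real part \<open>g\<close>. Rotating \<open>x\<close> so that \<open>F x\<close> becomes real turns the bound on \<open>g\<close>
  into one on \<open>\<bar>F\<bar>\<close>.\<close>

proposition complex_Hahn_Banach:
  fixes q :: "'a::complex_normed_vector \<Rightarrow> real" and f :: "'a \<Rightarrow> complex"
  assumes add: "\<And>x y. q (x + y) \<le> q x + q y"
    and scale: "\<And>c x. q (c *\<^sub>C x) = cmod c * q x"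
    and V: "csubspace V"
    and f_add: "\<And>x y. x \<in> V \<Longrightarrow> y \<in> V \<Longrightarrow> f (x + y) = f x + f y"
    and f_scale: "\<And>c x. x \<in> V \<Longrightarrow> f (c *\<^sub>C x) = c * f x"
    and f_le: "\<And>x. x \<in> V \<Longrightarrow> cmod (f x) \<le> q x"
  obtains F where "clinear F" "\<And>x. cmod (F x) \<le> q x" "\<And>x. x \<in> V \<Longrightarrow> F x = f x"
proof -
  define G where "G = (\<lambda>x. (x, Re (f x))) ` V"
  have q0: "q 0 = 0" using scale[of 0 0] by simp
  have sG: "subspace G"
  proof (rule subspaceI)
    have "f 0 = 0" using f_scale[of 0 0] csubspace_0[OF V] by simp
    then show "0 \<in> G" using csubspace_0[OF V] by (force simp: G_def zero_prod_def)
    show "x + y \<in> G" if "x \<in> G" "y \<in> G" for x y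
      using that f_add csubspace_add[OF V] by (fastforce simp: G_def)
    show "k *\<^sub>R x \<in> G" if "x \<in> G" for k x
      using that f_scale[of _ "complex_of_real k"] csubspace_scale[OF V, of _ "complex_of_real k"]
      by (auto simp: G_def scaleR_scaleC image_iff)
  qed
  have G_le: "r \<le> q x" if "(x, r) \<in> G" for x r
    using that f_le complex_Re_le_cmod[of "f x"] by (fastforce simp: G_def)
  have scaleR: "q (t *\<^sub>R x) = t * q x" if "0 < t" for t x
    using that by (simp add: scaleR_scaleC scale)
  obtain g where g: "linear g" "\<And>x. g x \<le> q x" "\<And>x r. (x, r) \<in> G \<Longrightarrow> g x = r"
    using real_Hahn_Banach[OF add scaleR q0 sG G_le] by metis
  define F where "F x = Complex (g x) (- g (\<i> *\<^sub>C x))" for x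
  have gadd: "g (x + y) = g x + g y" for x y using g(1) by (rule linear_add)
  have gsc: "g (complex_of_real r *\<^sub>C x) = r * g x" for r x
    using linear_scale[OF g(1), of r x] by (simp add: scaleR_scaleC)
  have gneg: "g (- x) = - g x" for x using g(1) by (rule linear_neg)
  have Fadd: "F (x + y) = F x + F y" for x y
    by (simp add: F_def gadd scaleC_add_right complex_eq_iff)
  have Fre: "F (complex_of_real r *\<^sub>C x) = of_real r * F x" for r x
  proof -
    have "g ((\<i> * complex_of_real r) *\<^sub>C x) = r * g (\<i> *\<^sub>C x)"
      using gsc[of r "\<i> *\<^sub>C x"] by (simp add: scaleC_scaleC mult.commute)
    then show ?thesis by (simp add: F_def gsc complex_eq_iff)
  qed
  have Fi: "F (\<i> *\<^sub>C x) = \<i> * F x" for x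
    by (simp add: F_def scaleC_scaleC gneg complex_eq_iff)
  have Fsc: "F (c *\<^sub>C x) = c * F x" for c x
  proof -
    have eq: "c *\<^sub>C x = complex_of_real (Re c) *\<^sub>C x + \<i> *\<^sub>C complex_of_real (Im c) *\<^sub>C x"
      by (simp add: scaleC_scaleC flip: scaleC_add_left complex_eq)
    have "F (c *\<^sub>C x) = F (complex_of_real (Re c) *\<^sub>C x) + F (\<i> *\<^sub>C complex_of_real (Im c) *\<^sub>C x)"
      unfolding Fadd[symmetric] eq[symmetric] ..
    also have "\<dots> = (of_real (Re c) + \<i> * of_real (Im c)) * F x"
      unfolding Fre Fi by (simp add: algebra_simps)
    also have "\<dots> = c * F x" by (simp flip: complex_eq)
    finally show ?thesis .
  qed
  have "cmod (F x) \<le> q x" for x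
  proof (cases "F x = 0")
    case True
    have "0 = q (x + - x)" using q0 by simp
    also have "\<dots> \<le> q x + q (- x)" by (rule add)
    also have "q (- x) = q x" using scale[of "-1" x] by simp
    finally show ?thesis using True by simp
  next
    case False
    define c where "c = cnj (F x) / cmod (F x)"
    have c: "cmod c = 1" "c * F x = cmod (F x)" using False
      by (simp_all add: c_def norm_divide mult.commute[of "cnj (F x)"] complex_norm_square[symmetric] power2_eq_square)
    have "cmod (F x) = Re (F (c *\<^sub>C x))" using c(2) by (simp add: Fsc)
    also have "\<dots> \<le> q (c *\<^sub>C x)" using g(2) by (simp add: F_def)
    finally show ?thesis using c(1) scale by simp
  qed
  moreover have "clinear F" using Fadd Fsc by (simp add: clinear_iff scaleC_complex_def)
  moreover have "F x = f x" if "x \<in> V" for x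
  proof -
    have "g x = Re (f x)" using g(3)[of x "Re (f x)"] that by (simp add: G_def)
    moreover have "g (\<i> *\<^sub>C x) = Re (f (\<i> *\<^sub>C x))"
      using g(3)[of "\<i> *\<^sub>C x" "Re (f (\<i> *\<^sub>C x))"] csubspace_scale[OF V that] by (simp add: G_def)
    ultimately show ?thesis using f_scale[OF that] by (simp add: F_def complex_eq_iff)
  qed
  ultimately show ?thesis by (intro that)
qed

lemma bounded_clinear_intro:
  assumes "clinear f" "\<And>x. norm (f x) \<le> K * norm x"
  shows "bounded_clinear f"
  unfolding bounded_clinear_def
proof
  show "bounded_linear f"
    using assms by (intro bounded_linear_intro[where K = K])
      (simp_all add: clinear_iff scaleR_scaleC mult.commute)
qed (use assms in \<open>simp add: clinear_iff\<close>)

lemma bounded_clinear_imp_clinear: "bounded_clinear f \<Longrightarrow> clinear f"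
  by (simp add: bounded_clinear_def clinear_iff linear_add bounded_linear.linear)

lemma bounded_clinear_cdual_apply: "bounded_clinear (cdual_apply \<phi>)"
  using cdual_apply by blast

lemma clinear_cdual_apply: "clinear (cdual_apply \<phi>)"
  by (rule bounded_clinear_imp_clinear[OF bounded_clinear_cdual_apply])

lemma cdual_extension:
  fixes f :: "'a::complex_normed_vector \<Rightarrow> complex"
  assumes V: "csubspace V"
    and f_add: "\<And>x y. x \<in> V \<Longrightarrow> y \<in> V \<Longrightarrow> f (x + y) = f x + f y"
    and f_scale: "\<And>c x. x \<in> V \<Longrightarrow> f (c *\<^sub>C x) = c * f x"
    and f_le: "\<And>x. x \<in> V \<Longrightarrow> cmod (f x) \<le> K * norm x" and K: "0 \<le> K"
  obtains \<phi> where "\<And>x. x \<in> V \<Longrightarrow> cdual_apply \<phi> x = f x"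
proof -
  have "K * norm (x + y) \<le> K * norm x + K * norm y" for x y :: 'a
    using mult_left_mono[OF norm_triangle_ineq K] by (simp add: distrib_left)
  moreover have "K * norm (c *\<^sub>C x) = cmod c * (K * norm x)" for c and x :: 'a
    by (simp add: norm_scaleC)
  ultimately obtain F where F: "clinear F" "\<And>x. cmod (F x) \<le> K * norm x" "\<And>x. x \<in> V \<Longrightarrow> F x = f x"
    using complex_Hahn_Banach[OF _ _ V f_add f_scale f_le] by metis
  have "cdual_apply (Cdual F) = F" using bounded_clinear_intro[OF F(1,2)] by (simp add: Cdual_inverse)
  then show ?thesis using that[of "Cdual F"] F by simp
qed

text \<open>Applying the inequality to \<open>c\<close> and to its inverse gives the equality. For seminorms defined
  as an infimum only the inequality is immediate.\<close>

lemma seminorm_scaleC_eqI: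
  fixes q :: "'a::complex_normed_vector \<Rightarrow> real"
  assumes le: "\<And>c x. c \<noteq> 0 \<Longrightarrow> q (c *\<^sub>C x) \<le> cmod c * q x" and q0: "q 0 = 0"
  shows "q (c *\<^sub>C x) = cmod c * q x"
proof (cases "c = 0")
  case False
  have "q (inverse c *\<^sub>C (c *\<^sub>C x)) \<le> cmod (inverse c) * q (c *\<^sub>C x)" using False by (intro le) simp
  then have "cmod c * q x \<le> cmod c * (cmod (inverse c) * q (c *\<^sub>C x))"
    using False by (intro mult_left_mono) (simp_all add: scaleC_scaleC scaleC_one)
  also have "\<dots> = q (c *\<^sub>C x)" using False by (simp add: norm_divide divide_simps)
  finally show ?thesis using le[OF False, of x] by simp
qed (simp add: q0)

text \<open>Partial minimisation of a jointly subadditive and homogeneous function. The distance to a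
  subspace is one instance; the gauge in the closed range theorem is another.\<close>

lemma infimum_seminorm:
  fixes g :: "'a::complex_normed_vector \<Rightarrow> 'b::complex_normed_vector \<Rightarrow> real"
  assumes W: "csubspace W" and nonneg: "\<And>y x. 0 \<le> g y x"
    and add: "\<And>y y' x x'. g (y + y') (x + x') \<le> g y x + g y' x'"
    and scale: "\<And>c y x. g (c *\<^sub>C y) (c *\<^sub>C x) = cmod c * g y x"
  shows "(INF x\<in>W. g (y + y') x) \<le> (INF x\<in>W. g y x) + (INF x\<in>W. g y' x)"
    and "(INF x\<in>W. g (c *\<^sub>C y) x) = cmod c * (INF x\<in>W. g y x)"
proof -
  define q where "q y = (INF x\<in>W. g y x)" for y
  have ne: "W \<noteq> {}" using csubspace_0[OF W] by auto
  have bdd: "bdd_below (g y ` W)" for y using nonneg by (intro bdd_belowI[of _ 0]) auto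
  have lower: "q y \<le> g y x" if "x \<in> W" for y x unfolding q_def by (rule cINF_lower[OF bdd that])
  have "q (y + y') - q y' \<le> g y x" if x: "x \<in> W" for x
  proof -
    have "q (y + y') - g y x \<le> g y' x'" if "x' \<in> W" for x'
      using lower[OF csubspace_add[OF W x that], of "y + y'"] add[of y y' x x'] by simp
    then have "q (y + y') - g y x \<le> q y'" unfolding q_def[of y'] by (intro cINF_greatest ne)
    then show ?thesis by simp
  qed
  then have "q (y + y') - q y' \<le> q y" unfolding q_def[of y] by (intro cINF_greatest ne)
  then show "(INF x\<in>W. g (y + y') x) \<le> (INF x\<in>W. g y x) + (INF x\<in>W. g y' x)" by (simp add: q_def)
  have "q (c *\<^sub>C y) = cmod c * q y"
  proof (rule seminorm_scaleC_eqI[where q = q])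
    have "q 0 \<le> 0" using lower[OF csubspace_0[OF W], of 0] scale[of 0 0 0] by simp
    moreover have "0 \<le> q 0" unfolding q_def by (rule cINF_greatest[OF ne nonneg])
    ultimately show "q 0 = 0" by simp
    fix c :: complex and y assume c: "c \<noteq> 0"
    have "q (c *\<^sub>C y) / cmod c \<le> g y x" if "x \<in> W" for x
      using lower[OF csubspace_scale[OF W that], of "c *\<^sub>C y" c] c
      by (simp add: scale divide_le_eq mult.commute)
    then have "q (c *\<^sub>C y) / cmod c \<le> q y" unfolding q_def[of y] by (intro cINF_greatest ne)
    then show "q (c *\<^sub>C y) \<le> cmod c * q y" using c by (simp add: divide_le_eq mult.commute)
  qed
  then show "(INF x\<in>W. g (c *\<^sub>C y) x) = cmod c * (INF x\<in>W. g y x)" by (simp add: q_def)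
qed

lemma infdist_subspace_seminorm:
  fixes V :: "'a::complex_normed_vector set"
  assumes V: "csubspace V"
  shows infdist_subspace_add: "infdist (x + y) V \<le> infdist x V + infdist y V"
    and infdist_subspace_scale: "infdist (c *\<^sub>C x) V = cmod c * infdist x V"
proof -
  have inf: "infdist x V = (INF v\<in>V. dist x v)" for x
    using csubspace_0[OF V] by (intro infdist_notempty) auto
  have sc: "dist (c *\<^sub>C y) (c *\<^sub>C x) = cmod c * dist y x" for c and x y :: 'a
    by (simp add: dist_norm norm_scaleC flip: complex_vector.scale_right_diff_distrib)
  show "infdist (x + y) V \<le> infdist x V + infdist y V"
    unfolding inf by (rule infimum_seminorm(1)[where g = dist, OF V zero_le_dist dist_triangle_add sc])
  show "infdist (c *\<^sub>C x) V = cmod c * infdist x V"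
    unfolding inf by (rule infimum_seminorm(2)[where g = dist, OF V zero_le_dist dist_triangle_add sc])
qed

text \<open>On the line through \<open>z\<close> the functional sends \<open>k z\<close> to \<open>k q(z)\<close>. If \<open>z = 0\<close> the choice of \<open>k\<close>
  is ambiguous, but then the factor \<open>q z\<close> vanishes.\<close>

lemma seminorm_attaining_functional:
  fixes q :: "'a::complex_normed_vector \<Rightarrow> real"
  assumes add: "\<And>x y. q (x + y) \<le> q x + q y"
    and scale: "\<And>c x. q (c *\<^sub>C x) = cmod c * q x"
    and nonneg: "0 \<le> q z"
  obtains F where "clinear F" "\<And>x. cmod (F x) \<le> q x" "F z = complex_of_real (q z)"
proof -
  define f where "f x = (SOME k. x = k *\<^sub>C z) * complex_of_real (q z)" for x
  have f: "f (k *\<^sub>C z) = k * complex_of_real (q z)" for k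
  proof (cases "z = 0")
    case True
    then show ?thesis using scale[of 0 0] by (simp add: f_def)
  next
    case False
    then show ?thesis unfolding f_def by (simp add: complex_vector.scale_right_imp_eq)
  qed
  have span: "x \<in> cspan {z} \<longleftrightarrow> (\<exists>k. x = k *\<^sub>C z)" for x
    by (auto simp: complex_vector.span_singleton)
  have f1: "f (x + y) = f x + f y" if "x \<in> cspan {z}" "y \<in> cspan {z}" for x y
    using that f by (auto simp: span distrib_right simp flip: scaleC_add_left)
  have f2: "f (c *\<^sub>C x) = c * f x" if "x \<in> cspan {z}" for c x
    using that f by (auto simp: span scaleC_scaleC)
  have f3: "cmod (f x) \<le> q x" if "x \<in> cspan {z}" for x
    using that f nonneg by (auto simp: span norm_mult scale)
  obtain F where F: "clinear F" "\<And>x. cmod (F x) \<le> q x" "\<And>x. x \<in> cspan {z} \<Longrightarrow> F x = f x"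
    using complex_Hahn_Banach[where q = q and f = f, OF add scale complex_vector.subspace_span[of "{z}"] f1 f2 f3] by metis
  have "F z = complex_of_real (q z)"
    using F(3)[of z] f[of 1] by (simp add: cspan_base scaleC_one)
  then show ?thesis using that F(1,2) by metis
qed

lemma cdual_separates_closed_subspace:
  fixes z :: "'a::complex_normed_vector"
  assumes V: "csubspace V" "closed V" and z: "z \<notin> V"
  obtains \<phi> where "\<And>x. x \<in> V \<Longrightarrow> cdual_apply \<phi> x = 0" "cdual_apply \<phi> z = 1"
proof -
  have ne: "V \<noteq> {}" using csubspace_0[OF V(1)] by auto
  define d where "d = infdist z V"
  have d: "d \<noteq> 0" unfolding d_def using in_closed_iff_infdist_zero[OF V(2) ne] z by blast
  obtain F where F: "clinear F" "\<And>x. cmod (F x) \<le> infdist x V" "F z = complex_of_real d"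
    using seminorm_attaining_functional[where q = "\<lambda>x. infdist x V" and z = z, OF infdist_subspace_add[OF V(1)]
        infdist_subspace_scale[OF V(1)] infdist_nonneg] unfolding d_def by metis
  have "infdist x V \<le> 1 * norm x" for x
    using infdist_le[of 0 V x] csubspace_0[OF V(1)] by simp
  then have "cmod (F x) \<le> 1 * norm x" for x using F(2) order_trans by blast
  then have "bounded_clinear F" by (rule bounded_clinear_intro[OF F(1)])
  then have ap: "cdual_apply (Cdual F) = F" by (simp add: Cdual_inverse)
  define \<phi> where "\<phi> = inverse (complex_of_real d) *\<^sub>C Cdual F"
  have \<phi>: "cdual_apply \<phi> x = inverse (complex_of_real d) * F x" for x
    by (simp add: \<phi>_def scaleC_cdual.rep_eq ap scaleC_complex_def)
  have "cdual_apply \<phi> x = 0" if "x \<in> V" for x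
    using F(2)[of x] that by (simp add: \<phi>)
  moreover have "cdual_apply \<phi> z = 1" using d by (simp add: \<phi> F(3))
  ultimately show ?thesis using that by metis
qed

lemma cdual_separates_points:
  fixes z :: "'a::complex_normed_vector"
  assumes "\<And>\<phi>. cdual_apply \<phi> z = 0"
  shows "z = 0"
proof (rule ccontr)
  assume "z \<noteq> 0"
  then show False using cdual_separates_closed_subspace[of "{0}" z] assms
    by (metis closed_singleton complex_vector.subspace_single_0 singletonD zero_neq_one)
qed

section \<open>Bounded lifting and the open mapping theorem\<close>

lemma bounded_clinear_imp_bounded_linear: "bounded_clinear T \<Longrightarrow> bounded_linear T"
  by (simp add: bounded_clinear_def)

lemma bounded_clinear_bound:
  assumes "bounded_clinear T"
  obtains K where "K > 0" "\<And>x. norm (T x) \<le> K * norm x"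
  using bounded_linear.pos_bounded[OF bounded_clinear_imp_bounded_linear[OF assms]]
  by (metis mult.commute)

lemma bounded_clinear_tendsto:
  "bounded_clinear T \<Longrightarrow> (f \<longlongrightarrow> l) F \<Longrightarrow> ((\<lambda>x. T (f x)) \<longlongrightarrow> T l) F"
  by (rule bounded_linear.tendsto[OF bounded_clinear_imp_bounded_linear])

lemma bounded_clinear_funpow:
  fixes T :: "'a::complex_normed_vector \<Rightarrow> 'a"
  assumes "bounded_clinear T"
  shows "bounded_clinear (T ^^ n)"
proof (induction n)
  case 0
  show ?case by (simp add: bounded_clinear_def bounded_linear_ident id_def)
next
  case (Suc n)
  then show ?case using bounded_clinear_compose[OF assms Suc] by (simp add: o_def)
qed

lemma closed_kernel:
  assumes "bounded_clinear T"
  shows "closed (kernel T)"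
proof -
  have "continuous_on UNIV T"
    by (rule bounded_linear.continuous_on[OF bounded_clinear_imp_bounded_linear[OF assms] continuous_on_id])
  then have "closed (T -` {0})" by (rule closed_vimage[rotated]) simp
  then show ?thesis by (simp add: kernel_def vimage_def)
qed

lemma csubspace_LIMSEQ:
  assumes "closed V" "\<And>n. f n \<in> V" "f \<longlonglongrightarrow> l"
  shows "l \<in> V"
  using assms closed_sequentially by blast

text \<open>Successive approximation: the residual left by one approximate preimage is approximated in
  turn, and the series of preimages converges. The target \<open>Z\<close> may be larger than the image of \<open>M\<close>;
  with \<open>Z\<close> the closure of a range, the conclusion is that the range is closed.\<close>

lemma lifting_of_approximate_lifting:
  fixes T :: "'a::complex_banach \<Rightarrow> 'b::complex_normed_vector"
  assumes T: "bounded_clinear T"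
    and M: "csubspace M" "closed M" and Z: "csubspace Z" "T ` M \<subseteq> Z" and C: "0 \<le> C"
    and approx: "\<And>z e. z \<in> Z \<Longrightarrow> 0 < e \<Longrightarrow> \<exists>x\<in>M. norm x \<le> C * norm z \<and> norm (z - T x) < e"
    and y: "y \<in> Z"
  shows "\<exists>x\<in>M. T x = y \<and> norm x \<le> 2 * C * norm y"
proof (cases "y = 0")
  case True
  have "T 0 = 0" using clinear_0[OF bounded_clinear_imp_clinear[OF T]] .
  then show ?thesis using True csubspace_0[OF M(1)] by (intro bexI[of _ 0]) auto
next
  case False
  define a where "a = norm y"
  have a: "a > 0" using False by (simp add: a_def)
  have "\<forall>n. \<forall>z\<in>Z. \<exists>x\<in>M. norm x \<le> C * norm z \<and> norm (z - T x) < a / 2 ^ Suc n"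
    using approx a by simp
  then obtain h where h: "\<And>n z. z \<in> Z \<Longrightarrow> h n z \<in> M \<and> norm (h n z) \<le> C * norm z
      \<and> norm (z - T (h n z)) < a / 2 ^ Suc n"
    by metis
  \<comment> \<open>\<open>R n\<close> is the residual after \<open>n\<close> corrections, of norm at most \<open>a / 2 ^ n\<close>.\<close>
  define R where "R = rec_nat y (\<lambda>n r. r - T (h n r))"
  have R0: "R 0 = y" and RS: "R (Suc n) = R n - T (h n (R n))" for n by (simp_all add: R_def)
  define X where "X n = h n (R n)" for n
  have RZ: "R n \<in> Z" for n
  proof (induction n)
    case 0
    show ?case using y by (simp add: R0)
  next
    case (Suc n)
    have "T (h n (R n)) \<in> Z" using h[OF Suc] Z(2) by blast
    then show ?case using csubspace_diff[OF Z(1) Suc] by (simp add: RS)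
  qed
  have Rn: "norm (R n) \<le> a / 2 ^ n" for n
  proof (cases n)
    case 0
    then show ?thesis by (simp add: R0 a_def)
  next
    case (Suc m)
    then show ?thesis using h[OF RZ[of m], of m] by (simp add: RS)
  qed
  have XM: "X n \<in> M" for n using h[OF RZ] by (simp add: X_def)
  have Xn: "norm (X n) \<le> C * a * (1 / 2) ^ n" for n
  proof -
    have "norm (X n) \<le> C * norm (R n)" using h[OF RZ] by (simp add: X_def)
    also have "\<dots> \<le> C * (a / 2 ^ n)" by (rule mult_left_mono[OF Rn C])
    finally show ?thesis by (simp add: power_one_over field_simps)
  qed
  have geo: "(\<lambda>n. C * a * (1 / 2) ^ n) sums (C * a * 2)"
    using sums_mult[OF geometric_sums[of "1 / 2 :: real"], of "C * a"] by simp
  have sn: "summable (\<lambda>n. norm (X n))"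
    by (rule summable_comparison_test'[OF sums_summable[OF geo], of 0]) (use Xn in simp)
  then have sX: "summable X" by (rule summable_norm_cancel)
  have "norm (suminf X) \<le> (\<Sum>n. norm (X n))" by (rule summable_norm[OF sn])
  also have "\<dots> \<le> (\<Sum>n. C * a * (1 / 2) ^ n)" by (rule suminf_le[OF Xn sn sums_summable[OF geo]])
  also have "\<dots> = 2 * C * norm y" using geo by (simp add: sums_iff a_def)
  finally have norm: "norm (suminf X) \<le> 2 * C * norm y" .
  have psum: "(\<Sum>i<n. T (X i)) = y - R n" for n
    by (induction n) (simp_all add: R0 RS X_def)
  have "R \<longlonglongrightarrow> 0"
  proof (rule Lim_null_comparison)
    show "\<forall>\<^sub>F n in sequentially. norm (R n) \<le> a * (1 / 2) ^ n"
      using Rn by (simp add: power_one_over field_simps)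
    show "(\<lambda>n. a * (1 / 2) ^ n) \<longlonglongrightarrow> 0"
      by (rule tendsto_mult_right_zero, rule LIMSEQ_power_zero) simp
  qed
  then have "(\<lambda>n. y - R n) \<longlonglongrightarrow> y - 0" by (intro tendsto_intros)
  then have "(\<lambda>i. T (X i)) sums y" by (simp add: sums_def psum)
  moreover have "(\<lambda>i. T (X i)) sums T (suminf X)"
    by (rule bounded_linear.sums[OF bounded_clinear_imp_bounded_linear[OF T] summable_sums[OF sX]])
  ultimately have "T (suminf X) = y" by (metis sums_unique2)
  moreover have "suminf X \<in> M"
  proof (rule csubspace_LIMSEQ[OF M(2)])
    show "(\<lambda>n. \<Sum>i<n. X i) \<longlonglongrightarrow> suminf X" using summable_LIMSEQ[OF sX] .
    show "(\<Sum>i<n. X i) \<in> M" for n by (rule complex_vector.subspace_sum[OF M(1)]) (rule XM)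
  qed
  ultimately show ?thesis using norm by (intro bexI[of _ "suminf X"]) simp_all
qed

text \<open>Baire's theorem for the complete metric space \<open>T M\<close>, which is the union of the relative
  closures of the images of balls of integer radius.\<close>

lemma closure_image_ball_interior:
  fixes T :: "'a::complex_normed_vector \<Rightarrow> 'b::complex_banach"
  assumes T: "bounded_clinear T" and M: "csubspace M" and cl: "closed (T ` M)"
  obtains n :: nat and y e where "y \<in> T ` M" "0 < e"
    "\<And>z. z \<in> T ` M \<Longrightarrow> dist y z < e \<Longrightarrow> z \<in> closure (T ` (M \<inter> cball 0 (real n)))"
proof -
  define Z where "Z = T ` M"
  interpret S: Submetric UNIV dist Z by unfold_locales simp
  have Zne: "Z \<noteq> {}" using csubspace_0[OF M] by (auto simp: Z_def)
  have top: "S.sub.mtopology = top_of_set Z"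
    using S.mtopology_submetric by simp
  have "Met_TC.mcomplete TYPE('b)" by (simp add: complete_UNIV)
  then have compl: "S.sub.mcomplete"
    using S.closedin_mcomplete_imp_mcomplete cl by (simp add: Z_def)
  define A where "A n = Z \<inter> closure (T ` (M \<inter> cball 0 (real n)))" for n
  have un: "\<Union>(range A) = Z"
  proof
    show "Z \<subseteq> \<Union>(range A)"
    proof
      fix z assume z: "z \<in> Z"
      then obtain x where x: "x \<in> M" "z = T x" by (auto simp: Z_def)
      obtain n where "norm x \<le> real n" using real_arch_simple by blast
      then have "z \<in> T ` (M \<inter> cball 0 (real n))" using x by auto
      then have "z \<in> closure (T ` (M \<inter> cball 0 (real n)))" by (rule subsetD[OF closure_subset])
      then show "z \<in> \<Union>(range A)" using z by (auto simp: A_def)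
    qed
  qed (auto simp: A_def)
  have "\<exists>n. (top_of_set Z) interior_of (A n) \<noteq> {}"
  proof (rule ccontr)
    assume no: "\<not> ?thesis"
    have "closedin S.sub.mtopology B \<and> S.sub.mtopology interior_of B = {}" if "B \<in> range A" for B
      using that no by (auto simp: top A_def intro: closedin_closed_Int)
    then have "S.sub.mtopology interior_of \<Union>(range A) = {}"
      by (intro S.sub.metric_Baire_category_alt[OF compl]) auto
    then show False using Zne by (simp add: un top interior_of_openin)
  qed
  then obtain n y where "y \<in> (top_of_set Z) interior_of (A n)" by blast
  then obtain U where U: "openin (top_of_set Z) U" "y \<in> U" "U \<subseteq> A n"
    by (auto simp: interior_of_def)
  then obtain e where e: "e > 0" "\<And>z. z \<in> Z \<Longrightarrow> dist z y < e \<Longrightarrow> z \<in> U"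
    unfolding openin_euclidean_subtopology_iff by blast
  have "y \<in> Z" using U by (auto simp: A_def)
  moreover have "z \<in> closure (T ` (M \<inter> cball 0 (real n)))" if "z \<in> Z" "dist y z < e" for z
    using e(2)[of z] that U(3) by (auto simp: A_def dist_commute)
  ultimately show ?thesis using that[of y e n] e(1) by (simp add: Z_def)
qed

text \<open>The open mapping theorem for the restriction of \<open>T\<close> to a closed subspace with closed image,
  in the form in which it is used: preimages can be chosen with norm bounded by that of the
  image.\<close>

proposition bounded_lifting:
  fixes T :: "'a::complex_banach \<Rightarrow> 'b::complex_banach"
  assumes T: "bounded_clinear T" and M: "csubspace M" "closed M" and cl: "closed (T ` M)"
  obtains C where "0 < C" "\<And>y. y \<in> T ` M \<Longrightarrow> \<exists>x\<in>M. T x = y \<and> norm x \<le> C * norm y"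
proof -
  obtain n :: nat and y0 e where y0: "y0 \<in> T ` M" and e: "0 < e"
    and ball: "\<And>z. z \<in> T ` M \<Longrightarrow> dist y0 z < e \<Longrightarrow> z \<in> closure (T ` (M \<inter> cball 0 (real n)))"
    using closure_image_ball_interior[OF T M(1) cl] by metis
  have lin: "clinear T" using bounded_clinear_imp_clinear[OF T] .
  have sZ: "csubspace (T ` M)" using clinear_subspace_image[OF lin M(1)] .
  \<comment> \<open>Vectors of \<open>T M\<close> of norm below \<open>e\<close> are differences of two points of the ball about \<open>y0\<close>,
    hence approximated by images of vectors of norm at most \<open>2 n\<close>; scaling by \<open>t = e / (2 \<parallel>z\<parallel>)\<close>
    gives \<open>C\<close>.\<close>
  define C where "C = 4 * real n / e"
  have C: "0 \<le> C" using e by (simp add: C_def)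
  have approx: "\<exists>x\<in>M. norm x \<le> C * norm z \<and> norm (z - T x) < d" if z: "z \<in> T ` M" and d: "0 < d" for z d
  proof (cases "z = 0")
    case True
    then show ?thesis using csubspace_0[OF M(1)] d clinear_0[OF lin]
      by (intro bexI[of _ 0]) auto
  next
    case False
    define t where "t = e / (2 * norm z)"
    have t: "t > 0" using False e by (simp add: t_def)
    define w where "w = complex_of_real t *\<^sub>C z"
    have w: "w \<in> T ` M" using z sZ by (simp add: w_def csubspace_scale)
    have "norm w = t * norm z" using t by (simp add: w_def norm_scaleC)
    then have nw: "norm w < e" using False e by (simp add: t_def)
    have "y0 + w \<in> closure (T ` (M \<inter> cball 0 (real n)))"
      using nw csubspace_add[OF sZ y0 w] by (intro ball) (auto simp: dist_norm)
    then obtain u where u: "u \<in> M" "norm u \<le> real n" "dist (T u) (y0 + w) < t * d / 2"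
      using t d unfolding closure_approachable Bex_def by (auto dest!: spec[of _ "t * d / 2"])
    have "y0 \<in> closure (T ` (M \<inter> cball 0 (real n)))" using ball[OF y0] e by simp
    then obtain v where v: "v \<in> M" "norm v \<le> real n" "dist (T v) y0 < t * d / 2"
      using t d unfolding closure_approachable Bex_def by (auto dest!: spec[of _ "t * d / 2"])
    define x where "x = complex_of_real (inverse t) *\<^sub>C (u - v)"
    have xM: "x \<in> M" unfolding x_def
      by (intro csubspace_scale[OF M(1)] csubspace_diff[OF M(1)] u v)
    have "norm (u - v) \<le> 2 * real n" using norm_triangle_ineq4[of u v] u(2) v(2) by simp
    moreover have "norm x = norm (u - v) / t" using t unfolding x_def norm_scaleC by (simp add: norm_divide field_simps)
    ultimately have "norm x \<le> 2 * real n / t" using t by (simp add: divide_right_mono)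
    then have nx: "norm x \<le> C * norm z" by (simp add: C_def t_def mult_ac)
    have "norm (w - T (u - v)) = norm ((y0 + w - T u) - (y0 - T v))"
      by (simp add: clinear_diff[OF lin] algebra_simps)
    also have "\<dots> \<le> norm (y0 + w - T u) + norm (y0 - T v)" by (rule norm_triangle_ineq4)
    also have "\<dots> < t * d" using u(3) v(3) by (simp add: dist_norm norm_minus_commute)
    finally have lt: "norm (w - T (u - v)) < t * d" .
    have "z - T x = complex_of_real (inverse t) *\<^sub>C (w - T (u - v))"
    proof -
      have "complex_of_real (inverse t) *\<^sub>C w = z"
        using t by (simp add: w_def scaleC_scaleC scaleC_one flip: of_real_mult)
      moreover have "T x = complex_of_real (inverse t) *\<^sub>C T (u - v)"
        unfolding x_def by (rule clinear_scale[OF lin])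
      ultimately show ?thesis by (simp only: complex_vector.scale_right_diff_distrib)
    qed
    then have "norm (z - T x) = inverse t * norm (w - T (u - v))" using t by (simp only: norm_scaleC) (simp add: norm_inverse)
    also have "\<dots> < d" using lt t by (simp add: field_simps)
    finally show ?thesis using xM nx by blast
  qed
  have "\<exists>x\<in>M. T x = y \<and> norm x \<le> (2 * C + 1) * norm y" if y: "y \<in> T ` M" for y
  proof -
    obtain x where "x \<in> M" "T x = y" "norm x \<le> 2 * C * norm y"
      using lifting_of_approximate_lifting[OF T M sZ order_refl C approx y] by blast
    moreover have "2 * C * norm y \<le> (2 * C + 1) * norm y" by (simp add: distrib_right)
    ultimately show ?thesis by (intro bexI[of _ x]) simp_all
  qed
  moreover have "0 < 2 * C + 1" using C by simp
  ultimately show ?thesis by (rule that[rotated])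
qed

section \<open>Closed and finite dimensional subspaces\<close>

lemma bounded_linear_scaleC_left: "bounded_linear (\<lambda>c. c *\<^sub>C (b::'a::complex_normed_vector))"
  by (rule bounded_linear_intro[where K = "norm b"])
    (simp_all add: scaleC_add_left scaleR_scaleC scaleC_scaleC norm_scaleC scaleR_conv_of_real scaleC_complex_def)

lemmas tendsto_scaleC_left = bounded_linear.tendsto[OF bounded_linear_scaleC_left]

lemma infdist_le_norm_add:
  assumes "csubspace V" "v \<in> V"
  shows "infdist x V \<le> norm (v + (x::'a::complex_normed_vector))"
proof -
  have "infdist x V \<le> dist x (- v)"
    using assms by (intro infdist_le) (rule complex_vector.subspace_neg)
  then show ?thesis by (simp add: dist_norm add.commute)
qed

lemma infdist_pos_of_closed:
  assumes "csubspace V" "closed V" "b \<notin> V"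
  shows "0 < infdist (b::'a::complex_normed_vector) V"
proof -
  have "V \<noteq> {}" using csubspace_0[OF assms(1)] by auto
  then have "infdist b V \<noteq> 0" using in_closed_iff_infdist_zero[OF assms(2)] assms(3) by blast
  then show ?thesis using infdist_nonneg[of b V] by simp
qed

text \<open>The coefficient along a vector \<open>b\<close> at positive distance from \<open>V\<close> is controlled by the norm.
  This is the only estimate needed for closedness and for compactness in finite dimensions, both
  by induction on a spanning set.\<close>

lemma coefficient_bound:
  fixes b :: "'a::complex_normed_vector"
  assumes V: "csubspace V" "v \<in> V"
  shows "cmod c * infdist b V \<le> norm (v + c *\<^sub>C b)"
  using infdist_le_norm_add[OF V, of "c *\<^sub>C b"] by (simp add: infdist_subspace_scale[OF V(1)])

lemma closed_cspan_insert:
  fixes b :: "'a::complex_normed_vector"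
  assumes V: "csubspace V" "closed V"
  shows "closed (cspan (insert b V))"
proof (cases "b \<in> V")
  case True
  then have "insert b V = V" by auto
  then show ?thesis using V cspan_eq_iff[of V] by (metis Un_empty_right)
next
  case False
  define d where "d = infdist b V"
  have d: "0 < d" unfolding d_def by (rule infdist_pos_of_closed[OF V False])
  have span: "x \<in> cspan (insert b V) \<longleftrightarrow> (\<exists>k. x - k *\<^sub>C b \<in> V)" for x
    using V(1) cspan_eq_iff[THEN iffD2, OF V(1)] by (simp only: cspan_insert mem_Collect_eq)
  show ?thesis
    unfolding closed_sequential_limits
  proof (intro allI impI, elim conjE)
    fix f l assume f: "\<forall>n. f n \<in> cspan (insert b V)" and lim: "f \<longlonglongrightarrow> l"
    then obtain k where k: "\<And>n. f n - k n *\<^sub>C b \<in> V" unfolding span by metis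
    have "Cauchy k"
    proof (rule metric_CauchyI)
      fix e :: real assume e: "0 < e"
      have "Cauchy f" using lim by (rule LIMSEQ_imp_Cauchy)
      then obtain M where M: "\<And>m n. m \<ge> M \<Longrightarrow> n \<ge> M \<Longrightarrow> norm (f m - f n) < e * d"
        using e d unfolding Cauchy_def dist_norm by (metis mult_pos_pos)
      have "dist (k m) (k n) < e" if "m \<ge> M" "n \<ge> M" for m n
      proof -
        have "(f m - k m *\<^sub>C b) - (f n - k n *\<^sub>C b) \<in> V"
          by (rule csubspace_diff[OF V(1) k k])
        from coefficient_bound[OF V(1) this, of "k m - k n" b]
        have "cmod (k m - k n) * d \<le> norm (f m - f n)"
          by (simp add: d_def complex_vector.scale_left_diff_distrib algebra_simps)
        also have "\<dots> < e * d" using M that by simp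
        finally show ?thesis using d by (simp add: dist_norm)
      qed
      then show "\<exists>M. \<forall>m\<ge>M. \<forall>n\<ge>M. dist (k m) (k n) < e" by blast
    qed
    then obtain c where c: "k \<longlonglongrightarrow> c" using Cauchy_convergent_iff convergent_def by metis
    have "(\<lambda>n. f n - k n *\<^sub>C b) \<longlonglongrightarrow> l - c *\<^sub>C b"
      by (intro tendsto_diff lim tendsto_scaleC_left c)
    then have "l - c *\<^sub>C b \<in> V" by (rule csubspace_LIMSEQ[OF V(2) k])
    then show "l \<in> cspan (insert b V)" unfolding span by blast
  qed
qed

lemma closed_cspan_Un_finite:
  fixes V :: "'a::complex_normed_vector set"
  assumes V: "csubspace V" "closed V" and B: "finite B"
  shows "closed (cspan (V \<union> B))"
  using B
proof (induction B rule: finite_induct)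
  case empty
  then show ?case using V cspan_eq_iff[of V] by (metis Un_empty_right)
next
  case (insert b B)
  have "cspan (V \<union> insert b B) = cspan (insert b (cspan (V \<union> B)))"
  proof (rule antisym)
    show "cspan (V \<union> insert b B) \<subseteq> cspan (insert b (cspan (V \<union> B)))"
      using cspan_superset[of "V \<union> B"] by (intro cspan_mono) auto
    have "cspan (V \<union> B) \<subseteq> cspan (V \<union> insert b B)" by (rule cspan_mono) auto
    moreover have "b \<in> cspan (V \<union> insert b B)" by (rule cspan_base) simp
    ultimately show "cspan (insert b (cspan (V \<union> B))) \<subseteq> cspan (V \<union> insert b B)"
      by (intro cspan_minimal) auto
  qed
  then show ?case using closed_cspan_insert[OF _ insert.IH] by simp
qed

lemma closed_cspan_finite: "finite B \<Longrightarrow> closed (cspan B)" for B :: "'a::complex_normed_vector set"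
  using closed_cspan_Un_finite[of "{0}" B] by simp

text \<open>\<open>V\<close> is the sum of \<open>M\<close> and a finite dimensional space, namely the part of \<open>V\<close> in the span of
  a finite set that completes \<open>M\<close>.\<close>

lemma closed_superspace_of_finite_codimension:
  assumes M: "csubspace M" "closed M" "ccodimension M < \<infinity>" and V: "csubspace V" "M \<subseteq> V"
  shows "closed V"
proof -
  obtain B where B: "finite B" "cspan (M \<union> B) = UNIV"
    using M(3) ccodimension_less_infty_iff[OF M(1)] by auto
  have sub: "csubspace (cspan B \<inter> V)" using V(1) by (intro complex_vector.subspace_inter) auto
  have "cdimension (cspan B \<inter> V) < \<infinity>" unfolding cdimension_less_infty_iff using B(1) by auto
  then obtain A where A: "finite A" "cspan A = cspan B \<inter> V" using cdimension_basis[OF sub] by metis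
  have "V = cspan (M \<union> A)"
  proof
    show "V \<subseteq> cspan (M \<union> A)"
    proof
      fix x assume x: "x \<in> V"
      have "x \<in> cspan (M \<union> B)" using B by simp
      then obtain m b where mb: "m \<in> M" "b \<in> cspan B" "x = m + b"
        unfolding in_cspan_Un_iff[OF M(1)] by blast
      have "x - m \<in> V" using mb(1) V x by (intro csubspace_diff) auto
      then have "b \<in> cspan A" using mb A by simp
      then show "x \<in> cspan (M \<union> A)" unfolding in_cspan_Un_iff[OF M(1)] using mb by blast
    qed
    have "A \<subseteq> V" using A(2) cspan_superset[of A] by blast
    then show "cspan (M \<union> A) \<subseteq> V" using V by (intro cspan_minimal) auto
  qed
  then show ?thesis using closed_cspan_Un_finite[OF M(1,2) A(1)] by simp
qed

text \<open>Local compactness of finite dimensional subspaces: the coefficients of one basis vector are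
  bounded, a subsequence of them converges, and the remainder lies in a smaller span.\<close>

lemma finite_dimensional_bounded_subsequence:
  fixes x :: "nat \<Rightarrow> 'a::complex_normed_vector"
  assumes B: "finite B" and x: "\<And>n. x n \<in> cspan B" "\<And>n. norm (x n) \<le> K"
  shows "\<exists>r l. strict_mono r \<and> (x \<circ> r) \<longlonglongrightarrow> l"
  using B x
proof (induction B arbitrary: x K rule: finite_induct)
  case empty
  then have "x = (\<lambda>n. 0)" by auto
  then have "(x \<circ> id) \<longlonglongrightarrow> 0" by simp
  then show ?case using strict_mono_id by blast
next
  case (insert b B)
  show ?case
  proof (cases "b \<in> cspan B")
    case True
    then have "x n \<in> cspan B" for n using insert.prems(1) by (metis complex_vector.span_redundant)
    then show ?thesis by (rule insert.IH[OF _ insert.prems(2)])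
  next
    case False
    define d where "d = infdist b (cspan B)"
    have d: "0 < d" unfolding d_def using closed_cspan_finite[OF insert.hyps(1)]
      by (intro infdist_pos_of_closed False) auto
    obtain k where k: "\<And>n. x n - k n *\<^sub>C b \<in> cspan B"
      using insert.prems(1) unfolding cspan_insert mem_Collect_eq by metis
    have kd: "cmod (k n) \<le> K / d" for n
    proof -
      have "cmod (k n) * d \<le> norm (x n)"
        using coefficient_bound[OF complex_vector.subspace_span k[of n], of "k n" b] by (simp add: d_def)
      also have "\<dots> \<le> K" by (rule insert.prems(2))
      finally show ?thesis using d by (simp add: field_simps)
    qed
    then have "bounded (range k)" unfolding bounded_iff by blast
    then obtain c r where r: "strict_mono r" "(k \<circ> r) \<longlonglongrightarrow> c"
      using bounded_imp_convergent_subsequence by blast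
    define y where "y n = x (r n) - k (r n) *\<^sub>C b" for n
    have "norm (y n) \<le> K + K / d * norm b" for n
    proof -
      have "norm (y n) \<le> norm (x (r n)) + cmod (k (r n)) * norm b"
        unfolding y_def by (metis norm_scaleC norm_triangle_ineq4)
      then show ?thesis using insert.prems(2)[of "r n"] mult_right_mono[OF kd[of "r n"], of "norm b"] by simp
    qed
    then obtain s l where s: "strict_mono s" "(y \<circ> s) \<longlonglongrightarrow> l"
      using insert.IH[of y] k unfolding y_def by blast
    have "(k \<circ> r \<circ> s) \<longlonglongrightarrow> c" by (rule LIMSEQ_subseq_LIMSEQ[OF r(2) s(1)])
    then have "(\<lambda>n. k (r (s n)) *\<^sub>C b) \<longlonglongrightarrow> c *\<^sub>C b"
      by (intro tendsto_scaleC_left) (simp add: o_def)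
    then have "(\<lambda>n. (y \<circ> s) n + k (r (s n)) *\<^sub>C b) \<longlonglongrightarrow> l + c *\<^sub>C b" by (intro tendsto_add s(2))
    then have "(x \<circ> (r \<circ> s)) \<longlonglongrightarrow> l + c *\<^sub>C b" by (simp add: y_def o_def)
    then show ?thesis using strict_mono_o[OF r(1) s(1)] by blast
  qed
qed

section \<open>Properness on bounded sets\<close>

text \<open>For bounded operators on a Banach space this is equivalent to closed range and finite
  nullity. Unlike that description it visibly passes to compositions and to right factors, which
  is how closedness of the ranges of powers is obtained.\<close>

definition proper_on_bounded :: "('a::complex_normed_vector \<Rightarrow> 'b::complex_normed_vector) \<Rightarrow> bool" where
  "proper_on_bounded T \<longleftrightarrow> (\<forall>x y K. (\<forall>n. norm (x n) \<le> K) \<longrightarrow> (\<lambda>n. T (x n)) \<longlonglongrightarrow> y \<longrightarrow>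
     (\<exists>r l. strict_mono (r :: nat \<Rightarrow> nat) \<and> (x \<circ> r) \<longlonglongrightarrow> l))"

lemma proper_on_boundedD:
  assumes "proper_on_bounded T" "\<And>n. norm (x n) \<le> K" "(\<lambda>n. T (x n)) \<longlonglongrightarrow> y"
  obtains r :: "nat \<Rightarrow> nat" and l where "strict_mono r" "(x \<circ> r) \<longlonglongrightarrow> l"
  using assms unfolding proper_on_bounded_def by metis

text \<open>Convergence in the range is convergence of suitable preimages: the errors \<open>f n - T z\<close> are
  lifted with norm control.\<close>

lemma null_sequence_lifting:
  fixes T :: "'a::complex_banach \<Rightarrow> 'b::complex_banach"
  assumes T: "bounded_clinear T" and cl: "closed (range T)"
    and f: "\<And>n. f n \<in> range T" and lim: "f \<longlonglongrightarrow> l" and l: "l = T z"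
  obtains u where "\<And>n. T (u n) = f n - l" "u \<longlonglongrightarrow> 0"
proof -
  obtain C where C: "0 < C" "\<And>w. w \<in> range T \<Longrightarrow> \<exists>u\<in>UNIV. T u = w \<and> norm u \<le> C * norm w"
    using bounded_lifting[OF T csubspace_UNIV closed_UNIV cl] by metis
  have "f n - l \<in> range T" for n
    by (rule csubspace_diff[OF csubspace_range[OF bounded_clinear_imp_clinear[OF T]] f]) (simp add: l)
  then have "\<exists>u. T u = f n - l \<and> norm u \<le> C * norm (f n - l)" for n using C(2) by blast
  then obtain u where u: "\<And>n. T (u n) = f n - l" "\<And>n. norm (u n) \<le> C * norm (f n - l)" by metis
  have "(\<lambda>n. C * norm (f n - l)) \<longlonglongrightarrow> 0"
    using lim by (intro tendsto_mult_right_zero tendsto_norm_zero LIM_zero)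
  then have "u \<longlonglongrightarrow> 0" by (rule Lim_null_comparison[rotated]) (use u(2) in simp)
  with u(1) show ?thesis by (rule that)
qed

lemma upper_semi_Fredholm_imp_proper_on_bounded:
  fixes T :: "'a::complex_banach \<Rightarrow> 'a"
  assumes T: "bounded_clinear T" and sF: "upper_semi_Fredholm T"
  shows "proper_on_bounded T"
  unfolding proper_on_bounded_def
proof (intro allI impI)
  fix x :: "nat \<Rightarrow> 'a" and y :: 'a and K :: real
  assume K: "\<forall>n. norm (x n) \<le> K" and lim: "(\<lambda>n. T (x n)) \<longlonglongrightarrow> y"
  have lin: "clinear T" using bounded_clinear_imp_clinear[OF T] .
  have cl: "closed (range T)" and "nullity T < \<infinity>" using sF by (auto simp: upper_semi_Fredholm_def)
  then obtain B where B: "finite B" "kernel T \<subseteq> cspan B"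
    unfolding nullity_def cdimension_less_infty_iff by auto
  have "y \<in> range T" using csubspace_LIMSEQ[OF cl _ lim] by simp
  then obtain z where z: "y = T z" by auto
  obtain u where u: "\<And>n. T (u n) = T (x n) - y" and u0: "u \<longlonglongrightarrow> 0"
    using null_sequence_lifting[OF T cl rangeI lim z] by metis
  obtain D where D: "\<And>n. norm (u n) \<le> D"
    using convergent_imp_Bseq[of u] u0 unfolding Bseq_def convergent_def by blast
  define w where "w n = x n - z - u n" for n
  have "w n \<in> cspan B" for n
    using B(2) by (auto simp: w_def kernel_def clinear_diff[OF lin] u z)
  moreover have "norm (w n) \<le> K + norm z + D" for n
  proof -
    have "norm (w n) \<le> norm (x n) + norm z + norm (u n)"
      unfolding w_def using norm_triangle_ineq4[of "x n - z" "u n"] norm_triangle_ineq4[of "x n" z] by simp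
    then show ?thesis using K D[of n] by (meson add_mono order_refl order_trans)
  qed
  ultimately obtain r l where r: "strict_mono r" "(w \<circ> r) \<longlonglongrightarrow> l"
    using finite_dimensional_bounded_subsequence[OF B(1), of w] by metis
  have "(u \<circ> r) \<longlonglongrightarrow> 0" by (rule LIMSEQ_subseq_LIMSEQ[OF u0 r(1)])
  then have "(\<lambda>n. (w \<circ> r) n + z + (u \<circ> r) n) \<longlonglongrightarrow> l + z + 0" by (intro tendsto_intros r(2))
  then have "(x \<circ> r) \<longlonglongrightarrow> l + z" by (simp add: w_def o_def)
  then show "\<exists>r l. strict_mono r \<and> (x \<circ> r) \<longlonglongrightarrow> l" using r(1) by blast
qed

text \<open>Approximate preimages are modified by kernel elements so that their norm almost equals their
  distance to the kernel. If they were unbounded, their normalisations would accumulate at a unit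
  vector of the kernel, although they keep a distance close to \<open>1\<close> from it.\<close>

lemma proper_on_bounded_imp_closed_range:
  fixes T :: "'a::complex_normed_vector \<Rightarrow> 'a"
  assumes T: "bounded_clinear T" and proper: "proper_on_bounded T"
  shows "closed (range T)"
  unfolding closed_sequential_limits
proof (intro allI impI, elim conjE)
  fix f l assume "\<forall>n. f n \<in> range T" and lim: "f \<longlonglongrightarrow> l"
  then obtain x where x: "\<And>n. f n = T (x n)" unfolding image_iff by metis
  have lin: "clinear T" using bounded_clinear_imp_clinear[OF T] .
  define N where "N = kernel T"
  have N: "csubspace N" "closed N" unfolding N_def using csubspace_kernel[OF lin] closed_kernel[OF T] by auto
  have Nne: "N \<noteq> {}" using csubspace_0[OF N(1)] by auto
  have "\<exists>z. T z = f n \<and> norm z \<le> infdist z N + 1" for n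
  proof -
    obtain v where v: "v \<in> N" "dist (x n) v < infdist (x n) N + 1"
      using cInf_lessD[of "dist (x n) ` N" "infdist (x n) N + 1"] Nne infdist_notempty[OF Nne, of "x n"] by auto
    have "infdist (x n) N \<le> infdist (x n - v) N + infdist v N"
      using infdist_subspace_add[OF N(1), of "x n - v" v] by simp
    then have "infdist (x n) N \<le> infdist (x n - v) N" using v(1) by simp
    then show ?thesis using v x
      by (intro exI[of _ "x n - v"]) (auto simp: clinear_diff[OF lin] N_def kernel_def dist_norm)
  qed
  then obtain z where z: "\<And>n. T (z n) = f n" "\<And>n. norm (z n) \<le> infdist (z n) N + 1" by metis
  have "\<exists>K. \<forall>n. norm (z n) \<le> K"
  proof (rule ccontr)
    assume "\<not> ?thesis"
    then have "\<forall>k. \<exists>n. norm (z n) > real k + 1" by (metis linorder_not_less)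
    then obtain s where s: "\<And>k. norm (z (s k)) > real k + 1" by metis
    then have pos: "norm (z (s k)) > 0" for k using of_nat_0_le_iff[of k] by (metis add_nonneg_pos less_numeral_extra(1) order_less_trans)
    define u where "u k = complex_of_real (inverse (norm (z (s k)))) *\<^sub>C z (s k)" for k
    have nu: "norm (u k) = 1" for k using pos[of k] unfolding u_def norm_scaleC by (simp add: norm_inverse)
    obtain D where D: "\<And>n. norm (f n) \<le> D" "D > 0"
      using convergent_imp_Bseq[of f] lim unfolding Bseq_def convergent_def by blast
    have "(\<lambda>k. T (u k)) \<longlonglongrightarrow> 0"
    proof (rule Lim_null_comparison)
      have "norm (T (u k)) \<le> D * inverse (real (Suc k))" for k
      proof -
        have "norm (T (u k)) = inverse (norm (z (s k))) * norm (f (s k))"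
          unfolding u_def clinear_scale[OF lin] norm_scaleC z(1) by (simp add: norm_inverse)
        also have "\<dots> \<le> inverse (real (Suc k)) * D"
          using s[of k] D by (intro mult_mono le_imp_inverse_le) auto
        finally show ?thesis by (simp add: mult.commute)
      qed
      then show "\<forall>\<^sub>F k in sequentially. norm (T (u k)) \<le> D * inverse (real (Suc k))" by simp
      show "(\<lambda>k. D * inverse (real (Suc k))) \<longlonglongrightarrow> 0"
        by (rule tendsto_mult_right_zero[OF LIMSEQ_inverse_real_of_nat])
    qed
    then obtain r w where r: "strict_mono r" "(u \<circ> r) \<longlonglongrightarrow> w"
      using proper_on_boundedD[OF proper, of u 1 0] nu by (metis order_refl)
    have "(\<lambda>k. T ((u \<circ> r) k)) \<longlonglongrightarrow> T w" by (rule bounded_clinear_tendsto[OF T r(2)])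
    moreover have "(\<lambda>k. T ((u \<circ> r) k)) \<longlonglongrightarrow> 0"
      using LIMSEQ_subseq_LIMSEQ[OF \<open>(\<lambda>k. T (u k)) \<longlonglongrightarrow> 0\<close> r(1)] by (simp add: o_def)
    ultimately have "T w = 0" by (rule LIMSEQ_unique)
    then have w: "w \<in> N" by (simp add: N_def kernel_def)
    have low: "1 - inverse (real (Suc k)) \<le> norm (u k - w)" for k
    proof -
      have "norm (z (s k)) - 1 \<le> infdist (z (s k)) N" using z(2)[of "s k"] by simp
      then have "inverse (norm (z (s k))) * (norm (z (s k)) - 1) \<le> infdist (u k) N"
        unfolding u_def infdist_subspace_scale[OF N(1)]
        using pos[of k] by (simp add: norm_inverse)
      moreover have "inverse (norm (z (s k))) * (norm (z (s k)) - 1) = 1 - inverse (norm (z (s k)))"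
        using pos[of k] by (simp add: right_diff_distrib)
      moreover have "inverse (norm (z (s k))) \<le> inverse (real (Suc k))"
        using s[of k] by (intro le_imp_inverse_le) auto
      moreover have "infdist (u k) N \<le> norm (u k - w)" using infdist_le[OF w, of "u k"] by (simp add: dist_norm)
      ultimately show ?thesis by linarith
    qed
    have up: "(\<lambda>k. norm ((u \<circ> r) k - w)) \<longlonglongrightarrow> 0" using r(2) by (intro tendsto_norm_zero LIM_zero)
    have "(\<lambda>k. 1 - inverse (real (Suc (r k)))) \<longlonglongrightarrow> 1 - 0"
      using LIMSEQ_subseq_LIMSEQ[OF LIMSEQ_inverse_real_of_nat r(1)] by (intro tendsto_intros) (simp add: o_def)
    from LIMSEQ_le[OF this up] have "1 - 0 \<le> (0 :: real)" using low by auto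
    then show False by simp
  qed
  then obtain K where "\<And>n. norm (z n) \<le> K" by blast
  moreover have "(\<lambda>n. T (z n)) \<longlonglongrightarrow> l" using lim z(1) by simp
  ultimately obtain r w where r: "strict_mono r" "(z \<circ> r) \<longlonglongrightarrow> w"
    using proper_on_boundedD[OF proper, of z K l] by metis
  have "(\<lambda>k. T ((z \<circ> r) k)) \<longlonglongrightarrow> T w" by (rule bounded_clinear_tendsto[OF T r(2)])
  moreover have "(\<lambda>k. T ((z \<circ> r) k)) \<longlonglongrightarrow> l"
    using LIMSEQ_subseq_LIMSEQ[OF lim r(1)] z(1) by (simp add: o_def)
  ultimately have "T w = l" by (rule LIMSEQ_unique)
  then show "l \<in> range T" by blast
qed

lemma proper_on_bounded_compose:
  assumes S: "proper_on_bounded S" and T: "proper_on_bounded T" "bounded_clinear T"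
  shows "proper_on_bounded (\<lambda>x. S (T x))"
  unfolding proper_on_bounded_def
proof (intro allI impI)
  fix x :: "nat \<Rightarrow> _" and y K
  assume K: "\<forall>n. norm (x n) \<le> K" and lim: "(\<lambda>n. S (T (x n))) \<longlonglongrightarrow> y"
  obtain C where C: "C > 0" "\<And>x. norm (T x) \<le> C * norm x" using bounded_clinear_bound[OF T(2)] by metis
  have "norm (T (x n)) \<le> C * K" for n using C K by (meson less_imp_le mult_left_mono order_trans)
  then obtain r l where r: "strict_mono r" "((\<lambda>n. T (x n)) \<circ> r) \<longlonglongrightarrow> l"
    using proper_on_boundedD[OF S, of "\<lambda>n. T (x n)" "C * K" y] lim by metis
  have "\<And>n. norm ((x \<circ> r) n) \<le> K" using K by simp
  moreover have "(\<lambda>n. T ((x \<circ> r) n)) \<longlonglongrightarrow> l" using r(2) by (simp add: o_def)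
  ultimately obtain s l' where s: "strict_mono s" "(x \<circ> r \<circ> s) \<longlonglongrightarrow> l'"
    using proper_on_boundedD[OF T(1), of "x \<circ> r" K l] by metis
  then show "\<exists>r l. strict_mono r \<and> (x \<circ> r) \<longlonglongrightarrow> l"
    using strict_mono_o[OF r(1) s(1)] by (metis comp_assoc)
qed

lemma proper_on_bounded_of_compose:
  assumes "proper_on_bounded (\<lambda>x. S (T x))" "bounded_clinear S"
  shows "proper_on_bounded T"
  unfolding proper_on_bounded_def
proof (intro allI impI)
  fix x :: "nat \<Rightarrow> _" and y K
  assume K: "\<forall>n. norm (x n) \<le> K" and lim: "(\<lambda>n. T (x n)) \<longlonglongrightarrow> y"
  have "(\<lambda>n. S (T (x n))) \<longlonglongrightarrow> S y" by (rule bounded_clinear_tendsto[OF assms(2) lim])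
  then show "\<exists>r l. strict_mono r \<and> (x \<circ> r) \<longlonglongrightarrow> l"
    using assms(1) K unfolding proper_on_bounded_def by blast
qed

lemma proper_on_bounded_funpow:
  fixes T :: "'a::complex_normed_vector \<Rightarrow> 'a"
  assumes "proper_on_bounded T" "bounded_clinear T"
  shows "proper_on_bounded (T ^^ Suc n)"
proof (induction n)
  case 0
  show ?case using assms(1) by simp
next
  case (Suc n)
  show ?case
    using proper_on_bounded_compose[OF assms(1) Suc bounded_clinear_funpow[OF assms(2)]]
    by (simp add: o_def)
qed

lemma upper_semi_Fredholm_closed_range_funpow:
  fixes T :: "'a::complex_banach \<Rightarrow> 'a"
  assumes "bounded_clinear T" "upper_semi_Fredholm T"
  shows "closed (range (T ^^ n))"
proof (cases n)
  case (Suc m)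
  then show ?thesis
    using proper_on_bounded_funpow[OF upper_semi_Fredholm_imp_proper_on_bounded[OF assms] assms(1)]
      proper_on_bounded_imp_closed_range bounded_clinear_funpow[OF assms(1)] by blast
qed auto

text \<open>A subspace \<open>M\<close> that contains the kernel is the full preimage of its image, so a convergent
  sequence in the image lifts to a convergent sequence in \<open>M\<close>.\<close>

lemma closed_image_of_closed_superspace_of_kernel:
  fixes T :: "'a::complex_banach \<Rightarrow> 'a"
  assumes T: "bounded_clinear T" and cl: "closed (range T)"
    and M: "csubspace M" "closed M" "kernel T \<subseteq> M"
  shows "closed (T ` M)"
  unfolding closed_sequential_limits
proof (intro allI impI, elim conjE)
  fix f l assume f: "\<forall>n. f n \<in> T ` M" and lim: "f \<longlonglongrightarrow> l"
  have lin: "clinear T" using bounded_clinear_imp_clinear[OF T] .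
  obtain m where m: "\<And>n. m n \<in> M" "\<And>n. f n = T (m n)" using f unfolding image_iff by metis
  have "l \<in> range T" using csubspace_LIMSEQ[OF cl _ lim] m(2) by blast
  then obtain z where z: "l = T z" by auto
  have "f n \<in> range T" for n using m(2) by blast
  then obtain u where u: "\<And>n. T (u n) = f n - l" and u0: "u \<longlonglongrightarrow> 0"
    using null_sequence_lifting[OF T cl _ lim z] by metis
  have "z + u n \<in> M" for n
  proof -
    have "m n - (z + u n) \<in> M"
      using M(3) by (auto simp: kernel_def clinear_diff[OF lin]
        clinear_add[OF lin] u z m(2))
    then have "m n - (m n - (z + u n)) \<in> M" by (rule csubspace_diff[OF M(1) m(1)])
    then show ?thesis by (simp add: add.commute)
  qed
  moreover have "(\<lambda>n. z + u n) \<longlonglongrightarrow> z + 0" by (intro tendsto_intros u0)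
  ultimately have "z \<in> M" using csubspace_LIMSEQ[OF M(2), of "\<lambda>n. z + u n"] by simp
  then show "l \<in> T ` M" using z by blast
qed

section \<open>The SVEP and backward orbits\<close>

lemma bounded_clinear_op_shift:
  assumes "bounded_clinear T"
  shows "bounded_clinear (op_shift T \<mu>)"
proof -
  have "bounded_clinear (\<lambda>x::'a. x)" by (simp add: bounded_clinear_def bounded_linear_ident)
  then show ?thesis unfolding op_shift_def
    by (intro bounded_clinear_diff assms bounded_clinear_scaleC)
qed

lemma op_shift_op_shift: "op_shift (op_shift T \<mu>) \<nu> = op_shift T (\<mu> + \<nu>)"
  by (auto simp: op_shift_def scaleC_add_left)

text \<open>The radius \<open>1 / (2 C)\<close> makes the terms and their derivatives decay like \<open>n / 2^n\<close>, so that
  the Weierstrass test applies to the differentiated series.\<close>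

lemma power_series_vector_analytic:
  fixes x :: "nat \<Rightarrow> 'a::complex_banach"
  assumes C: "0 < C" and x: "\<And>n. norm (x n) \<le> K * C ^ n"
  obtains g where "vector_analytic_on g (ball \<mu> (1 / (2 * C)))"
    "\<And>z. z \<in> ball \<mu> (1 / (2 * C)) \<Longrightarrow> (\<lambda>n. (z - \<mu>) ^ n *\<^sub>C x n) sums g z"
proof -
  define S where "S = ball \<mu> (1 / (2 * C))"
  have K: "0 \<le> K" using x[of 0] norm_ge_zero[of "x 0"] by (metis mult.right_neutral order_trans power_0)
  have zS: "cmod (z - \<mu>) * C \<le> 1 / 2" if "z \<in> S" for z
    using that C by (simp add: S_def dist_norm norm_minus_commute field_simps)
  define D where "D n z = (of_nat n * (z - \<mu>) ^ (n - 1)) *\<^sub>C x n" for n z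
  have Dn: "norm (D n z) \<le> real n * (1 / 2) ^ (n - 1) * (K * C)" if "z \<in> S" for n z
  proof (cases n)
    case 0
    then show ?thesis by (simp add: D_def)
  next
    case (Suc m)
    have "norm (D n z) = real n * (cmod (z - \<mu>) ^ m * norm (x n))"
      by (simp add: D_def norm_scaleC norm_mult norm_power Suc del: of_nat_Suc)
    also have "\<dots> \<le> real n * (cmod (z - \<mu>) ^ m * (K * C ^ n))"
      by (intro mult_left_mono x) auto
    also have "\<dots> = real n * ((cmod (z - \<mu>) * C) ^ m * (K * C))"
      by (simp add: Suc power_mult_distrib algebra_simps)
    also have "\<dots> \<le> real n * ((1 / 2) ^ m * (K * C))"
      using zS[OF that] C K by (intro mult_left_mono mult_right_mono power_mono) auto
    finally show ?thesis by (simp add: Suc)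
  qed
  have "summable (\<lambda>n. real (Suc n) * (1 / 2) ^ n)"
    using geometric_deriv_sums[of "1 / 2 :: real"] by (simp add: sums_iff)
  then have "summable (\<lambda>n. real n * (1 / 2) ^ (n - 1))"
    by (subst summable_Suc_iff[symmetric]) simp
  then have sum: "summable (\<lambda>n. real n * (1 / 2) ^ (n - 1) * (K * C))" by (rule summable_mult2)
  have ul: "uniform_limit S (\<lambda>n z. \<Sum>i<n. D i z) (\<lambda>z. \<Sum>i. D i z) sequentially"
    by (rule Weierstrass_m_test[OF Dn sum])
  have "\<exists>g. \<forall>z\<in>S. (\<lambda>n. (z - \<mu>) ^ n *\<^sub>C x n) sums (g z) \<and>
      (g has_derivative (\<lambda>h. h *\<^sub>C (\<Sum>i. D i z))) (at z within S)"
  proof (rule has_derivative_series[where x = \<mu> and f' = "\<lambda>n z h. h *\<^sub>C D n z"])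
    show "convex S" "\<mu> \<in> S" using C by (simp_all add: S_def)
    show "(\<lambda>n. (\<mu> - \<mu>) ^ n *\<^sub>C x n) sums x 0"
      using sums_finite[of "{0}" "\<lambda>n. (\<mu> - \<mu>) ^ n *\<^sub>C x n"] by (simp add: scaleC_one)
    show "((\<lambda>z. (z - \<mu>) ^ n *\<^sub>C x n) has_derivative (\<lambda>h. h *\<^sub>C D n z)) (at z within S)"
      if "z \<in> S" for n z
    proof -
      have "((\<lambda>z. (z - \<mu>) ^ n) has_field_derivative of_nat n * (z - \<mu>) ^ (n - 1)) (at z within S)"
        by (auto intro!: derivative_eq_intros)
      then have "((\<lambda>z. (z - \<mu>) ^ n) has_derivative (\<lambda>h. of_nat n * (z - \<mu>) ^ (n - 1) * h)) (at z within S)"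
        by (simp add: has_field_derivative_def)
      from bounded_linear.has_derivative[OF bounded_linear_scaleC_left this, of "x n"]
      show ?thesis by (simp add: D_def scaleC_scaleC mult_ac)
    qed
    fix e :: real assume e: "0 < e"
    have sumC: "(\<Sum>i<n. h *\<^sub>C D i z) = h *\<^sub>C (\<Sum>i<n. D i z)" for n h z
      by (simp add: complex_vector.scale_sum_right)
    have "\<forall>\<^sub>F n in sequentially. \<forall>z\<in>S. dist (\<Sum>i<n. D i z) (\<Sum>i. D i z) < e"
      using ul e unfolding uniform_limit_iff by blast
    then show "\<forall>\<^sub>F n in sequentially. \<forall>z\<in>S. \<forall>h. norm ((\<Sum>i<n. h *\<^sub>C D i z) - h *\<^sub>C (\<Sum>i. D i z)) \<le> e * norm h"
    proof (eventually_elim, intro ballI allI)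
      fix n z h assume "\<forall>z\<in>S. dist (\<Sum>i<n. D i z) (\<Sum>i. D i z) < e" "z \<in> S"
      then have "norm ((\<Sum>i<n. D i z) - (\<Sum>i. D i z)) \<le> e" by (simp add: dist_norm less_imp_le)
      from mult_left_mono[OF this norm_ge_zero[of h]]
      show "norm ((\<Sum>i<n. h *\<^sub>C D i z) - h *\<^sub>C (\<Sum>i. D i z)) \<le> e * norm h"
        unfolding sumC complex_vector.scale_right_diff_distrib[symmetric] norm_scaleC by (simp add: mult.commute)
    qed
  qed
  then obtain g where g: "\<And>z. z \<in> S \<Longrightarrow> (\<lambda>n. (z - \<mu>) ^ n *\<^sub>C x n) sums (g z)"
      "\<And>z. z \<in> S \<Longrightarrow> (g has_derivative (\<lambda>h. h *\<^sub>C (\<Sum>i. D i z))) (at z within S)"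
    by metis
  have "vector_analytic_on g S"
    unfolding vector_analytic_on_def
  proof (intro ballI exI)
    fix z assume z: "z \<in> S"
    have "at z within S = at z" using z by (intro at_within_open) (auto simp: S_def)
    then show "(g has_derivative (\<lambda>h. h *\<^sub>C (\<Sum>i. D i z))) (at z)" using g(2)[OF z] by simp
  qed
  then show ?thesis using that g(1) unfolding S_def by blast
qed

text \<open>The generating series \<open>g(z)\<close> of the orbit satisfies \<open>S g(z) = (z - \<mu>) g(z)\<close> because \<open>S\<close>
  shifts the coefficients, that is, \<open>(T - z) g(z) = 0\<close>; its value at \<open>\<mu>\<close> is \<open>x 0\<close>.\<close>

lemma SVEP_at_backward_orbit_trivial:
  fixes T :: "'a::complex_banach \<Rightarrow> 'a"
  assumes T: "bounded_clinear T" and svep: "SVEP_at T \<mu>"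
    and x0: "op_shift T \<mu> (x 0) = 0" and xS: "\<And>n. op_shift T \<mu> (x (Suc n)) = x n"
    and C: "0 < C" and bound: "\<And>n. norm (x n) \<le> K * C ^ n"
  shows "x 0 = 0"
proof -
  define U where "U = ball \<mu> (1 / (2 * C))"
  obtain g where g: "vector_analytic_on g U" "\<And>z. z \<in> U \<Longrightarrow> (\<lambda>n. (z - \<mu>) ^ n *\<^sub>C x n) sums g z"
    unfolding U_def using power_series_vector_analytic[OF C bound] by metis
  define S where "S = op_shift T \<mu>"
  have S: "bounded_clinear S" unfolding S_def by (rule bounded_clinear_op_shift[OF T])
  have "op_shift T z (g z) = 0" if z: "z \<in> U" for z
  proof -
    define w where "w = z - \<mu>"
    have sg: "(\<lambda>n. w ^ n *\<^sub>C x n) sums g z" using g(2)[OF z] by (simp add: w_def)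
    have "(\<lambda>n. S (w ^ n *\<^sub>C x n)) sums S (g z)"
      by (rule bounded_linear.sums[OF bounded_clinear_imp_bounded_linear[OF S] sg])
    then have 1: "(\<lambda>n. w ^ n *\<^sub>C S (x n)) sums S (g z)"
      by (simp add: clinear_scale[OF bounded_clinear_imp_clinear[OF S]])
    have "(\<lambda>n. w *\<^sub>C (w ^ n *\<^sub>C x n)) sums (w *\<^sub>C g z)"
      by (rule bounded_linear.sums[OF bounded_linear_scaleC sg])
    then have "(\<lambda>n. w ^ Suc n *\<^sub>C S (x (Suc n))) sums (w *\<^sub>C g z)"
      by (simp add: xS[folded S_def] scaleC_scaleC)
    then have "(\<lambda>n. w ^ n *\<^sub>C S (x n)) sums (w *\<^sub>C g z + w ^ 0 *\<^sub>C S (x 0))"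
      by (rule sums_Suc)
    then have "(\<lambda>n. w ^ n *\<^sub>C S (x n)) sums (w *\<^sub>C g z)" using x0 by (simp add: S_def)
    then have "S (g z) = w *\<^sub>C g z" using 1 sums_unique2 by blast
    then show ?thesis by (simp add: S_def w_def op_shift_def complex_vector.scale_left_diff_distrib)
  qed
  moreover have \<mu>: "\<mu> \<in> U" "open U" "connected U" using C by (auto simp: U_def)
  ultimately have "g \<mu> = 0" using svep g(1) unfolding SVEP_at_def by blast
  moreover have "(\<lambda>n. (\<mu> - \<mu>) ^ n *\<^sub>C x n) sums x 0"
    using sums_finite[of "{0}" "\<lambda>n. (\<mu> - \<mu>) ^ n *\<^sub>C x n"] by (simp add: scaleC_one)
  ultimately show ?thesis using g(2)[OF \<mu>(1)] sums_unique2 by metis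
qed

lemma image_range_funpow:
  fixes f :: "'a \<Rightarrow> 'a"
  shows "f ` range (f ^^ n) = range (f ^^ Suc n)"
  by (auto simp: image_comp)

lemma range_funpow_antimono:
  fixes f :: "'a \<Rightarrow> 'a"
  assumes "m \<le> n"
  shows "range (f ^^ n) \<subseteq> range (f ^^ m)"
proof -
  have "f ^^ n = (f ^^ m) \<circ> (f ^^ (n - m))" using assms by (simp flip: funpow_add)
  then show ?thesis by auto
qed

text \<open>\<open>R(S\<^sup>n\<^sup>+\<^sup>1)\<close> is the image under \<open>S\<close> of \<open>R(S\<^sup>n) + N(S)\<close>. This space is closed because
  \<open>R(S\<^sup>n)\<close> is closed of finite codimension, and it contains the kernel.\<close>

lemma closed_range_funpow_finite_deficiency:
  fixes S :: "'a::complex_banach \<Rightarrow> 'a"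
  assumes S: "bounded_clinear S" and cl: "closed (range S)" and fin: "deficiency S < \<infinity>"
  shows "closed (range (S ^^ n))"
proof (induction n)
  case 0
  show ?case by simp
next
  case (Suc n)
  have lin: "clinear S" using bounded_clinear_imp_clinear[OF S] .
  define M where "M = range (S ^^ n)"
  define V where "V = cspan (M \<union> kernel S)"
  have M: "csubspace M" unfolding M_def by (rule csubspace_range[OF clinear_funpow[OF lin]])
  have sup: "M \<union> kernel S \<subseteq> V" unfolding V_def by (rule cspan_superset)
  have "closed V"
    using closed_superspace_of_finite_codimension[OF M Suc[folded M_def]
        finite_codimension_range_funpow[OF lin fin, of n, folded M_def], of V] sup by (simp add: V_def)
  then have "closed (S ` V)"
    using closed_image_of_closed_superspace_of_kernel[OF S cl, of V] sup by (simp add: V_def)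
  moreover have "S ` V = S ` M"
  proof
    show "S ` V \<subseteq> S ` M"
    proof
      fix y assume "y \<in> S ` V"
      then obtain v where v: "v \<in> V" "y = S v" by auto
      obtain m k where mk: "m \<in> M" "k \<in> cspan (kernel S)" "v = m + k"
        using v(1) unfolding V_def in_cspan_Un_iff[OF M] by blast
      have ker: "cspan (kernel S) = kernel S" using csubspace_kernel[OF lin] cspan_eq_iff by blast
      have "k \<in> kernel S" using mk(2) unfolding ker .
      then have "S k = 0" by (simp add: kernel_def)
      then have "y = S m" unfolding v(2) mk(3) clinear_add[OF lin] by simp
      then show "y \<in> S ` M" using mk(1) by simp
    qed
    show "S ` M \<subseteq> S ` V" using sup by blast
  qed
  ultimately show ?case unfolding M_def image_range_funpow by simp
qed

text \<open>If \<open>x = S\<^sup>n y\<close> and \<open>S x = 0\<close>, then \<open>y\<close> lies in \<open>N(S\<^sup>n\<^sup>+\<^sup>1)\<close>. Once the chain \<open>R(S) + N(S\<^sup>n)\<close>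
  is stationary, \<open>y = S u + v\<close> with \<open>S\<^sup>n v = 0\<close>, whence \<open>x = S\<^sup>n\<^sup>+\<^sup>1 u\<close>. So membership in one
  range improves to membership in the next.\<close>

lemma kernel_Int_range_stabilises:
  fixes S :: "'a::complex_normed_vector \<Rightarrow> 'a"
  assumes lin: "clinear S" and fin: "deficiency S < \<infinity>"
  obtains m where "\<And>n. kernel S \<inter> range (S ^^ m) \<subseteq> range (S ^^ n)"
proof -
  \<comment> \<open>The chain starts with a space that contains \<open>R(S)\<close>, so all codimensions are finite.\<close>
  define W where "W n = cspan (range S \<union> kernel (S ^^ n))" for n
  have R: "csubspace (range S)" by (rule csubspace_range[OF lin])
  have ker: "cspan (kernel (S ^^ n)) = kernel (S ^^ n)" for n
    using csubspace_kernel[OF clinear_funpow[OF lin]] cspan_eq_iff by blast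
  have S0: "S 0 = 0" by (rule clinear_0[OF lin])
  have "W n \<subseteq> W (Suc n)" for n
    unfolding W_def by (rule cspan_mono) (auto simp: kernel_def S0)
  moreover have "csubspace (W n)" for n by (simp add: W_def)
  moreover have "ccodimension (W 0) < \<infinity>"
  proof (rule le_less_trans)
    show "ccodimension (W 0) \<le> ccodimension (range S)"
      using cspan_superset[of "range S \<union> kernel (S ^^ 0)"]
      by (intro ccodimension_antimono R) (auto simp: W_def)
  qed (use fin in \<open>simp add: deficiency_def\<close>)
  ultimately obtain m where m: "\<And>n. n \<ge> m \<Longrightarrow> W n = W m"
    using finite_codimension_chain_stabilises[of W] by metis
  have step: "kernel S \<inter> range (S ^^ n) \<subseteq> range (S ^^ Suc n)" if n: "n \<ge> m" for n
  proof
    fix x assume x: "x \<in> kernel S \<inter> range (S ^^ n)"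
    then obtain y where y: "x = (S ^^ n) y" by auto
    have "y \<in> kernel (S ^^ Suc n)" using x y by (simp add: kernel_def)
    then have "y \<in> W (Suc n)" unfolding W_def by (intro cspan_base) simp
    then have "y \<in> W n" using m[of n] m[of "Suc n"] n by simp
    then obtain u v where uv: "y = S u + v" "v \<in> kernel (S ^^ n)"
      unfolding W_def in_cspan_Un_iff[OF R] ker by blast
    have "x = (S ^^ n) (S u)"
      using uv(2) unfolding y uv(1) clinear_add[OF clinear_funpow[OF lin]]
      by (simp add: kernel_def)
    then have "x = (S ^^ Suc n) u" by (simp add: funpow_swap1)
    then show "x \<in> range (S ^^ Suc n)" by blast
  qed
  have add: "kernel S \<inter> range (S ^^ m) \<subseteq> range (S ^^ (m + k))" for k
  proof (induction k)
    case (Suc k)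
    then have "kernel S \<inter> range (S ^^ m) \<subseteq> kernel S \<inter> range (S ^^ (m + k))" by blast
    also have "\<dots> \<subseteq> range (S ^^ Suc (m + k))" by (rule step) simp
    finally show ?case by simp
  qed simp
  have "kernel S \<inter> range (S ^^ m) \<subseteq> range (S ^^ n)" for n
    using add[of "n"] range_funpow_antimono[of n "m + n" S] by auto
  then show ?thesis by (rule that)
qed

text \<open>Let \<open>R\<close> be the intersection of all \<open>R(S\<^sup>n)\<close>. Two preimages in \<open>R(S\<^sup>m)\<close> of an element of \<open>R\<close>
  differ by an element of \<open>N(S) \<inter> R(S\<^sup>m)\<close>, which is contained in \<open>R\<close>; therefore any preimage in
  \<open>R(S\<^sup>m)\<close>, in particular one with norm control, already lies in \<open>R\<close>. Iterating yields the
  backward orbits.\<close>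

proposition SVEP_imp_kernel_meets_range_trivially:
  fixes T :: "'a::complex_banach \<Rightarrow> 'a"
  assumes T: "bounded_clinear T" and svep: "SVEP_at T \<mu>"
    and cl: "closed (range (op_shift T \<mu>))" and fin: "deficiency (op_shift T \<mu>) < \<infinity>"
  shows "\<exists>m. kernel (op_shift T \<mu>) \<inter> range (op_shift T \<mu> ^^ m) \<subseteq> {0}"
proof -
  define S where "S = op_shift T \<mu>"
  have S: "bounded_clinear S" unfolding S_def by (rule bounded_clinear_op_shift[OF T])
  have lin: "clinear S" using bounded_clinear_imp_clinear[OF S] .
  obtain m where m: "\<And>n. kernel S \<inter> range (S ^^ m) \<subseteq> range (S ^^ n)"
    using kernel_Int_range_stabilises[OF lin] fin unfolding S_def by metis
  define M where "M = range (S ^^ m)"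
  have M: "csubspace M" unfolding M_def by (rule csubspace_range[OF clinear_funpow[OF lin]])
  have clR: "closed (range (S ^^ n))" for n
    using closed_range_funpow_finite_deficiency[OF S] cl fin unfolding S_def by blast
  have "closed (S ` M)" unfolding M_def image_range_funpow by (rule clR)
  then obtain C where C: "0 < C" "\<And>y. y \<in> S ` M \<Longrightarrow> \<exists>x\<in>M. S x = y \<and> norm x \<le> C * norm y"
    using bounded_lifting[OF S M clR[of m, folded M_def]] by metis
  define R where "R = (\<Inter>n. range (S ^^ n))"
  have step: "\<exists>x. x \<in> R \<and> S x = y \<and> norm x \<le> C * norm y" if y: "y \<in> R" for y
  proof -
    have "y \<in> range (S ^^ Suc m)" using y unfolding R_def by blast
    then have "y \<in> S ` M" unfolding M_def image_range_funpow .
    then obtain x where x: "x \<in> M" "S x = y" "norm x \<le> C * norm y" using C(2) by blast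
    have "x \<in> range (S ^^ n)" for n
    proof -
      have "y \<in> range (S ^^ Suc (max m n))" using y unfolding R_def by blast
      then have "y \<in> S ` range (S ^^ max m n)" unfolding image_range_funpow .
      then obtain z where z: "z \<in> range (S ^^ max m n)" "y = S z" by blast
      have zm: "z \<in> M" and zn: "z \<in> range (S ^^ n)"
        using z(1) range_funpow_antimono[of m "max m n" S] range_funpow_antimono[of n "max m n" S]
        unfolding M_def by (blast intro: max.cobounded1 max.cobounded2)+
      have "x - z \<in> kernel S" using x(2) z(2) by (simp add: kernel_def clinear_diff[OF lin])
      moreover have "x - z \<in> M" by (rule csubspace_diff[OF M x(1) zm])
      ultimately have "x - z \<in> range (S ^^ n)" using m[of n] unfolding M_def by blast
      then have "x - z + z \<in> range (S ^^ n)"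
        using zn by (intro csubspace_add csubspace_range clinear_funpow lin)
      then show ?thesis by simp
    qed
    then have "x \<in> R" unfolding R_def by blast
    then show ?thesis using x by blast
  qed
  obtain h where h: "\<And>y. y \<in> R \<Longrightarrow> h y \<in> R \<and> S (h y) = y \<and> norm (h y) \<le> C * norm y"
    using step by metis
  have "z = 0" if z: "z \<in> kernel S \<inter> range (S ^^ m)" for z
  proof -
    define x where "x n = (h ^^ n) z" for n
    have zR: "z \<in> R" using z m unfolding R_def by blast
    have xR: "x n \<in> R" for n by (induction n) (simp_all add: x_def zR h)
    have "norm (x n) \<le> norm z * C ^ n" for n
    proof (induction n)
      case (Suc n)
      have "norm (x (Suc n)) \<le> C * norm (x n)" using h[OF xR[of n]] by (simp add: x_def)
      also have "\<dots> \<le> C * (norm z * C ^ n)" using Suc C(1) by (intro mult_left_mono) auto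
      finally show ?case by (simp add: mult_ac)
    qed (simp add: x_def)
    moreover have "S (x (Suc n)) = x n" for n using h[OF xR[of n]] by (simp add: x_def)
    moreover have "S (x 0) = 0" using z by (simp add: x_def kernel_def)
    ultimately have "x 0 = 0"
      using SVEP_at_backward_orbit_trivial[OF T svep, of x C "norm z"] C(1) unfolding S_def by blast
    then show ?thesis by (simp add: x_def)
  qed
  then show ?thesis unfolding S_def by blast
qed

section \<open>Operators bounded below near a given point\<close>

text \<open>\<open>T\<^sup>k - \<mu>\<^sup>k\<close> is divisible by \<open>T - \<mu>\<close>, and for \<open>\<bar>\<mu>\<bar> \<le> 1\<close> the cofactor is bounded independently
  of \<open>\<mu>\<close>.\<close>

lemma power_difference_bound:
  fixes T :: "'a::complex_normed_vector \<Rightarrow> 'a"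
  assumes T: "bounded_clinear T"
  obtains D where "0 \<le> D"
    "\<And>\<mu> x. cmod \<mu> \<le> 1 \<Longrightarrow> norm ((T ^^ k) x - \<mu> ^ k *\<^sub>C x) \<le> D * norm (op_shift T \<mu> x)"
proof -
  obtain K where K: "K > 0" "\<And>x. norm (T x) \<le> K * norm x" using bounded_clinear_bound[OF T] by metis
  have lin: "clinear T" using bounded_clinear_imp_clinear[OF T] .
  have "\<exists>D\<ge>0. \<forall>\<mu> x. cmod \<mu> \<le> 1 \<longrightarrow> norm ((T ^^ k) x - \<mu> ^ k *\<^sub>C x) \<le> D * norm (op_shift T \<mu> x)"
  proof (induction k)
    case 0
    show ?case by (intro exI[of _ 0]) (simp add: scaleC_one)
  next
    case (Suc k)
    then obtain D where D: "D \<ge> 0"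
      "\<And>\<mu> x. cmod \<mu> \<le> 1 \<Longrightarrow> norm ((T ^^ k) x - \<mu> ^ k *\<^sub>C x) \<le> D * norm (op_shift T \<mu> x)" by blast
    have "norm ((T ^^ Suc k) x - \<mu> ^ Suc k *\<^sub>C x) \<le> (K * D + 1) * norm (op_shift T \<mu> x)"
      if \<mu>: "cmod \<mu> \<le> 1" for \<mu> x
    proof -
      have "(T ^^ Suc k) x - \<mu> ^ Suc k *\<^sub>C x
          = T ((T ^^ k) x - \<mu> ^ k *\<^sub>C x) + \<mu> ^ k *\<^sub>C op_shift T \<mu> x"
        by (simp add: op_shift_def clinear_diff[OF lin] clinear_scale[OF lin]
            complex_vector.scale_right_diff_distrib scaleC_scaleC mult.commute)
      also have "norm \<dots> \<le> norm (T ((T ^^ k) x - \<mu> ^ k *\<^sub>C x)) + norm (\<mu> ^ k *\<^sub>C op_shift T \<mu> x)"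
        by (rule norm_triangle_ineq)
      also have "\<dots> \<le> K * (D * norm (op_shift T \<mu> x)) + 1 * norm (op_shift T \<mu> x)"
      proof (rule add_mono)
        show "norm (T ((T ^^ k) x - \<mu> ^ k *\<^sub>C x)) \<le> K * (D * norm (op_shift T \<mu> x))"
          using K(2)[of "(T ^^ k) x - \<mu> ^ k *\<^sub>C x"] mult_left_mono[OF D(2)[OF \<mu>, of x], of K] K(1) by linarith
        show "norm (\<mu> ^ k *\<^sub>C op_shift T \<mu> x) \<le> 1 * norm (op_shift T \<mu> x)"
          unfolding norm_scaleC norm_power using \<mu> by (intro mult_right_mono power_le_one) auto
      qed
      finally show ?thesis by (simp add: algebra_simps)
    qed
    then show ?case using D(1) K(1) by (intro exI[of _ "K * D + 1"]) simp
  qed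
  then show ?thesis using that by blast
qed

text \<open>Otherwise there are \<open>\<mu>\<^sub>n\<close> tending to \<open>0\<close> and unit vectors \<open>u\<^sub>n\<close> for which \<open>(T - \<mu>\<^sub>n) u\<^sub>n\<close> is
  small even compared with \<open>\<mu>\<^sub>n\<^sup>p\<close>. Then \<open>T u\<^sub>n\<close> tends to \<open>0\<close>, so a subsequence converges to a
  unit vector \<open>w\<close> of the kernel. But \<open>u\<^sub>n\<close> is also close to \<open>T\<^sup>p (\<mu>\<^sub>n\<^sup>-\<^sup>p u\<^sub>n)\<close>, so that \<open>w\<close>
  belongs to the closed range of \<open>T\<^sup>p\<close>.\<close>

proposition bounded_below_punctured_neighbourhood:
  fixes T :: "'a::complex_banach \<Rightarrow> 'a"
  assumes T: "bounded_clinear T" and sF: "upper_semi_Fredholm T"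
    and triv: "kernel T \<inter> range (T ^^ p) \<subseteq> {0}"
  obtains e where "0 < e"
    "\<And>\<mu>. \<mu> \<noteq> 0 \<Longrightarrow> cmod \<mu> < e \<Longrightarrow> \<exists>c>0. \<forall>x. c * norm x \<le> norm (op_shift T \<mu> x)"
proof (rule ccontr)
  assume neg: "\<not> thesis"
  note dense = that
  have lin: "clinear T" using bounded_clinear_imp_clinear[OF T] .
  have linp: "clinear (T ^^ p)" by (rule clinear_funpow[OF lin])
  have "\<exists>\<mu> u. \<mu> \<noteq> 0 \<and> cmod \<mu> < inverse (real (Suc n)) \<and> norm u = 1 \<and>
      norm (op_shift T \<mu> u) \<le> cmod \<mu> ^ p * inverse (real (Suc n))" for n
  proof -
    obtain \<mu> where \<mu>: "\<mu> \<noteq> 0" "cmod \<mu> < inverse (real (Suc n))"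
      "\<not> (\<exists>c>0. \<forall>x. c * norm x \<le> norm (op_shift T \<mu> x))"
      using neg dense[of "inverse (real (Suc n))"] by (metis inverse_positive_iff_positive of_nat_0_less_iff zero_less_Suc)
    \<comment> \<open>The factor \<open>\<bar>\<mu>\<bar>\<^sup>p\<close> survives the later division by \<open>\<mu>\<^sup>p\<close>.\<close>
    define c where "c = cmod \<mu> ^ p * inverse (real (Suc n))"
    have "c > 0" using \<mu>(1) by (simp add: c_def)
    then obtain x where x: "norm (op_shift T \<mu> x) < c * norm x" using \<mu>(3) by (meson not_le)
    then have x0: "norm x > 0" using \<open>c > 0\<close> norm_ge_zero[of "op_shift T \<mu> x"]
      by (metis mult_zero_right norm_ge_zero order_le_less not_less)
    define u where "u = complex_of_real (inverse (norm x)) *\<^sub>C x"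
    have "norm u = 1" using x0 unfolding u_def norm_scaleC by (simp add: norm_inverse)
    have "op_shift T \<mu> u = complex_of_real (inverse (norm x)) *\<^sub>C op_shift T \<mu> x"
      unfolding u_def by (rule clinear_scale[OF bounded_clinear_imp_clinear[OF bounded_clinear_op_shift[OF T]]])
    then have "norm (op_shift T \<mu> u) = inverse (norm x) * norm (op_shift T \<mu> x)"
      using x0 by (simp only: norm_scaleC) (simp add: norm_inverse)
    also have "\<dots> \<le> inverse (norm x) * (c * norm x)" using x by (intro mult_left_mono) auto
    also have "\<dots> = c" using x0 by simp
    finally have "norm (op_shift T \<mu> u) \<le> c" .
    with \<open>norm u = 1\<close> show ?thesis using \<mu>(1,2) unfolding c_def by blast
  qed
  then obtain \<mu> u where \<mu>: "\<And>n. \<mu> n \<noteq> 0" "\<And>n. cmod (\<mu> n) < inverse (real (Suc n))"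
    and u: "\<And>n. norm (u n) = 1" "\<And>n. norm (op_shift T (\<mu> n) (u n)) \<le> cmod (\<mu> n) ^ p * inverse (real (Suc n))"
    by metis
  have \<mu>1: "cmod (\<mu> n) \<le> 1" for n
    using \<mu>(2)[of n] inverse_le_1_iff[of "real (Suc n)"] by simp
  have Tu: "(\<lambda>n. T (u n)) \<longlonglongrightarrow> 0"
  proof (rule Lim_null_comparison)
    have "norm (T (u n)) \<le> 2 * inverse (real (Suc n))" for n
    proof -
      have "T (u n) = op_shift T (\<mu> n) (u n) + \<mu> n *\<^sub>C u n" by (simp add: op_shift_def)
      then have "norm (T (u n)) \<le> norm (op_shift T (\<mu> n) (u n)) + cmod (\<mu> n)"
        using norm_triangle_ineq[of "op_shift T (\<mu> n) (u n)" "\<mu> n *\<^sub>C u n"] u(1)[of n] by (simp add: norm_scaleC)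
      moreover have "cmod (\<mu> n) ^ p * inverse (real (Suc n)) \<le> 1 * inverse (real (Suc n))"
        using \<mu>1[of n] by (intro mult_right_mono power_le_one) auto
      ultimately show ?thesis using u(2)[of n] \<mu>(2)[of n] by linarith
    qed
    then show "\<forall>\<^sub>F n in sequentially. norm (T (u n)) \<le> 2 * inverse (real (Suc n))" by simp
    show "(\<lambda>n. 2 * inverse (real (Suc n))) \<longlonglongrightarrow> 0"
      by (rule tendsto_mult_right_zero[OF LIMSEQ_inverse_real_of_nat])
  qed
  obtain r w where r: "strict_mono r" "(u \<circ> r) \<longlonglongrightarrow> w"
    using proper_on_boundedD[OF upper_semi_Fredholm_imp_proper_on_bounded[OF T sF] _ Tu, of 1] u(1) by (metis order_refl)
  have "(\<lambda>n. norm ((u \<circ> r) n)) \<longlonglongrightarrow> norm w" by (rule tendsto_norm[OF r(2)])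
  then have nw: "norm w = 1" using u(1) by (simp add: LIMSEQ_const_iff)
  have "(\<lambda>n. T ((u \<circ> r) n)) \<longlonglongrightarrow> T w" by (rule bounded_clinear_tendsto[OF T r(2)])
  moreover have "(\<lambda>n. T ((u \<circ> r) n)) \<longlonglongrightarrow> 0" using LIMSEQ_subseq_LIMSEQ[OF Tu r(1)] by (simp add: o_def)
  ultimately have "T w = 0" by (rule LIMSEQ_unique)
  obtain D where D: "0 \<le> D"
    "\<And>\<mu> x. cmod \<mu> \<le> 1 \<Longrightarrow> norm ((T ^^ p) x - \<mu> ^ p *\<^sub>C x) \<le> D * norm (op_shift T \<mu> x)"
    using power_difference_bound[OF T] by metis
  define v where "v n = (T ^^ p) (inverse (\<mu> n ^ p) *\<^sub>C u n)" for n
  have vu: "norm (v n - u n) \<le> D * inverse (real (Suc n))" for n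
  proof -
    have p: "cmod (\<mu> n) ^ p > 0" using \<mu>(1) by simp
    have "u n = inverse (\<mu> n ^ p) *\<^sub>C (\<mu> n ^ p *\<^sub>C u n)" using \<mu>(1)[of n] by (simp add: scaleC_scaleC scaleC_one)
    then have "v n - u n = inverse (\<mu> n ^ p) *\<^sub>C ((T ^^ p) (u n) - \<mu> n ^ p *\<^sub>C u n)"
      unfolding v_def clinear_scale[OF linp] complex_vector.scale_right_diff_distrib by simp
    then have "norm (v n - u n) = inverse (cmod (\<mu> n) ^ p) * norm ((T ^^ p) (u n) - \<mu> n ^ p *\<^sub>C u n)"
      by (simp only: norm_scaleC norm_inverse norm_power)
    also have "\<dots> \<le> inverse (cmod (\<mu> n) ^ p) * (D * (cmod (\<mu> n) ^ p * inverse (real (Suc n))))"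
      using p D(1) by (intro mult_left_mono order_trans[OF D(2)[OF \<mu>1]] u(2)) auto
    also have "\<dots> = D * inverse (real (Suc n))" using \<mu>(1)[of n] by (simp add: field_simps)
    finally show ?thesis .
  qed
  have "(\<lambda>n. v n - u n) \<longlonglongrightarrow> 0"
  proof (rule Lim_null_comparison)
    show "\<forall>\<^sub>F n in sequentially. norm (v n - u n) \<le> D * inverse (real (Suc n))" using vu by simp
    show "(\<lambda>n. D * inverse (real (Suc n))) \<longlonglongrightarrow> 0"
      by (rule tendsto_mult_right_zero[OF LIMSEQ_inverse_real_of_nat])
  qed
  from LIMSEQ_subseq_LIMSEQ[OF this r(1)] have "(\<lambda>n. (u \<circ> r) n + (v (r n) - u (r n))) \<longlonglongrightarrow> w + 0"
    by (intro tendsto_add r(2)) (simp add: o_def)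
  then have lim: "(\<lambda>n. v (r n)) \<longlonglongrightarrow> w" by (simp add: o_def)
  have "w \<in> range (T ^^ p)"
    by (rule csubspace_LIMSEQ[OF upper_semi_Fredholm_closed_range_funpow[OF T sF] _ lim]) (simp add: v_def)
  then have "w = 0" using triv \<open>T w = 0\<close> by (auto simp: kernel_def)
  then show False using nw by simp
qed

section \<open>Duality of nullity and deficiency\<close>

lemma enat_leI:
  fixes a b :: enat
  assumes "\<And>n. enat n \<le> a \<Longrightarrow> enat n \<le> b"
  shows "a \<le> b"
proof (rule ccontr)
  assume "\<not> a \<le> b"
  then obtain m where "b = enat m" "enat (Suc m) \<le> a" by (cases b) (auto simp: Suc_ile_eq not_le)
  then show False using assms[of "Suc m"] by simp
qed

lemma cdual_eqI: "(\<And>x. cdual_apply \<phi> x = cdual_apply \<psi> x) \<Longrightarrow> \<phi> = \<psi>"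
  using cdual_apply_inject by blast

lemma clinear_cdual_evaluation: "clinear (\<lambda>\<phi>. cdual_apply \<phi> x)"
  by (simp add: clinear_iff plus_cdual.rep_eq scaleC_cdual.rep_eq)

lemma norm_cdual_apply_le: "cmod (cdual_apply \<phi> x) \<le> norm \<phi> * norm x"
  unfolding norm_cdual.rep_eq
  by (rule onorm) (rule bounded_clinear_imp_bounded_linear[OF bounded_clinear_cdual_apply])

lemma norm_cdual_le:
  assumes "0 \<le> b" "\<And>x. cmod (cdual_apply \<phi> x) \<le> b * norm x"
  shows "norm \<phi> \<le> b"
  unfolding norm_cdual.rep_eq using assms by (rule onorm_bound)

lemma bounded_clinear_cdual_evaluation: "bounded_clinear (\<lambda>\<phi>. cdual_apply \<phi> x)"
  by (rule bounded_clinear_intro[OF clinear_cdual_evaluation, where K = "norm x"])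
    (use norm_cdual_apply_le in \<open>simp add: mult.commute\<close>)

lemma bounded_clinear_dual_op:
  assumes T: "bounded_clinear T"
  shows "bounded_clinear (dual_op T)"
proof -
  obtain K where K: "K > 0" "\<And>x. norm (T x) \<le> K * norm x" using bounded_clinear_bound[OF T] by metis
  have "clinear (dual_op T)"
    unfolding clinear_iff
    by (auto intro!: cdual_eqI simp: cdual_apply_dual_op[OF T] plus_cdual.rep_eq scaleC_cdual.rep_eq)
  moreover have "norm (dual_op T \<phi>) \<le> K * norm \<phi>" for \<phi>
  proof (rule norm_cdual_le)
    show "cmod (cdual_apply (dual_op T \<phi>) x) \<le> K * norm \<phi> * norm x" for x
      using norm_cdual_apply_le[of \<phi> "T x"] mult_left_mono[OF K(2)[of x] norm_ge_zero[of \<phi>]]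
      by (simp add: cdual_apply_dual_op[OF T] mult_ac)
  qed (use K in simp)
  ultimately show ?thesis by (rule bounded_clinear_intro)
qed

lemma dual_op_shift:
  assumes T: "bounded_clinear T"
  shows "dual_op (op_shift T \<mu>) = op_shift (dual_op T) \<mu>"
proof (intro ext cdual_eqI)
  fix \<phi> x
  have "cdual_apply \<phi> (T x - \<mu> *\<^sub>C x) = cdual_apply \<phi> (T x) - \<mu> *\<^sub>C cdual_apply \<phi> x"
    by (simp add: clinear_diff[OF clinear_cdual_apply]
        clinear_scale[OF clinear_cdual_apply])
  then show "cdual_apply (dual_op (op_shift T \<mu>) \<phi>) x = cdual_apply (op_shift (dual_op T) \<mu> \<phi>) x"
    unfolding cdual_apply_dual_op[OF bounded_clinear_op_shift[OF T]]
    by (simp add: op_shift_def minus_cdual.rep_eq scaleC_cdual.rep_eq cdual_apply_dual_op[OF T])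
qed

lemma cdual_apply_dual_op_funpow:
  assumes T: "bounded_clinear T"
  shows "cdual_apply ((dual_op T ^^ n) \<phi>) x = cdual_apply \<phi> ((T ^^ n) x)"
  by (induction n arbitrary: \<phi>) (simp_all add: cdual_apply_dual_op[OF T] funpow_swap1)

lemma kernel_dual_op_iff:
  assumes "bounded_clinear T"
  shows "\<phi> \<in> kernel (dual_op T) \<longleftrightarrow> (\<forall>y\<in>range T. cdual_apply \<phi> y = 0)"
proof
  assume "\<phi> \<in> kernel (dual_op T)"
  then have "cdual_apply (dual_op T \<phi>) x = 0" for x by (simp add: kernel_def zero_cdual.rep_eq)
  then show "\<forall>y\<in>range T. cdual_apply \<phi> y = 0" by (simp add: cdual_apply_dual_op[OF assms])
next
  assume "\<forall>y\<in>range T. cdual_apply \<phi> y = 0"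
  then have "dual_op T \<phi> = 0"
    by (intro cdual_eqI) (simp add: cdual_apply_dual_op[OF assms] zero_cdual.rep_eq)
  then show "\<phi> \<in> kernel (dual_op T)" by (simp add: kernel_def)
qed

definition annihilator :: "'a::complex_normed_vector set \<Rightarrow> 'a cdual set" where
  "annihilator V = {\<phi>. \<forall>x\<in>V. cdual_apply \<phi> x = 0}"

lemma csubspace_annihilator: "csubspace (annihilator V)"
  by (rule complex_vector.subspaceI)
    (simp_all add: annihilator_def zero_cdual.rep_eq plus_cdual.rep_eq scaleC_cdual.rep_eq)

lemma closed_annihilator: "closed (annihilator V)"
  unfolding closed_sequential_limits
proof (intro allI impI, elim conjE)
  fix f \<phi> assume f: "\<forall>n. f n \<in> annihilator V" and lim: "f \<longlonglongrightarrow> \<phi>"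
  have "cdual_apply \<phi> x = 0" if "x \<in> V" for x
  proof -
    have "(\<lambda>n. cdual_apply (f n) x) \<longlonglongrightarrow> cdual_apply \<phi> x"
      by (rule bounded_clinear_tendsto[OF bounded_clinear_cdual_evaluation lim])
    moreover have "(\<lambda>n. cdual_apply (f n) x) = (\<lambda>n. 0)" using f that by (auto simp: annihilator_def)
    ultimately show ?thesis by (simp add: LIMSEQ_const_iff)
  qed
  then show "\<phi> \<in> annihilator V" by (simp add: annihilator_def)
qed

lemma annihilator_cspan: "annihilator (cspan B) = annihilator B"
proof
  show "annihilator (cspan B) \<subseteq> annihilator B"
    using cspan_superset[of B] by (auto simp: annihilator_def)
  show "annihilator B \<subseteq> annihilator (cspan B)"
  proof
    fix \<phi> assume "\<phi> \<in> annihilator B"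
    then have "cspan B \<subseteq> {x. cdual_apply \<phi> x = 0}"
      by (intro cspan_minimal complex_vector_pair.linear_subspace_kernel clinear_cdual_apply)
        (auto simp: annihilator_def)
    then show "\<phi> \<in> annihilator (cspan B)" by (auto simp: annihilator_def)
  qed
qed

text \<open>Each further point of \<open>B\<close> imposes one linear condition, and one functional that violates it
  spans the difference.\<close>

lemma ccodimension_annihilator_finite:
  fixes B :: "'a::complex_normed_vector set"
  assumes "finite B"
  shows "ccodimension (annihilator B) \<le> enat (card B)"
proof -
  have "\<exists>\<Psi>. finite \<Psi> \<and> card \<Psi> \<le> card B \<and> cspan (annihilator B \<union> \<Psi>) = UNIV"
    using assms
  proof (induction B rule: finite_induct)
    case empty
    have "annihilator {} = (UNIV :: 'a cdual set)" by (simp add: annihilator_def)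
    then show ?case by (intro exI[of _ "{}"]) simp
  next
    case (insert b B)
    then obtain \<Psi> where \<Psi>: "finite \<Psi>" "card \<Psi> \<le> card B" "cspan (annihilator B \<union> \<Psi>) = UNIV" by blast
    have ins: "annihilator (insert b B) = {\<phi> \<in> annihilator B. cdual_apply \<phi> b = 0}"
      by (auto simp: annihilator_def)
    show ?case
    proof (cases "\<forall>\<phi>\<in>annihilator B. cdual_apply \<phi> b = 0")
      case True
      then have "annihilator (insert b B) = annihilator B" using ins by auto
      then show ?thesis using \<Psi> insert.hyps by (intro exI[of _ \<Psi>]) simp
    next
      case False
      then obtain \<psi> where \<psi>: "\<psi> \<in> annihilator B" "cdual_apply \<psi> b \<noteq> 0" by blast
      define A where "A = annihilator (insert b B) \<union> insert \<psi> {}"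
      have "annihilator B \<subseteq> cspan A"
      proof
        fix \<phi> assume \<phi>: "\<phi> \<in> annihilator B"
        define c where "c = cdual_apply \<phi> b / cdual_apply \<psi> b"
        have "\<phi> - c *\<^sub>C \<psi> \<in> annihilator B"
          by (intro csubspace_diff csubspace_scale csubspace_annihilator \<phi> \<psi>)
        then have "\<phi> - c *\<^sub>C \<psi> \<in> annihilator (insert b B)"
          using \<psi>(2) by (simp add: ins minus_cdual.rep_eq scaleC_cdual.rep_eq scaleC_complex_def c_def)
        then have "\<phi> - c *\<^sub>C \<psi> \<in> cspan A" "\<psi> \<in> cspan A"
          by (auto simp: A_def intro: cspan_base)
        then have "(\<phi> - c *\<^sub>C \<psi>) + c *\<^sub>C \<psi> \<in> cspan A"
          by (intro complex_vector.span_add complex_vector.span_scale)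
        then show "\<phi> \<in> cspan A" by simp
      qed
      from cspan_Un_eq_UNIV[OF \<Psi>(3) this] have "cspan (annihilator (insert b B) \<union> insert \<psi> \<Psi>) = UNIV"
        by (simp add: A_def)
      moreover have "card (insert \<psi> \<Psi>) \<le> card (insert b B)"
        using \<Psi>(1,2) insert.hyps card_insert_le_m1[of "Suc (card \<Psi>)" \<Psi> \<psi>] by (simp add: card_insert_if)
      ultimately show ?thesis using \<Psi>(1) by (intro exI[of _ "insert \<psi> \<Psi>"]) simp
    qed
  qed
  then obtain \<Psi> where \<Psi>: "finite \<Psi>" "card \<Psi> \<le> card B" "cspan (annihilator B \<union> \<Psi>) = UNIV" by blast
  have "ccodimension (annihilator B) \<le> enat (card \<Psi>)"
    by (rule ccodimension_le_card[OF csubspace_annihilator \<Psi>(1,3)])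
  also have "\<dots> \<le> enat (card B)" using \<Psi>(2) by simp
  finally show ?thesis .
qed

text \<open>For each \<open>b\<close> in \<open>B\<close>, the vectors of \<open>V\<close> and the other vectors of \<open>B\<close> span a closed subspace
  that does not contain \<open>b\<close>; a functional separating \<open>b\<close> from it takes the value \<open>1\<close> at \<open>b\<close> and
  vanishes at the rest. The last conclusion says that a combination of these functionals is
  determined by its values on \<open>B\<close>.\<close>

lemma biorthogonal_functionals:
  fixes B :: "'a::complex_normed_vector set"
  assumes V: "csubspace V" "closed V" and B: "finite B" "cindependent B" "cspan B \<inter> V \<subseteq> {0}"
  obtains \<Phi> where "finite \<Phi>" "card \<Phi> = card B" "cindependent \<Phi>" "\<Phi> \<subseteq> annihilator V"
    "cspan \<Phi> \<inter> annihilator B \<subseteq> {0}"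
proof -
  have "\<exists>\<phi>. \<phi> \<in> annihilator V \<and> cdual_apply \<phi> b = 1 \<and> (\<forall>b'\<in>B - {b}. cdual_apply \<phi> b' = 0)" if b: "b \<in> B" for b
  proof -
    define W where "W = cspan (V \<union> (B - {b}))"
    have "closed W" unfolding W_def using closed_cspan_Un_finite[OF V] B(1) by simp
    moreover have "csubspace W" by (simp add: W_def)
    moreover have "b \<notin> W"
    proof
      assume "b \<in> W"
      then obtain v u where vu: "v \<in> V" "u \<in> cspan (B - {b})" "b = v + u"
        unfolding W_def in_cspan_Un_iff[OF V(1)] by blast
      have u: "u \<in> cspan B" using vu(2) cspan_mono[of "B - {b}" B] by blast
      have "b - u \<in> cspan B" by (rule complex_vector.span_diff[OF cspan_base[OF b] u])
      then have "v = 0" using vu(1,3) B(3) by auto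
      then have "b \<in> cspan (B - {b})" using vu by simp
      then show False using B(2) b unfolding complex_vector.dependent_def by blast
    qed
    ultimately obtain \<phi> where \<phi>: "\<And>x. x \<in> W \<Longrightarrow> cdual_apply \<phi> x = 0" "cdual_apply \<phi> b = 1"
      using cdual_separates_closed_subspace by metis
    have "V \<union> (B - {b}) \<subseteq> W" unfolding W_def by (rule cspan_superset)
    then show ?thesis using \<phi> by (intro exI[of _ \<phi>]) (auto simp: annihilator_def)
  qed
  then obtain p where p: "\<And>b. b \<in> B \<Longrightarrow> p b \<in> annihilator V" "\<And>b. b \<in> B \<Longrightarrow> cdual_apply (p b) b = 1"
    "\<And>b b'. b \<in> B \<Longrightarrow> b' \<in> B - {b} \<Longrightarrow> cdual_apply (p b) b' = 0"
    by metis
  have inj: "inj_on p B"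
  proof (rule inj_onI, rule ccontr)
    fix b b' assume *: "b \<in> B" "b' \<in> B" "p b = p b'" "b \<noteq> b'"
    then have "cdual_apply (p b) b' = 0" using p(3)[of b b'] by simp
    then show False using p(2)[of b'] * by simp
  qed
  have ev: "cdual_apply \<phi> b = 0" if b: "b \<in> B" and \<phi>: "\<phi> \<in> cspan (p ` B - {p b})" for b \<phi>
  proof (rule complex_vector_pair.linear_eq_0_on_span[OF clinear_cdual_evaluation _ \<phi>])
    fix \<psi> assume "\<psi> \<in> p ` B - {p b}"
    then show "cdual_apply \<psi> b = 0" using p(3) b by auto
  qed
  have "cindependent (p ` B)"
    unfolding complex_vector.dependent_def
  proof
    assume "\<exists>a\<in>p ` B. a \<in> cspan (p ` B - {a})"
    then obtain b where "b \<in> B" "p b \<in> cspan (p ` B - {p b})" by blast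
    then show False using ev[of b "p b"] p(2)[of b] by simp
  qed
  moreover have "cspan (p ` B) \<inter> annihilator B \<subseteq> {0}"
  proof
    fix \<phi> assume \<phi>: "\<phi> \<in> cspan (p ` B) \<inter> annihilator B"
    then obtain u where u: "\<phi> = (\<Sum>\<psi>\<in>p ` B. u \<psi> *\<^sub>C \<psi>)"
      using complex_vector.span_finite[of "p ` B"] B(1) by auto
    then have u': "\<phi> = (\<Sum>b\<in>B. u (p b) *\<^sub>C p b)" by (simp add: sum.reindex[OF inj])
    have "u (p b) = 0" if b: "b \<in> B" for b
    proof -
      have "0 = cdual_apply \<phi> b" using \<phi> b by (simp add: annihilator_def)
      also have "\<dots> = (\<Sum>b'\<in>B. u (p b') * cdual_apply (p b') b)"
        unfolding u' complex_vector_pair.linear_sum[OF clinear_cdual_evaluation]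
        by (simp add: scaleC_cdual.rep_eq scaleC_complex_def)
      also have "\<dots> = (\<Sum>b'\<in>B. if b' = b then u (p b) else 0)"
        using p(2,3) b by (intro sum.cong) auto
      also have "\<dots> = u (p b)" using b B(1) by simp
      finally show ?thesis by simp
    qed
    then show "\<phi> \<in> {0}" unfolding u' by simp
  qed
  moreover have "p ` B \<subseteq> annihilator V" using p(1) by blast
  ultimately show ?thesis using that[of "p ` B"] B(1) card_image[OF inj] by simp
qed

text \<open>Vectors independent modulo the closed range have biorthogonal functionals that annihilate
  the range, and these are elements of the kernel of the dual operator.\<close>

lemma deficiency_le_nullity_dual_op:
  assumes T: "bounded_clinear T" and cl: "closed (range T)"
  shows "deficiency T \<le> nullity (dual_op T)"
proof -
  have R: "csubspace (range T)" by (rule csubspace_range[OF bounded_clinear_imp_clinear[OF T]])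
  have "enat n \<le> nullity (dual_op T)" if n: "enat n \<le> deficiency T" for n
  proof -
    obtain B where B: "finite B" "cindependent B" "cspan B \<inter> range T \<subseteq> {0}" "card B = n"
      using ccodimension_ge_obtain[OF R] n unfolding deficiency_def by metis
    obtain \<Phi> where \<Phi>: "finite \<Phi>" "card \<Phi> = card B" "cindependent \<Phi>" "\<Phi> \<subseteq> annihilator (range T)"
      using biorthogonal_functionals[OF R cl B(1-3)] by metis
    have "\<Phi> \<subseteq> kernel (dual_op T)" using \<Phi>(4) kernel_dual_op_iff[OF T] by (auto simp: annihilator_def)
    then show ?thesis using card_le_cdimension[OF _ \<Phi>(3,1)] \<Phi>(2) B(4) by (metis nullity_def)
  qed
  then show ?thesis by (rule enat_leI)
qed

text \<open>A functional that annihilates the range is determined by its values on a basis modulo the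
  range.\<close>

lemma nullity_dual_op_le_deficiency:
  assumes T: "bounded_clinear T"
  shows "nullity (dual_op T) \<le> deficiency T"
proof (cases "deficiency T < \<infinity>")
  case True
  have R: "csubspace (range T)" by (rule csubspace_range[OF bounded_clinear_imp_clinear[OF T]])
  obtain B where B: "finite B" "cspan (range T \<union> B) = UNIV" "enat (card B) = deficiency T"
    using ccodimension_basis[OF R] True unfolding deficiency_def by metis
  have "enat n \<le> deficiency T" if n: "enat n \<le> nullity (dual_op T)" for n
  proof -
    have K: "csubspace (kernel (dual_op T))"
      by (rule csubspace_kernel[OF bounded_clinear_imp_clinear[OF bounded_clinear_dual_op[OF T]]])
    obtain \<Phi> where \<Phi>: "finite \<Phi>" "cindependent \<Phi>" "\<Phi> \<subseteq> kernel (dual_op T)" "card \<Phi> = n"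
      using cdimension_ge_obtain[OF K] n unfolding nullity_def by metis
    have sub: "cspan \<Phi> \<subseteq> kernel (dual_op T)" by (rule cspan_minimal[OF \<Phi>(3) K])
    have "\<phi> = 0" if \<phi>: "\<phi> \<in> cspan \<Phi> \<inter> annihilator B" for \<phi>
    proof -
      have "\<phi> \<in> annihilator (range T \<union> B)"
        using \<phi> sub kernel_dual_op_iff[OF T, of \<phi>] by (auto simp: annihilator_def)
      then have "\<phi> \<in> annihilator UNIV" using annihilator_cspan[of "range T \<union> B"] B(2) by simp
      then show "\<phi> = 0" by (intro cdual_eqI) (simp add: annihilator_def zero_cdual.rep_eq)
    qed
    then have "cspan \<Phi> \<inter> annihilator B \<subseteq> {0}" by blast
    then have "enat (card \<Phi>) \<le> ccodimension (annihilator B)"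
      by (rule card_le_ccodimension[OF csubspace_annihilator \<Phi>(1,2)])
    also have "\<dots> \<le> enat (card B)" by (rule ccodimension_annihilator_finite[OF B(1)])
    finally show ?thesis using \<Phi>(4) B(3) by simp
  qed
  then show ?thesis by (rule enat_leI)
qed auto

text \<open>A functional that annihilates the kernel induces one on the range, bounded by the lifting
  constant; a Hahn--Banach extension of it is a preimage under the dual operator.\<close>

lemma range_dual_op_eq_annihilator:
  fixes T :: "'a::complex_banach \<Rightarrow> 'a"
  assumes T: "bounded_clinear T" and cl: "closed (range T)"
  shows "range (dual_op T) = annihilator (kernel T)"
proof
  show "range (dual_op T) \<subseteq> annihilator (kernel T)"
    using clinear_0[OF clinear_cdual_apply]
    by (auto simp: annihilator_def kernel_def cdual_apply_dual_op[OF T])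
  show "annihilator (kernel T) \<subseteq> range (dual_op T)"
  proof
    fix \<phi> assume \<phi>: "\<phi> \<in> annihilator (kernel T)"
    have lin: "clinear T" using bounded_clinear_imp_clinear[OF T] .
    obtain C where C: "0 < C" "\<And>y. y \<in> range T \<Longrightarrow> \<exists>x\<in>UNIV. T x = y \<and> norm x \<le> C * norm y"
      using bounded_lifting[OF T csubspace_UNIV closed_UNIV cl] by metis
    define f where "f y = cdual_apply \<phi> (SOME x. T x = y)" for y
    have f: "f (T x) = cdual_apply \<phi> x" for x
    proof -
      have "T (SOME z. T z = T x) = T x" by (rule someI) (rule refl)
      then have "(SOME z. T z = T x) - x \<in> kernel T"
        by (simp add: kernel_def clinear_diff[OF lin])
      then have "cdual_apply \<phi> ((SOME z. T z = T x) - x) = 0" using \<phi> unfolding annihilator_def by blast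
      then show ?thesis unfolding f_def clinear_diff[OF clinear_cdual_apply] by simp
    qed
    have f1: "f (x + y) = f x + f y" if xy: "x \<in> range T" "y \<in> range T" for x y
    proof -
      obtain u v where "x = T u" "y = T v" using xy by blast
      then show ?thesis using f clinear_add[OF clinear_cdual_apply]
        by (metis clinear_add[OF lin])
    qed
    have f2: "f (c *\<^sub>C x) = c * f x" if "x \<in> range T" for c x
    proof -
      obtain u where "x = T u" using \<open>x \<in> range T\<close> by blast
      then have "f (c *\<^sub>C x) = f (T (c *\<^sub>C u))" by (simp add: clinear_scale[OF lin])
      then show ?thesis using \<open>x = T u\<close>
        by (simp add: f clinear_scale[OF clinear_cdual_apply] scaleC_complex_def)
    qed
    have f3: "cmod (f y) \<le> (norm \<phi> * C) * norm y" if y: "y \<in> range T" for y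
    proof -
      obtain x where x: "T x = y" "norm x \<le> C * norm y" using C(2)[OF y] by blast
      have "cmod (f y) \<le> norm \<phi> * norm x" using f[of x] x(1) norm_cdual_apply_le[of \<phi> x] by simp
      also have "\<dots> \<le> norm \<phi> * (C * norm y)" using x(2) by (intro mult_left_mono) auto
      finally show ?thesis by (simp add: mult_ac)
    qed
    obtain \<psi> where \<psi>: "\<And>y. y \<in> range T \<Longrightarrow> cdual_apply \<psi> y = f y"
      using cdual_extension[where f = f, OF csubspace_range[OF lin] f1 f2 f3] C(1) by (metis less_imp_le mult_nonneg_nonneg norm_ge_zero)
    have "dual_op T \<psi> = \<phi>" by (rule cdual_eqI) (simp add: cdual_apply_dual_op[OF T] \<psi> f)
    then show "\<phi> \<in> range (dual_op T)" by blast
  qed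
qed

lemma closed_range_dual_op:
  fixes T :: "'a::complex_banach \<Rightarrow> 'a"
  assumes "bounded_clinear T" "closed (range T)"
  shows "closed (range (dual_op T))"
  unfolding range_dual_op_eq_annihilator[OF assms] by (rule closed_annihilator)

lemma deficiency_dual_op_le_nullity:
  fixes T :: "'a::complex_banach \<Rightarrow> 'a"
  assumes T: "bounded_clinear T" and cl: "closed (range T)"
  shows "deficiency (dual_op T) \<le> nullity T"
proof (cases "nullity T < \<infinity>")
  case True
  obtain B where B: "finite B" "cspan B = kernel T" "enat (card B) = nullity T"
    using cdimension_basis[OF csubspace_kernel[OF bounded_clinear_imp_clinear[OF T]]] True
    unfolding nullity_def by metis
  have "range (dual_op T) = annihilator B"
    unfolding range_dual_op_eq_annihilator[OF T cl] B(2)[symmetric] by (rule annihilator_cspan)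
  then show ?thesis
    unfolding deficiency_def B(3)[symmetric] using ccodimension_annihilator_finite[OF B(1)] by simp
qed auto

text \<open>Functionals biorthogonal to a family in the kernel are independent modulo the range of the
  dual operator, whose elements vanish on the kernel.\<close>

lemma nullity_le_deficiency_dual_op:
  assumes T: "bounded_clinear T"
  shows "nullity T \<le> deficiency (dual_op T)"
proof -
  have K: "csubspace (kernel T)" by (rule csubspace_kernel[OF bounded_clinear_imp_clinear[OF T]])
  have R: "csubspace (range (dual_op T))"
    by (rule csubspace_range[OF bounded_clinear_imp_clinear[OF bounded_clinear_dual_op[OF T]]])
  have "enat n \<le> deficiency (dual_op T)" if n: "enat n \<le> nullity T" for n
  proof -
    obtain B where B: "finite B" "cindependent B" "B \<subseteq> kernel T" "card B = n"
      using cdimension_ge_obtain[OF K] n unfolding nullity_def by metis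
    obtain \<Phi> where \<Phi>: "finite \<Phi>" "card \<Phi> = card B" "cindependent \<Phi>" "cspan \<Phi> \<inter> annihilator B \<subseteq> {0}"
      using biorthogonal_functionals[OF complex_vector.subspace_single_0 closed_singleton B(1,2)]
      by (metis inf_le2)
    have "T b = 0" if "b \<in> B" for b using B(3) that by (auto simp: kernel_def)
    then have "range (dual_op T) \<subseteq> annihilator B"
      using clinear_0[OF clinear_cdual_apply]
      by (auto simp: annihilator_def cdual_apply_dual_op[OF T])
    then have "cspan \<Phi> \<inter> range (dual_op T) \<subseteq> {0}" using \<Phi>(4) by blast
    then show ?thesis
      unfolding deficiency_def using card_le_ccodimension[OF R \<Phi>(1,3)] \<Phi>(2) B(4) by simp
  qed
  then show ?thesis by (rule enat_leI)
qed

section \<open>The closed range theorem\<close>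

text \<open>A separation of \<open>z\<close> from the image of the ball of radius \<open>a\<close>. The infimum over \<open>x\<close> of
  \<open>\<parallel>x\<parallel> / a + \<parallel>y - T x\<parallel> / e\<close> is a seminorm in \<open>y\<close>. It is at most \<open>\<parallel>x\<parallel> / a\<close> at \<open>T x\<close>, which bounds
  the dual operator, and at least \<open>1\<close> at \<open>z\<close>, because no \<open>x\<close> makes both summands small.\<close>

lemma functional_separating_from_image_ball:
  fixes T :: "'a::complex_normed_vector \<Rightarrow> 'a"
  assumes T: "bounded_clinear T" and a: "0 < a" and e: "0 < e"
    and far: "\<And>x. norm x \<le> a \<Longrightarrow> e \<le> norm (z - T x)"
  obtains \<psi> where "1 \<le> cmod (cdual_apply \<psi> z)" "norm (dual_op T \<psi>) \<le> 1 / a"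
proof -
  have lin: "clinear T" using bounded_clinear_imp_clinear[OF T] .
  define g where "g y x = norm x / a + norm (y - T x) / e" for y x
  define q where "q y = (INF x. g y x)" for y
  have g0: "0 \<le> g y x" for y x using a e by (simp add: g_def)
  have lower: "q y \<le> g y x" for y x
    unfolding q_def using g0 by (intro cINF_lower bdd_belowI[of _ 0]) auto
  have q_nonneg: "0 \<le> q y" for y unfolding q_def by (rule cINF_greatest) (simp_all add: g0)
  have g_add: "g (y + y') (x + x') \<le> g y x + g y' x'" for y y' x x'
  proof -
    have "norm (y + y' - T (x + x')) = norm ((y - T x) + (y' - T x'))"
      by (simp add: clinear_add[OF lin] algebra_simps)
    then have "norm (y + y' - T (x + x')) / e \<le> (norm (y - T x) + norm (y' - T x')) / e"
      using e norm_triangle_ineq[of "y - T x" "y' - T x'"] by (intro divide_right_mono) auto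
    moreover have "norm (x + x') / a \<le> (norm x + norm x') / a"
      using a by (intro divide_right_mono norm_triangle_ineq) auto
    ultimately show ?thesis by (simp add: g_def add_divide_distrib)
  qed
  have g_scale: "g (c *\<^sub>C y) (c *\<^sub>C x) = cmod c * g y x" for c y x
  proof -
    have "norm (c *\<^sub>C y - T (c *\<^sub>C x)) = cmod c * norm (y - T x)"
      unfolding clinear_scale[OF lin] complex_vector.scale_right_diff_distrib[symmetric]
      by (rule norm_scaleC)
    then show ?thesis by (simp add: g_def norm_scaleC distrib_left)
  qed
  note q_seminorm = infimum_seminorm[where g = g, OF csubspace_UNIV g0 g_add g_scale, folded q_def]
  have q_T: "q (T x) \<le> norm x / a" for x using lower[of "T x" x] by (simp add: g_def)
  have q_le: "q y \<le> norm y / e" for y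
    using lower[of y 0] clinear_0[OF lin] by (simp add: g_def)
  have qz: "1 \<le> q z"
    unfolding q_def[of z]
  proof (rule cINF_greatest)
    fix x
    show "1 \<le> g z x"
    proof (cases "norm x \<le> a")
      case True
      then have "1 \<le> norm (z - T x) / e" using far e by simp
      then show ?thesis using a by (simp add: g_def add_increasing)
    next
      case False
      then have "1 \<le> norm x / a" using a by simp
      then show ?thesis using e by (simp add: g_def add_increasing2)
    qed
  qed simp
  obtain F where F: "clinear F" "\<And>x. cmod (F x) \<le> q x" "F z = complex_of_real (q z)"
    using seminorm_attaining_functional[where q = q and z = z, OF q_seminorm q_nonneg] by metis
  have "cmod (F x) \<le> (1 / e) * norm x" for x using F(2)[of x] q_le[of x] by simp
  then have "bounded_clinear F" by (rule bounded_clinear_intro[OF F(1)])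
  then have ap: "cdual_apply (Cdual F) = F" by (simp add: Cdual_inverse)
  have "norm (dual_op T (Cdual F)) \<le> 1 / a"
  proof (rule norm_cdual_le)
    show "cmod (cdual_apply (dual_op T (Cdual F)) x) \<le> 1 / a * norm x" for x
      using F(2)[of "T x"] q_T[of x] by (simp add: cdual_apply_dual_op[OF T] ap)
  qed (use a in simp)
  moreover have "1 \<le> cmod (cdual_apply (Cdual F) z)" using qz by (simp add: ap F(3))
  ultimately show ?thesis using that by blast
qed

text \<open>It suffices that every \<open>z\<close> in the closure of the range is approximated by images of vectors
  of norm at most \<open>2 C \<parallel>z\<parallel>\<close>. If not, a functional \<open>\<psi>\<close> separates \<open>z\<close> from these images and \<open>T\<^sup>* \<psi>\<close>
  is small. Lifting replaces \<open>\<psi>\<close> by a small functional with the same image under \<open>T\<^sup>*\<close>, hence with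
  the same values on the closure of the range, and its value at \<open>z\<close> is too small.\<close>

proposition closed_range_of_closed_range_dual_op:
  fixes T :: "'a::complex_banach \<Rightarrow> 'a"
  assumes T: "bounded_clinear T" and cl: "closed (range (dual_op T))"
  shows "closed (range T)"
proof -
  have lin: "clinear T" using bounded_clinear_imp_clinear[OF T] .
  obtain C where C: "0 < C"
    "\<And>\<phi>. \<phi> \<in> range (dual_op T) \<Longrightarrow> \<exists>\<psi>\<in>UNIV. dual_op T \<psi> = \<phi> \<and> norm \<psi> \<le> C * norm \<phi>"
    using bounded_lifting[OF bounded_clinear_dual_op[OF T] csubspace_UNIV closed_UNIV cl] by metis
  define Z where "Z = closure (range T)"
  have approx: "\<exists>x\<in>UNIV. norm x \<le> 2 * C * norm z \<and> norm (z - T x) < e" if z: "z \<in> Z" and e: "0 < e" for z e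
  proof (cases "z = 0")
    case True
    then show ?thesis using e clinear_0[OF lin] by (intro bexI[of _ 0]) auto
  next
    case False
    show ?thesis
    proof (rule ccontr)
      assume "\<not> ?thesis"
      then have far: "e \<le> norm (z - T x)" if "norm x \<le> 2 * C * norm z" for x using that by (meson UNIV_I not_le)
      \<comment> \<open>The factor \<open>2\<close> makes the final estimate \<open>1 / 2\<close> rather than \<open>1\<close>, hence contradictory.\<close>
      have a: "0 < 2 * C * norm z" using C False by simp
      obtain \<psi> where \<psi>: "1 \<le> cmod (cdual_apply \<psi> z)" "norm (dual_op T \<psi>) \<le> 1 / (2 * C * norm z)"
        using functional_separating_from_image_ball[OF T a e far] by metis
      obtain \<psi>' where \<psi>': "dual_op T \<psi>' = dual_op T \<psi>" "norm \<psi>' \<le> C * norm (dual_op T \<psi>)"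
        using C(2)[of "dual_op T \<psi>"] by blast
      have "cdual_apply \<psi> z = cdual_apply \<psi>' z"
      proof -
        obtain f where f: "\<And>n. f n \<in> range T" "f \<longlonglongrightarrow> z" using z unfolding Z_def closure_sequential by blast
        have eq: "cdual_apply \<psi> (f n) = cdual_apply \<psi>' (f n)" for n
        proof -
          obtain x where "f n = T x" using f(1) by blast
          then show ?thesis using arg_cong[OF \<psi>'(1), of "\<lambda>\<phi>. cdual_apply \<phi> x"] by (simp add: cdual_apply_dual_op[OF T])
        qed
        have lim: "(\<lambda>n. cdual_apply \<phi> (f n)) \<longlonglongrightarrow> cdual_apply \<phi> z" for \<phi>
          by (rule bounded_clinear_tendsto[OF bounded_clinear_cdual_apply f(2)])
        show ?thesis by (rule LIMSEQ_unique[OF lim[of \<psi>]]) (use lim[of \<psi>'] in \<open>simp add: eq\<close>)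
      qed
      then have "1 \<le> norm \<psi>' * norm z" using \<psi>(1) norm_cdual_apply_le[of \<psi>' z] by simp
      also have "\<dots> \<le> C * (1 / (2 * C * norm z)) * norm z"
        using \<psi>'(2) mult_left_mono[OF \<psi>(2), of C] C(1) by (intro mult_right_mono) auto
      also have "\<dots> = 1 / 2" using C(1) False by simp
      finally show False by simp
    qed
  qed
  have sZ: "csubspace Z"
  proof -
    have R: "csubspace (range T)" by (rule csubspace_range[OF lin])
    have Z: "y \<in> Z \<longleftrightarrow> infdist y (range T) = 0" for y
      unfolding Z_def by (rule in_closure_iff_infdist_zero) simp
    have "x + y \<in> Z" if "x \<in> Z" "y \<in> Z" for x y
      using infdist_subspace_add[OF R, of x y] infdist_nonneg[of "x + y" "range T"] that by (simp add: Z)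
    then show ?thesis
      using csubspace_0[OF R] by (intro complex_vector.subspaceI) (simp_all add: Z infdist_subspace_scale[OF R])
  qed
  have "Z \<subseteq> range T"
  proof
    fix y assume y: "y \<in> Z"
    have "0 \<le> 2 * C" using C(1) by simp
    from lifting_of_approximate_lifting[OF T csubspace_UNIV closed_UNIV sZ
        closure_subset[of "range T", folded Z_def] this approx y]
    obtain x where "T x = y" by blast
    then show "y \<in> range T" by blast
  qed
  then have "range T = Z" using closure_subset[of "range T"] unfolding Z_def by (rule antisym[rotated])
  moreover have "closed Z" unfolding Z_def by (rule closed_closure)
  ultimately show ?thesis by simp
qed

section \<open>Spectra and left poles\<close>

lemma upper_semi_Weyl_iff:
  "upper_semi_Weyl T \<longleftrightarrow> closed (range T) \<and> nullity T < \<infinity> \<and> nullity T \<le> deficiency T"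
proof -
  have "fredholm_index T \<le> 0 \<longleftrightarrow> nullity T \<le> deficiency T" if "nullity T < \<infinity>"
    using that unfolding fredholm_index_def by (cases "nullity T"; cases "deficiency T") auto
  then show ?thesis by (auto simp: upper_semi_Weyl_def upper_semi_Fredholm_def)
qed

lemma lower_semi_Weyl_iff:
  "lower_semi_Weyl T \<longleftrightarrow> closed (range T) \<and> deficiency T < \<infinity> \<and> deficiency T \<le> nullity T"
proof -
  have "0 \<le> fredholm_index T \<longleftrightarrow> deficiency T \<le> nullity T" if "deficiency T < \<infinity>"
    using that unfolding fredholm_index_def by (cases "nullity T"; cases "deficiency T") auto
  then show ?thesis by (auto simp: lower_semi_Weyl_def lower_semi_Fredholm_def)
qed

lemma nullity_eq_0_iff:
  assumes "clinear T"
  shows "nullity T = 0 \<longleftrightarrow> kernel T = {0}"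
proof
  assume "nullity T = 0"
  then obtain B where B: "finite B" "cspan B = kernel T" "enat (card B) = 0"
    using cdimension_basis[OF csubspace_kernel[OF assms]] unfolding nullity_def by (metis zero_less_iff_neq_zero i0_ne_infinity)
  then have "B = {}" by (simp add: enat_0_iff)
  then show "kernel T = {0}" using B(2) by simp
next
  assume "kernel T = {0}"
  then show "nullity T = 0" using cdimension_le_card[of "{}" "kernel T"] unfolding nullity_def by (simp add: enat_0)
qed

lemma surj_of_deficiency_0:
  assumes "clinear T" "deficiency T = 0"
  shows "range T = UNIV"
proof -
  have R: "csubspace (range T)" by (rule csubspace_range[OF assms(1)])
  obtain B where B: "finite B" "cspan (range T \<union> B) = UNIV" "enat (card B) = 0"
    using ccodimension_basis[OF R] assms(2) unfolding deficiency_def by (metis zero_less_iff_neq_zero i0_ne_infinity)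
  then have "B = {}" by (simp add: enat_0_iff)
  then show ?thesis using B(2) R cspan_eq_iff by (metis Un_empty_right)
qed

lemma not_in_op_spectrumI:
  fixes T :: "'a::complex_banach \<Rightarrow> 'a"
  assumes T: "bounded_clinear T" and ker: "kernel (op_shift T \<mu>) = {0}" and ran: "range (op_shift T \<mu>) = UNIV"
  shows "\<mu> \<notin> op_spectrum T"
proof -
  define S where "S = op_shift T \<mu>"
  have S: "bounded_clinear S" unfolding S_def by (rule bounded_clinear_op_shift[OF T])
  have lin: "clinear S" using bounded_clinear_imp_clinear[OF S] .
  have inj: "inj S"
    unfolding complex_vector_pair.linear_inj_iff_eq_0[OF lin] using ker by (auto simp: S_def kernel_def)
  have surj: "S (inv S y) = y" for y using ran by (simp add: S_def surj_f_inv_f)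
  have inv: "inv S (S x) = x" for x using inj by simp
  obtain C where C: "0 < C" "\<And>y. y \<in> range S \<Longrightarrow> \<exists>x\<in>UNIV. S x = y \<and> norm x \<le> C * norm y"
    using bounded_lifting[OF S csubspace_UNIV closed_UNIV] ran unfolding S_def by (metis closed_UNIV)
  have "clinear (inv S)"
    unfolding clinear_iff
  proof (intro conjI allI)
    show "inv S (x + y) = inv S x + inv S y" for x y
      using inv[of "inv S x + inv S y"] by (simp add: clinear_add[OF lin] surj)
    show "inv S (c *\<^sub>C x) = c *\<^sub>C inv S x" for c x
      using inv[of "c *\<^sub>C inv S x"] by (simp add: clinear_scale[OF lin] surj)
  qed
  moreover have "norm (inv S y) \<le> C * norm y" for y
  proof -
    obtain x where "S x = y" "norm x \<le> C * norm y" using C(2)[of y] ran unfolding S_def by blast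
    then show ?thesis using inv by auto
  qed
  ultimately have "bounded_clinear (inv S)" by (rule bounded_clinear_intro)
  moreover have "inv S \<circ> S = id" "S \<circ> inv S = id" using surj inv by auto
  ultimately show ?thesis unfolding op_spectrum_def S_def by blast
qed

lemma not_in_op_spectrumD:
  assumes "\<mu> \<notin> op_spectrum T"
  shows "kernel (op_shift T \<mu>) \<subseteq> {0}" "range (op_shift T \<mu>) = UNIV"
proof -
  obtain S where S: "bounded_clinear S" "S \<circ> op_shift T \<mu> = id" "op_shift T \<mu> \<circ> S = id"
    using assms unfolding op_spectrum_def by blast
  have "S (op_shift T \<mu> x) = x" "op_shift T \<mu> (S x) = x" for x
    using S(2,3) by (metis comp_apply id_apply)+
  moreover have "S 0 = 0" by (rule clinear_0[OF bounded_clinear_imp_clinear[OF S(1)]])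
  ultimately show "kernel (op_shift T \<mu>) \<subseteq> {0}" "range (op_shift T \<mu>) = UNIV"
    unfolding kernel_def by (metis (mono_tags, lifting) mem_Collect_eq singletonI subsetI, metis surjI)
qed

lemma approx_point_spectrum_subset_op_spectrum: "approx_point_spectrum T \<subseteq> op_spectrum T"
proof
  fix \<mu> assume "\<mu> \<in> approx_point_spectrum T"
  then obtain x where x: "\<And>n. norm (x n) = 1" "(\<lambda>n. op_shift T \<mu> (x n)) \<longlonglongrightarrow> 0"
    unfolding approx_point_spectrum_def by blast
  show "\<mu> \<in> op_spectrum T"
  proof (rule ccontr)
    assume "\<mu> \<notin> op_spectrum T"
    then obtain S where S: "bounded_clinear S" "S \<circ> op_shift T \<mu> = id"
      unfolding op_spectrum_def by blast
    have "S (op_shift T \<mu> y) = y" for y using S(2) by (metis comp_apply id_apply)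
    then have "x \<longlonglongrightarrow> S 0" using bounded_clinear_tendsto[OF S(1) x(2)] by simp
    moreover have "S 0 = 0" by (rule clinear_0[OF bounded_clinear_imp_clinear[OF S(1)]])
    ultimately have "(\<lambda>n. norm (x n)) \<longlonglongrightarrow> 0" by (simp add: tendsto_norm_zero)
    then show False using x(1) by (simp add: LIMSEQ_const_iff)
  qed
qed

lemma bounded_below_imp_upper_semi_Weyl:
  fixes S :: "'a::complex_banach \<Rightarrow> 'a"
  assumes S: "bounded_clinear S" and c: "0 < c" "\<And>x. c * norm x \<le> norm (S x)"
  shows "upper_semi_Weyl S"
proof -
  have lin: "clinear S" using bounded_clinear_imp_clinear[OF S] .
  have "x = 0" if "S x = 0" for x using c(2)[of x] c(1) that by (simp add: mult_le_0_iff)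
  then have "kernel S = {0}" using clinear_0[OF lin] by (auto simp: kernel_def)
  then have "nullity S = 0" using nullity_eq_0_iff[OF lin] by blast
  moreover have "proper_on_bounded S"
    unfolding proper_on_bounded_def
  proof (intro allI impI)
    fix x :: "nat \<Rightarrow> 'a" and y K assume "(\<lambda>n. S (x n)) \<longlonglongrightarrow> y"
    then have Cau: "Cauchy (\<lambda>n. S (x n))" by (rule LIMSEQ_imp_Cauchy)
    have "Cauchy x"
    proof (rule metric_CauchyI)
      fix e :: real assume "0 < e"
      then obtain M where M: "\<And>m n. m \<ge> M \<Longrightarrow> n \<ge> M \<Longrightarrow> dist (S (x m)) (S (x n)) < c * e"
        using Cau c(1) unfolding Cauchy_def by (metis mult_pos_pos)
      have "dist (x m) (x n) < e" if "m \<ge> M" "n \<ge> M" for m n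
      proof -
        have "c * dist (x m) (x n) \<le> dist (S (x m)) (S (x n))"
          unfolding dist_norm clinear_diff[OF lin, symmetric] by (rule c(2))
        also have "\<dots> < c * e" by (rule M[OF that])
        finally show ?thesis using c(1) by simp
      qed
      then show "\<exists>M. \<forall>m\<ge>M. \<forall>n\<ge>M. dist (x m) (x n) < e" by blast
    qed
    then obtain l where "x \<longlonglongrightarrow> l" using Cauchy_convergent_iff convergent_def by metis
    then have "strict_mono id \<and> (x \<circ> id) \<longlonglongrightarrow> l" by (simp add: strict_mono_id)
    then show "\<exists>r l. strict_mono (r :: nat \<Rightarrow> nat) \<and> (x \<circ> r) \<longlonglongrightarrow> l" by blast
  qed
  then have "closed (range S)" by (rule proper_on_bounded_imp_closed_range[OF S])
  ultimately show ?thesis by (simp add: upper_semi_Weyl_iff)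
qed

lemma bounded_below_not_in_approx_point_spectrum:
  assumes c: "0 < c" "\<And>x. c * norm x \<le> norm (op_shift T \<mu> x)"
  shows "\<mu> \<notin> approx_point_spectrum T"
proof
  assume "\<mu> \<in> approx_point_spectrum T"
  then obtain x where x: "\<And>n. norm (x n) = 1" "(\<lambda>n. op_shift T \<mu> (x n)) \<longlonglongrightarrow> 0"
    unfolding approx_point_spectrum_def by blast
  have "(\<lambda>n. norm (op_shift T \<mu> (x n))) \<longlonglongrightarrow> 0" using x(2) by (rule tendsto_norm_zero)
  then have "c \<le> 0" by (rule LIMSEQ_le_const) (use c(2)[of "x _"] x(1) in auto)
  then show False using c(1) by simp
qed

lemma eigenvalue_in_approx_point_spectrum:
  assumes T: "bounded_clinear T" and x: "op_shift T \<mu> x = 0" "x \<noteq> 0"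
  shows "\<mu> \<in> approx_point_spectrum T"
proof -
  define u where "u = complex_of_real (inverse (norm x)) *\<^sub>C x"
  have "norm u = 1" using x(2) unfolding u_def norm_scaleC by (simp add: norm_inverse)
  moreover have "op_shift T \<mu> u = 0"
    unfolding u_def clinear_scale[OF bounded_clinear_imp_clinear[OF bounded_clinear_op_shift[OF T]]] x(1) by simp
  ultimately show ?thesis unfolding approx_point_spectrum_def by (intro CollectI exI[of _ "\<lambda>n. u"]) simp
qed

lemma ascent_cases:
  fixes S :: "'a::complex_normed_vector \<Rightarrow> 'a"
  shows "ascent S = \<infinity> \<and> (\<forall>n. kernel (S ^^ n) \<noteq> kernel (S ^^ Suc n))
    \<or> (\<exists>p. ascent S = enat p \<and> kernel (S ^^ p) = kernel (S ^^ Suc p))"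
proof -
  define A where "A = enat ` {n. kernel (S ^^ n) = kernel (S ^^ (n + 1))}"
  have asc: "ascent S = Inf A" by (simp add: ascent_def A_def)
  show ?thesis
  proof (cases "A = {}")
    case False
    then have "Inf A \<in> A" unfolding Inf_enat_def by (auto intro: LeastI)
    then show ?thesis unfolding asc by (auto simp: A_def)
  qed (auto simp: asc A_def Inf_enat_def)
qed

lemma kernel_Int_range_ascent:
  fixes S :: "'a::complex_normed_vector \<Rightarrow> 'a"
  assumes "ascent S = enat p"
  shows "kernel S \<inter> range (S ^^ p) \<subseteq> {0}"
proof -
  have p: "kernel (S ^^ p) = kernel (S ^^ Suc p)" using ascent_cases[of S] assms by auto
  show ?thesis
  proof
    fix x assume "x \<in> kernel S \<inter> range (S ^^ p)"
    then obtain y where y: "x = (S ^^ p) y" "S x = 0" by (auto simp: kernel_def)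
    then have "y \<in> kernel (S ^^ Suc p)" by (simp add: kernel_def)
    then have "y \<in> kernel (S ^^ p)" using p by simp
    then show "x \<in> {0}" using y(1) by (simp add: kernel_def)
  qed
qed

text \<open>The power \<open>S\<^sup>p\<^sup>+\<^sup>1\<close> has closed range and finite nullity, so it is proper on bounded sets,
  and \<open>S\<close> is a right factor of it. Finite ascent makes kernel and \<open>R(S\<^sup>p)\<close> meet trivially, which
  bounds the nullity by the deficiency.\<close>

proposition left_pole_of_finite_rank_semi_Weyl:
  fixes T :: "'a::complex_banach \<Rightarrow> 'a"
  assumes T: "bounded_clinear T" and pole: "\<mu> \<in> finite_rank_left_poles T"
  shows "upper_semi_Weyl (op_shift T \<mu>)"
    and "\<exists>p. kernel (op_shift T \<mu>) \<inter> range (op_shift T \<mu> ^^ p) \<subseteq> {0}"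
proof -
  define S where "S = op_shift T \<mu>"
  have S: "bounded_clinear S" unfolding S_def by (rule bounded_clinear_op_shift[OF T])
  have lin: "clinear S" using bounded_clinear_imp_clinear[OF S] .
  obtain p where p: "ascent S = enat p" "closed (range (S ^^ (p + 1)))" and fin: "nullity S < \<infinity>"
    using pole unfolding finite_rank_left_poles_def left_pole_def S_def by blast
  have triv: "kernel S \<inter> range (S ^^ p) \<subseteq> {0}" by (rule kernel_Int_range_ascent[OF p(1)])
  then show "\<exists>p. kernel (op_shift T \<mu>) \<inter> range (op_shift T \<mu> ^^ p) \<subseteq> {0}" unfolding S_def by blast
  have "upper_semi_Fredholm (S ^^ Suc p)"
    using p(2) nullity_funpow_finite[OF lin fin, of "Suc p"] by (simp add: upper_semi_Fredholm_def)
  then have "proper_on_bounded (S ^^ Suc p)"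
    by (rule upper_semi_Fredholm_imp_proper_on_bounded[OF bounded_clinear_funpow[OF S]])
  then have "proper_on_bounded (\<lambda>x. (S ^^ p) (S x))" by (simp add: o_def funpow_swap1)
  then have "proper_on_bounded S" by (rule proper_on_bounded_of_compose[OF _ bounded_clinear_funpow[OF S]])
  then have cl: "closed (range S)" by (rule proper_on_bounded_imp_closed_range[OF S])
  have "nullity S \<le> deficiency S"
  proof (cases "deficiency S < \<infinity>")
    case True
    have "S ` range (S ^^ p) \<subseteq> range (S ^^ p)"
      unfolding image_range_funpow by (rule range_funpow_antimono) simp
    then show ?thesis
      by (rule nullity_le_deficiency_of_trivial_meet(1)[OF lin csubspace_range[OF clinear_funpow[OF lin]] _
          finite_codimension_range_funpow[OF lin True] triv])
  qed auto
  then show "upper_semi_Weyl (op_shift T \<mu>)" using cl fin by (simp add: upper_semi_Weyl_iff S_def)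
qed

lemma finite_rank_left_poles_subset:
  fixes T :: "'a::complex_banach \<Rightarrow> 'a"
  assumes T: "bounded_clinear T"
  shows "finite_rank_left_poles T \<subseteq> op_spectrum T - uw_spectrum T"
  using left_pole_of_finite_rank_semi_Weyl(1)[OF T] approx_point_spectrum_subset_op_spectrum[of T]
  by (auto simp: uw_spectrum_def finite_rank_left_poles_def left_pole_def)

text \<open>A nonzero kernel element places \<open>\<mu>\<close> in the approximate point spectrum; the powers of an
  upper semi-Fredholm operator have closed range.\<close>

lemma finite_rank_left_poleI:
  fixes T :: "'a::complex_banach \<Rightarrow> 'a"
  assumes T: "bounded_clinear T" and W: "upper_semi_Weyl (op_shift T \<mu>)"
    and ker: "kernel (op_shift T \<mu> ^^ m) = kernel (op_shift T \<mu> ^^ Suc m)"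
    and ne: "kernel (op_shift T \<mu>) \<noteq> {0}"
  shows "\<mu> \<in> finite_rank_left_poles T"
proof -
  have S: "bounded_clinear (op_shift T \<mu>)" by (rule bounded_clinear_op_shift[OF T])
  have sF: "upper_semi_Fredholm (op_shift T \<mu>)" using W by (simp add: upper_semi_Weyl_def)
  have "0 \<in> kernel (op_shift T \<mu>)"
    using csubspace_0[OF csubspace_kernel[OF bounded_clinear_imp_clinear[OF S]]] .
  then obtain x where "op_shift T \<mu> x = 0" "x \<noteq> 0" using ne by (auto simp: kernel_def)
  then have "\<mu> \<in> approx_point_spectrum T" by (rule eigenvalue_in_approx_point_spectrum[OF T])
  moreover obtain p where "ascent (op_shift T \<mu>) = enat p" using ascent_cases[of "op_shift T \<mu>"] ker by blast
  moreover have "closed (range (op_shift T \<mu> ^^ (p + 1)))"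
    by (rule upper_semi_Fredholm_closed_range_funpow[OF S sF])
  moreover have "nullity (op_shift T \<mu>) < \<infinity>" using sF by (simp add: upper_semi_Fredholm_def)
  ultimately show ?thesis unfolding finite_rank_left_poles_def left_pole_def by blast
qed

section \<open>The SVEP and property (az)\<close>

text \<open>Both implications from the SVEP to property \<open>(az)\<close> are instances: \<open>S\<close> and \<open>S'\<close> are dual to
  each other, in either order. Of the duality only the two inequalities and the passage from
  descent to ascent enter. The chain \<open>\<beta>(S) \<le> \<alpha>(S') \<le> \<beta>(S') \<le> \<alpha>(S) \<le> \<beta>(S)\<close> collapses, the last
  inequality being a consequence of the SVEP.\<close>

proposition semi_Weyl_pair_of_SVEP:
  fixes A :: "'b::complex_banach \<Rightarrow> 'b" and B :: "'c::complex_banach \<Rightarrow> 'c"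
  assumes A: "bounded_clinear A" and svep: "SVEP_at A \<mu>"
    and S: "S = op_shift A \<mu>" "closed (range S)"
    and B: "bounded_clinear B" and S': "S' = op_shift B \<mu>" "upper_semi_Weyl S'"
    and le: "deficiency S \<le> nullity S'" "deficiency S' \<le> nullity S"
    and dual: "\<And>m. range (S ^^ m) = range (S ^^ Suc m) \<Longrightarrow> kernel (S' ^^ m) = kernel (S' ^^ Suc m)"
    and spec: "\<mu> \<in> op_spectrum B"
  shows "\<mu> \<in> finite_rank_left_poles B"
proof -
  have lin: "clinear S" unfolding S(1)
    by (rule bounded_clinear_imp_clinear[OF bounded_clinear_op_shift[OF A]])
  have lin': "clinear S'" unfolding S'(1)
    by (rule bounded_clinear_imp_clinear[OF bounded_clinear_op_shift[OF B]])
  have W: "nullity S' < \<infinity>" "nullity S' \<le> deficiency S'" using S'(2) by (auto simp: upper_semi_Weyl_iff)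
  have fin: "deficiency S < \<infinity>" using le(1) W(1) by (rule le_less_trans)
  obtain m where m: "kernel S \<inter> range (S ^^ m) \<subseteq> {0}"
    using SVEP_imp_kernel_meets_range_trivially[OF A svep] S fin by blast
  have inv: "S ` range (S ^^ m) \<subseteq> range (S ^^ m)"
    unfolding image_range_funpow by (rule range_funpow_antimono) simp
  note meet = nullity_le_deficiency_of_trivial_meet[OF lin csubspace_range[OF clinear_funpow[OF lin]] inv
      finite_codimension_range_funpow[OF lin fin] m]
  have "deficiency S \<le> nullity S" using le W(2) by (meson order_trans)
  then have eq: "nullity S = deficiency S" using meet(1) by simp
  have "S ` range (S ^^ m) = range (S ^^ m)" by (rule meet(2)[OF eq fin])
  then have ker: "kernel (S' ^^ m) = kernel (S' ^^ Suc m)"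
    unfolding image_range_funpow by (intro dual) simp
  have "kernel S' \<noteq> {0}"
  proof
    assume ker0: "kernel S' = {0}"
    then have "nullity S' = 0" using nullity_eq_0_iff[OF lin'] by blast
    then have "deficiency S' = 0" using le eq by simp
    then have "range S' = UNIV" by (rule surj_of_deficiency_0[OF lin'])
    then show False using not_in_op_spectrumI[OF B, of \<mu>] ker0 spec unfolding S'(1) by blast
  qed
  then show ?thesis using finite_rank_left_poleI[OF B, of \<mu> m] S'(2) ker unfolding S'(1) by blast
qed

text \<open>A local solution vanishes near \<open>\<mu>\<close> except possibly at \<open>\<mu>\<close> itself. Composed with a functional
  it is a scalar holomorphic function, which the identity theorem annihilates on the whole
  connected neighbourhood.\<close>

lemma SVEP_at_of_punctured_injectivity:
  fixes T :: "'a::complex_normed_vector \<Rightarrow> 'a"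
  assumes e: "0 < e" and inj: "\<And>\<nu>. \<nu> \<noteq> \<mu> \<Longrightarrow> dist \<mu> \<nu> < e \<Longrightarrow> kernel (op_shift T \<nu>) \<subseteq> {0}"
  shows "SVEP_at T \<mu>"
  unfolding SVEP_at_def
proof (intro allI impI ballI, elim conjE)
  fix U f w assume U: "open U" "connected U" "\<mu> \<in> U" and f: "vector_analytic_on f U"
    and z: "\<forall>\<nu>\<in>U. op_shift T \<nu> (f \<nu>) = 0" and w: "w \<in> U"
  define D where "D = U \<inter> ball \<mu> e - {\<mu>}"
  have fD: "f \<nu> = 0" if "\<nu> \<in> D" for \<nu>
  proof -
    have "f \<nu> \<in> kernel (op_shift T \<nu>)" using z that by (simp add: D_def kernel_def)
    then show ?thesis using inj[of \<nu>] that by (auto simp: D_def)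
  qed
  have lim: "\<mu> islimpt D"
  proof -
    have "\<mu> islimpt (U \<inter> ball \<mu> e)"
      using U e by (intro interior_limit_point) (simp add: interior_open)
    then show ?thesis unfolding D_def islimpt_punctured[of \<mu> "U \<inter> ball \<mu> e"] .
  qed
  have "cdual_apply \<phi> (f w) = 0" for \<phi>
  proof (rule analytic_continuation[where f = "\<lambda>\<nu>. cdual_apply \<phi> (f \<nu>)" and S = U and U = D and \<xi> = \<mu>])
    show "(\<lambda>\<nu>. cdual_apply \<phi> (f \<nu>)) holomorphic_on U"
    proof (rule holomorphic_onI)
      fix \<nu> assume "\<nu> \<in> U"
      then obtain d where "(f has_derivative (\<lambda>h. h *\<^sub>C d)) (at \<nu>)"
        using f unfolding vector_analytic_on_def by blast
      from bounded_linear.has_derivative[OF bounded_clinear_imp_bounded_linear[OF bounded_clinear_cdual_apply] this]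
      have "((\<lambda>\<nu>. cdual_apply \<phi> (f \<nu>)) has_derivative (\<lambda>h. cdual_apply \<phi> d * h)) (at \<nu>)"
        by (simp add: clinear_scale[OF clinear_cdual_apply] scaleC_complex_def mult.commute)
      then have "((\<lambda>\<nu>. cdual_apply \<phi> (f \<nu>)) has_field_derivative cdual_apply \<phi> d) (at \<nu>)"
        by (simp add: has_field_derivative_def)
      then show "(\<lambda>\<nu>. cdual_apply \<phi> (f \<nu>)) field_differentiable (at \<nu> within U)"
        unfolding field_differentiable_def by (blast intro: has_field_derivative_at_within)
    qed
    show "cdual_apply \<phi> (f \<nu>) = 0" if "\<nu> \<in> D" for \<nu>
      using fD[OF that] clinear_0[OF clinear_cdual_apply] by simp
  qed (use U w lim in \<open>auto simp: D_def\<close>)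
  then show "f w = 0" by (rule cdual_separates_points)
qed

text \<open>Where \<open>T - \<nu>\<close> is bounded below, \<open>\<nu>\<close> lies neither in the upper semi-Weyl nor in the
  approximate point spectrum. Were it in the spectrum, property \<open>(az)\<close> would make it a left pole
  and thereby a point of the approximate point spectrum.\<close>

proposition property_az_imp_punctured_resolvent:
  fixes T :: "'a::complex_banach \<Rightarrow> 'a"
  assumes T: "bounded_clinear T" and az: "property_az T" and \<mu>: "\<mu> \<notin> uw_spectrum T"
  obtains e where "0 < e" "\<And>\<nu>. \<nu> \<noteq> \<mu> \<Longrightarrow> dist \<mu> \<nu> < e \<Longrightarrow> \<nu> \<notin> op_spectrum T"
proof -
  define S where "S = op_shift T \<mu>"
  have S: "bounded_clinear S" unfolding S_def by (rule bounded_clinear_op_shift[OF T])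
  have sF: "upper_semi_Fredholm S" using \<mu> by (simp add: uw_spectrum_def upper_semi_Weyl_def S_def)
  have az': "op_spectrum T - uw_spectrum T = finite_rank_left_poles T" using az by (simp add: property_az_def)
  have "\<exists>p. kernel S \<inter> range (S ^^ p) \<subseteq> {0}"
  proof (cases "\<mu> \<in> op_spectrum T")
    case True
    then have "\<mu> \<in> finite_rank_left_poles T" using \<mu> az' by blast
    then show ?thesis unfolding S_def by (rule left_pole_of_finite_rank_semi_Weyl(2)[OF T])
  next
    case False
    then show ?thesis using not_in_op_spectrumD(1)[OF False] unfolding S_def by blast
  qed
  then obtain p where p: "kernel S \<inter> range (S ^^ p) \<subseteq> {0}" by blast
  obtain e where e: "0 < e"
    "\<And>\<nu>. \<nu> \<noteq> 0 \<Longrightarrow> cmod \<nu> < e \<Longrightarrow> \<exists>c>0. \<forall>x. c * norm x \<le> norm (op_shift S \<nu> x)"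
    using bounded_below_punctured_neighbourhood[OF S sF p] by metis
  have "\<nu> \<notin> op_spectrum T" if \<nu>: "\<nu> \<noteq> \<mu>" "dist \<mu> \<nu> < e" for \<nu>
  proof
    assume spec: "\<nu> \<in> op_spectrum T"
    have "op_shift S (\<nu> - \<mu>) = op_shift T \<nu>" by (simp add: S_def op_shift_op_shift)
    then obtain c where c: "0 < c" "\<And>x. c * norm x \<le> norm (op_shift T \<nu> x)"
      using e(2)[of "\<nu> - \<mu>"] \<nu> by (auto simp: dist_norm norm_minus_commute)
    have "\<nu> \<notin> uw_spectrum T"
      using bounded_below_imp_upper_semi_Weyl[OF bounded_clinear_op_shift[OF T] c] by (simp add: uw_spectrum_def)
    then have "\<nu> \<in> approx_point_spectrum T"
      using spec az' by (auto simp: finite_rank_left_poles_def left_pole_def)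
    then show False using bounded_below_not_in_approx_point_spectrum[OF c] by blast
  qed
  then show ?thesis using that e(1) by blast
qed

text \<open>The finite descent of \<open>dual_op S\<close> becomes finite ascent of \<open>S\<close>: if
  \<open>(dual_op S)\<^sup>m \<phi> = (dual_op S)\<^sup>m\<^sup>+\<^sup>1 \<psi>\<close>, then \<open>\<phi> (S\<^sup>m x) = \<psi> (S\<^sup>m\<^sup>+\<^sup>1 x)\<close>, and functionals
  separate points.\<close>

lemma SVEP_dual_imp_property_az:
  fixes T :: "'a::complex_banach \<Rightarrow> 'a"
  assumes T: "bounded_clinear T" and svep: "\<And>\<mu>. \<mu> \<notin> uw_spectrum T \<Longrightarrow> SVEP_at (dual_op T) \<mu>"
  shows "property_az T"
  unfolding property_az_def
proof
  show "op_spectrum T - uw_spectrum T \<subseteq> finite_rank_left_poles T"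
  proof
    fix \<mu> assume \<mu>: "\<mu> \<in> op_spectrum T - uw_spectrum T"
    define S where "S = op_shift T \<mu>"
    have S: "bounded_clinear S" unfolding S_def by (rule bounded_clinear_op_shift[OF T])
    have lin: "clinear S" using bounded_clinear_imp_clinear[OF S] .
    have W: "upper_semi_Weyl S" using \<mu> by (simp add: uw_spectrum_def S_def)
    then have cl: "closed (range S)" by (simp add: upper_semi_Weyl_iff)
    have dual: "dual_op S = op_shift (dual_op T) \<mu>" unfolding S_def by (rule dual_op_shift[OF T])
    have svep': "SVEP_at (dual_op T) \<mu>" using svep \<mu> by blast
    have ker: "kernel (S ^^ m) = kernel (S ^^ Suc m)"
      if m: "range (dual_op S ^^ m) = range (dual_op S ^^ Suc m)" for m
    proof
      show "kernel (S ^^ m) \<subseteq> kernel (S ^^ Suc m)"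
        using clinear_0[OF lin] by (auto simp: kernel_def)
      show "kernel (S ^^ Suc m) \<subseteq> kernel (S ^^ m)"
      proof
        fix x assume x: "x \<in> kernel (S ^^ Suc m)"
        have "cdual_apply \<phi> ((S ^^ m) x) = 0" for \<phi>
        proof -
          obtain \<psi> where \<psi>: "(dual_op S ^^ m) \<phi> = (dual_op S ^^ Suc m) \<psi>" using m by blast
          have "cdual_apply \<phi> ((S ^^ m) x) = cdual_apply \<psi> ((S ^^ Suc m) x)"
            unfolding cdual_apply_dual_op_funpow[OF S, symmetric] \<psi> ..
          also have "\<dots> = 0" using x clinear_0[OF clinear_cdual_apply] by (simp add: kernel_def)
          finally show ?thesis .
        qed
        then have "(S ^^ m) x = 0" by (rule cdual_separates_points)
        then show "x \<in> kernel (S ^^ m)" by (simp add: kernel_def)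
      qed
    qed
    show "\<mu> \<in> finite_rank_left_poles T"
      by (rule semi_Weyl_pair_of_SVEP[OF bounded_clinear_dual_op[OF T] svep' dual closed_range_dual_op[OF S cl]
          T S_def W deficiency_dual_op_le_nullity[OF S cl] deficiency_le_nullity_dual_op[OF S cl] ker])
        (use \<mu> in simp_all)
  qed
qed (rule finite_rank_left_poles_subset[OF T])

text \<open>Closed ranges correspond by the closed range theorem, and the four duality inequalities
  exchange nullity and deficiency up to the inequality that the semi-Weyl condition provides.\<close>

lemma lower_semi_Weyl_dual:
  fixes S :: "'a::complex_banach \<Rightarrow> 'a"
  assumes S: "bounded_clinear S"
  shows "upper_semi_Weyl (dual_op S) \<longleftrightarrow> lower_semi_Weyl S"
proof
  assume W: "upper_semi_Weyl (dual_op S)"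
  then have cl: "closed (range S)"
    using closed_range_of_closed_range_dual_op[OF S] by (simp add: upper_semi_Weyl_iff)
  then show "lower_semi_Weyl S"
    using W deficiency_le_nullity_dual_op[OF S cl] deficiency_dual_op_le_nullity[OF S cl]
    unfolding upper_semi_Weyl_iff lower_semi_Weyl_iff by (meson le_less_trans order_trans)
next
  assume W: "lower_semi_Weyl S"
  then have cl: "closed (range S)" by (simp add: lower_semi_Weyl_iff)
  show "upper_semi_Weyl (dual_op S)"
    using W nullity_dual_op_le_deficiency[OF S] nullity_le_deficiency_dual_op[OF S] closed_range_dual_op[OF S cl]
    unfolding upper_semi_Weyl_iff lower_semi_Weyl_iff by (meson le_less_trans order_trans)
qed

text \<open>The kernel of a power of the dual operator is the annihilator of the range of the same
  power, so the finite descent of \<open>S\<close> directly gives finite ascent of \<open>dual_op S\<close>.\<close>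

lemma SVEP_imp_property_az_dual:
  fixes T :: "'a::complex_banach \<Rightarrow> 'a"
  assumes T: "bounded_clinear T" and svep: "\<And>\<mu>. \<mu> \<notin> lw_spectrum T \<Longrightarrow> SVEP_at T \<mu>"
  shows "property_az (dual_op T)"
  unfolding property_az_def
proof
  have dT: "bounded_clinear (dual_op T)" by (rule bounded_clinear_dual_op[OF T])
  show "op_spectrum (dual_op T) - uw_spectrum (dual_op T) \<subseteq> finite_rank_left_poles (dual_op T)"
  proof
    fix \<mu> assume \<mu>: "\<mu> \<in> op_spectrum (dual_op T) - uw_spectrum (dual_op T)"
    define S where "S = op_shift T \<mu>"
    have S: "bounded_clinear S" unfolding S_def by (rule bounded_clinear_op_shift[OF T])
    have dual: "op_shift (dual_op T) \<mu> = dual_op S" unfolding S_def by (rule dual_op_shift[OF T, symmetric])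
    have W: "upper_semi_Weyl (dual_op S)" using \<mu> by (simp add: uw_spectrum_def dual)
    have lW: "lower_semi_Weyl S" using W lower_semi_Weyl_dual[OF S] by blast
    then have cl: "closed (range S)" by (simp add: lower_semi_Weyl_iff)
    have "\<mu> \<notin> lw_spectrum T" using lW by (simp add: lw_spectrum_def S_def)
    then have svep': "SVEP_at T \<mu>" by (rule svep)
    have "kernel (dual_op S ^^ n) = annihilator (range (S ^^ n))" for n
    proof -
      have "\<phi> \<in> kernel (dual_op S ^^ n) \<longleftrightarrow> (\<forall>x. cdual_apply \<phi> ((S ^^ n) x) = 0)" for \<phi>
        unfolding cdual_apply_dual_op_funpow[OF S, symmetric] kernel_def
        by (auto simp: zero_cdual.rep_eq intro: cdual_eqI)
      then show ?thesis by (auto simp: annihilator_def)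
    qed
    then have ker: "kernel (dual_op S ^^ m) = kernel (dual_op S ^^ Suc m)"
      if "range (S ^^ m) = range (S ^^ Suc m)" for m using that by metis
    show "\<mu> \<in> finite_rank_left_poles (dual_op T)"
      by (rule semi_Weyl_pair_of_SVEP[OF T svep' S_def cl dT dual[symmetric] W
          deficiency_le_nullity_dual_op[OF S cl] deficiency_dual_op_le_nullity[OF S cl] ker])
        (use \<mu> in simp_all)
  qed
  show "finite_rank_left_poles (dual_op T) \<subseteq> op_spectrum (dual_op T) - uw_spectrum (dual_op T)"
    by (rule finite_rank_left_poles_subset[OF dT])
qed

text \<open>A surjective operator has an injective dual.\<close>

lemma property_az_imp_SVEP_dual:
  fixes T :: "'a::complex_banach \<Rightarrow> 'a"
  assumes T: "bounded_clinear T" and az: "property_az T" and \<mu>: "\<mu> \<notin> uw_spectrum T"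
  shows "SVEP_at (dual_op T) \<mu>"
proof -
  obtain e where e: "0 < e" "\<And>\<nu>. \<nu> \<noteq> \<mu> \<Longrightarrow> dist \<mu> \<nu> < e \<Longrightarrow> \<nu> \<notin> op_spectrum T"
    using property_az_imp_punctured_resolvent[OF T az \<mu>] by metis
  show ?thesis
  proof (rule SVEP_at_of_punctured_injectivity[OF e(1)])
    fix \<nu> assume "\<nu> \<noteq> \<mu>" "dist \<mu> \<nu> < e"
    then have "range (op_shift T \<nu>) = UNIV" by (intro not_in_op_spectrumD(2) e(2))
    then show "kernel (op_shift (dual_op T) \<nu>) \<subseteq> {0}"
      using kernel_dual_op_iff[OF bounded_clinear_op_shift[OF T], of _ \<nu>]
      unfolding dual_op_shift[OF T] by (auto intro!: cdual_eqI simp: zero_cdual.rep_eq)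
  qed
qed

text \<open>An operator with surjective dual is injective, because functionals separate points.\<close>

lemma property_az_dual_imp_SVEP:
  fixes T :: "'a::complex_banach \<Rightarrow> 'a"
  assumes T: "bounded_clinear T" and az: "property_az (dual_op T)" and \<mu>: "\<mu> \<notin> lw_spectrum T"
  shows "SVEP_at T \<mu>"
proof -
  have "lower_semi_Weyl (op_shift T \<mu>)" using \<mu> by (simp add: lw_spectrum_def)
  then have "upper_semi_Weyl (dual_op (op_shift T \<mu>))"
    using lower_semi_Weyl_dual[OF bounded_clinear_op_shift[OF T]] by blast
  then have \<mu>': "\<mu> \<notin> uw_spectrum (dual_op T)" by (simp add: uw_spectrum_def dual_op_shift[OF T])
  obtain e where e: "0 < e" "\<And>\<nu>. \<nu> \<noteq> \<mu> \<Longrightarrow> dist \<mu> \<nu> < e \<Longrightarrow> \<nu> \<notin> op_spectrum (dual_op T)"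
    using property_az_imp_punctured_resolvent[OF bounded_clinear_dual_op[OF T] az \<mu>'] by metis
  show ?thesis
  proof (rule SVEP_at_of_punctured_injectivity[OF e(1)])
    fix \<nu> assume "\<nu> \<noteq> \<mu>" "dist \<mu> \<nu> < e"
    then have surj: "range (dual_op (op_shift T \<nu>)) = UNIV"
      unfolding dual_op_shift[OF T] by (intro not_in_op_spectrumD(2) e(2))
    show "kernel (op_shift T \<nu>) \<subseteq> {0}"
    proof
      fix x assume x: "x \<in> kernel (op_shift T \<nu>)"
      have "cdual_apply \<phi> x = 0" for \<phi>
      proof -
        obtain \<psi> where "\<phi> = dual_op (op_shift T \<nu>) \<psi>" using surj by blast
        then show ?thesis using x clinear_0[OF clinear_cdual_apply]
          by (simp add: kernel_def cdual_apply_dual_op[OF bounded_clinear_op_shift[OF T]])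
      qed
      then show "x \<in> {0}" using cdual_separates_points by blast
    qed
  qed
qed

theorem theorem2p2:
  fixes T :: "'a::complex_banach \<Rightarrow> 'a"
  assumes "cdimension (UNIV :: 'a set) = \<infinity>"
    and "bounded_clinear T"
  shows "((\<forall>\<mu>\<in>- uw_spectrum T. SVEP_at (dual_op T) \<mu>) \<longleftrightarrow> property_az T) \<and>
         ((\<forall>\<mu>\<in>- lw_spectrum T. SVEP_at T \<mu>) \<longleftrightarrow> property_az (dual_op T))"
  using SVEP_dual_imp_property_az[OF assms(2)] property_az_imp_SVEP_dual[OF assms(2)]
    SVEP_imp_property_az_dual[OF assms(2)] property_az_dual_imp_SVEP[OF assms(2)]
  by auto

end
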